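(* Let $k$ be a field of prime characteristic $p$, let $A\in pdCom_k$ be a divided powers algebra and let $J\subset A_+$ be a $p$-ideal of $A$. There is an exact sequence of $V(A/J)$-modules $$J/J^2\xrightarrow{\ \phi\ }\Omega_p(A)\otimes_A A/J\xrightarrow{\ \psi\ }\Omega_p(A/J)\to 0,$$ where $\phi(x+J^2)=d(x)\otimes(1+J)$ for $x\in J$ and $\psi\big(d(t)\otimes(a+J)\big)=(a+J)\,d(t+J)$ for $t,a\in A$.
   Context: Let $k$ be a field of prime characteristic $p$. An object of $pdCom_k$ (a divided powers algebra) is a pair $(A,\pi)$ where $A=k\oplus A_+$ is a commutative augmented $k$-algebra with augmentation ideal $A_+$, and $\pi:A_+\to A_+$ is a map (the $p$-map) such that: $x^p=0$; $\pi(x+y)=\pi(x)+\pi(y)+\sum_{j=1}^{p-1}\frac{(-1)^j}{j}x^jy^{p-j}$; $\pi(xy)=0$; $\pi(\lambda x)=\lambda^p\pi(x)$, for all $x,y\in A_+$, $\lambda\in k$. An ideal $J\subset A_+$ is a $p$-ideal if $\pi(J)\subset J$; then $A/J$ is an object of $pdCom_k$ with the induced $p$-map. Let $k[P]=\{\sum_{i}\lambda_iP^i\}$ be the skew polynomial ring with $P\lambda=\lambda^pP$ for $\lambda\in k$. The ring $V(A)$ has underlying $k$-module $A\otimes_k k[P]$, with multiplication determined by $(a\otimes1)(a'\otimes1)=aa'\otimes1$, $(1\otimes q)(1\otimes q')=1\otimes qq'$, $(a\otimes1)(1\otimes P)=a\otimes P$; $(1\otimes P)(a\otimes1)=0$ for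 $a\in A_+$; $(1\otimes P)(\lambda\otimes1)=\lambda^p\otimes P$ for $\lambda\in k$. For a $V(A)$-module $M$ write $Pm=(1\otimes P)m$, $am=(a\otimes1)m$. $\Omega_p(A)$ is the $V(A)$-module generated by symbols $da$, $a\in A$, with relations $d(\lambda)=0$, $d(\lambda a+\mu b)=\lambda\,da+\mu\,db$, $d(ab)=a\,db+b\,da$, $d(\pi(c))=P\,dc-c^{p-1}dc$, for $a,b\in A$, $c\in A_+$, $\lambda,\mu\in k$. Module structures: $J/J^2$ is a $V(A/J)$-module with its usual $A/J$-module structure and $P(x+J^2)=\pi(x)+J^2$; $\Omega_p(A)\otimes_AA/J$ is a $V(A/J)$-module with its usual $A/J$-module structure and $P(w\otimes(a+J))=a^pPw\otimes(1+J)$ for $w\in\Omega_p(A)$, $a\in A$. *)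

theory Defs
  imports "HOL-Computational_Algebra.Primes" "HOL-Algebra.Module" "HOL-Algebra.QuotRing"
    "HOL-Algebra.Ideal_Product"
begin

section \<open>Modules over a possibly noncommutative ring\<close>

text \<open>
  The library's locale \<open>module\<close> requires a commutative ring of scalars. As there, a module
  is a record extending a ring record, whose fields \<open>mult\<close> and \<open>one\<close> carry no meaning.
\<close>

locale left_module = R?: ring R + M?: abelian_group M
  for R :: "('r, 'u) ring_scheme" (structure)
    and M :: "('r, 'm, 'v) module_scheme" (structure) +
  assumes smult_closed:
      "\<lbrakk>a \<in> carrier R; x \<in> carrier M\<rbrakk> \<Longrightarrow> a \<odot>\<^bsub>M\<^esub> x \<in> carrier M"
    and smult_l_distr:
      "\<lbrakk>a \<in> carrier R; b \<in> carrier R; x \<in> carrier M\<rbrakk> \<Longrightarrow>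
        (a \<oplus> b) \<odot>\<^bsub>M\<^esub> x = a \<odot>\<^bsub>M\<^esub> x \<oplus>\<^bsub>M\<^esub> b \<odot>\<^bsub>M\<^esub> x"
    and smult_r_distr:
      "\<lbrakk>a \<in> carrier R; x \<in> carrier M; y \<in> carrier M\<rbrakk> \<Longrightarrow>
        a \<odot>\<^bsub>M\<^esub> (x \<oplus>\<^bsub>M\<^esub> y) = a \<odot>\<^bsub>M\<^esub> x \<oplus>\<^bsub>M\<^esub> a \<odot>\<^bsub>M\<^esub> y"
    and smult_assoc:
      "\<lbrakk>a \<in> carrier R; b \<in> carrier R; x \<in> carrier M\<rbrakk> \<Longrightarrow>
        (a \<otimes> b) \<odot>\<^bsub>M\<^esub> x = a \<odot>\<^bsub>M\<^esub> (b \<odot>\<^bsub>M\<^esub> x)"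
    and smult_one: "x \<in> carrier M \<Longrightarrow> \<one> \<odot>\<^bsub>M\<^esub> x = x"

definition left_module_hom ::
  "('r, 'u) ring_scheme \<Rightarrow> ('r, 'm, 'v) module_scheme \<Rightarrow> ('r, 'n, 'w) module_scheme
    \<Rightarrow> ('m \<Rightarrow> 'n) set" where
  "left_module_hom R M N =
    {h \<in> hom (add_monoid M) (add_monoid N).
      \<forall>r\<in>carrier R. \<forall>x\<in>carrier M. h (r \<odot>\<^bsub>M\<^esub> x) = r \<odot>\<^bsub>N\<^esub> h x}"

definition regular_module :: "('r, 'u) ring_scheme \<Rightarrow> ('r, 'r) module" where
  "regular_module R = \<lparr>carrier = carrier R, mult = mult R, one = one R,
     zero = zero R, add = add R, smult = mult R\<rparr>"

definition restrict_scalars ::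
  "('s \<Rightarrow> 'r) \<Rightarrow> ('r, 'm, 'u) module_scheme \<Rightarrow> ('s, 'm) module" where
  "restrict_scalars h M = \<lparr>carrier = carrier M, mult = mult M, one = one M,
     zero = zero M, add = add M, smult = (\<lambda>s. smult M (h s))\<rparr>"

definition quot_module :: "('r, 'm, 'u) module_scheme \<Rightarrow> 'm set \<Rightarrow> ('r, 'm set) module" where
  "quot_module M N = \<lparr>carrier = a_rcosets\<^bsub>M\<^esub> N, mult = undefined, one = undefined,
     zero = N, add = set_add M, smult = (\<lambda>r X. \<Union>x\<in>X. N +>\<^bsub>M\<^esub> (r \<odot>\<^bsub>M\<^esub> x))\<rparr>"

definition module_span ::
  "('r, 'u) ring_scheme \<Rightarrow> ('r, 'm, 'v) module_scheme \<Rightarrow> 'm set \<Rightarrow> 'm set" where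
  "module_span R M S = \<Inter>{N. submodule N R M \<and> S \<subseteq> N}"

text \<open>The free left module on \<open>X\<close>: finitely supported functions, zero outside \<open>X\<close>.\<close>

definition free_module :: "('r, 'u) ring_scheme \<Rightarrow> 'x set \<Rightarrow> ('r, 'x \<Rightarrow> 'r) module" where
  "free_module R X =
    \<lparr>carrier = {f. (\<forall>x\<in>X. f x \<in> carrier R) \<and> (\<forall>x. x \<notin> X \<longrightarrow> f x = \<zero>\<^bsub>R\<^esub>)
                  \<and> finite {x. f x \<noteq> \<zero>\<^bsub>R\<^esub>}},
     mult = undefined, one = undefined,
     zero = (\<lambda>x. \<zero>\<^bsub>R\<^esub>), add = (\<lambda>f g x. f x \<oplus>\<^bsub>R\<^esub> g x), smult = (\<lambda>r f x. r \<otimes>\<^bsub>R\<^esub> f x)\<rparr>"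

definition free_gen :: "('r, 'u) ring_scheme \<Rightarrow> 'x \<Rightarrow> 'x \<Rightarrow> 'r" where
  "free_gen R x = (\<lambda>y. if y = x then \<one>\<^bsub>R\<^esub> else \<zero>\<^bsub>R\<^esub>)"

text \<open>
  The tensor product of modules over a commutative ring, as the free module on pairs modulo
  the bilinearity relations.
\<close>

definition tensor_rels ::
  "('r, 'u) ring_scheme \<Rightarrow> ('r, 'm, 'v) module_scheme \<Rightarrow> ('r, 'n, 'w) module_scheme
    \<Rightarrow> ('m \<times> 'n \<Rightarrow> 'r) set" where
  "tensor_rels R M N =
    (let F = free_module R (carrier M \<times> carrier N); e = free_gen R in
      {e (x \<oplus>\<^bsub>M\<^esub> x', y) \<ominus>\<^bsub>F\<^esub> (e (x, y) \<oplus>\<^bsub>F\<^esub> e (x', y)) | x x' y.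
          x \<in> carrier M \<and> x' \<in> carrier M \<and> y \<in> carrier N}
    \<union> {e (x, y \<oplus>\<^bsub>N\<^esub> y') \<ominus>\<^bsub>F\<^esub> (e (x, y) \<oplus>\<^bsub>F\<^esub> e (x, y')) | x y y'.
          x \<in> carrier M \<and> y \<in> carrier N \<and> y' \<in> carrier N}
    \<union> {e (r \<odot>\<^bsub>M\<^esub> x, y) \<ominus>\<^bsub>F\<^esub> r \<odot>\<^bsub>F\<^esub> e (x, y) | r x y.
          r \<in> carrier R \<and> x \<in> carrier M \<and> y \<in> carrier N}
    \<union> {e (x, r \<odot>\<^bsub>N\<^esub> y) \<ominus>\<^bsub>F\<^esub> r \<odot>\<^bsub>F\<^esub> e (x, y) | r x y.
          r \<in> carrier R \<and> x \<in> carrier M \<and> y \<in> carrier N})"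

definition tensor ::
  "('r, 'u) ring_scheme \<Rightarrow> ('r, 'm, 'v) module_scheme \<Rightarrow> ('r, 'n, 'w) module_scheme
    \<Rightarrow> ('r, ('m \<times> 'n \<Rightarrow> 'r) set) module" where
  "tensor R M N =
    (let F = free_module R (carrier M \<times> carrier N)
     in quot_module F (module_span R F (tensor_rels R M N)))"

definition tensor_elt ::
  "('r, 'u) ring_scheme \<Rightarrow> ('r, 'm, 'v) module_scheme \<Rightarrow> ('r, 'n, 'w) module_scheme
    \<Rightarrow> 'm \<Rightarrow> 'n \<Rightarrow> ('m \<times> 'n \<Rightarrow> 'r) set" where
  "tensor_elt R M N x y =
    (let F = free_module R (carrier M \<times> carrier N)
     in module_span R F (tensor_rels R M N) +>\<^bsub>F\<^esub> free_gen R (x, y))"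

section \<open>Divided powers algebras in characteristic p\<close>

text \<open>The field \<open>smult\<close> of the record is the action of the ground field.\<close>

record ('k, 'a) pd_alg = "('k, 'a) module" +
  aug :: "'a \<Rightarrow> 'k"
  pmap :: "'a \<Rightarrow> 'a"

definition aug_ideal :: "('k, 'u) ring_scheme \<Rightarrow> ('k, 'a, 'v) pd_alg_scheme \<Rightarrow> 'a set" where
  "aug_ideal k A = a_kernel A k (aug A)"

text \<open>
  In a field of characteristic \<open>p\<close> the numbers \<open>1, \<dots>, p - 1\<close> are invertible, so
  the coefficient \<open>(-1)^j / j\<close> makes sense.
\<close>

definition pmap_coeff :: "('k, 'u) ring_scheme \<Rightarrow> nat \<Rightarrow> 'k" where
  "pmap_coeff k j = (\<ominus>\<^bsub>k\<^esub> \<one>\<^bsub>k\<^esub>) [^]\<^bsub>k\<^esub> j \<otimes>\<^bsub>k\<^esub> inv\<^bsub>k\<^esub> ([j] \<cdot>\<^bsub>k\<^esub> \<one>\<^bsub>k\<^esub>)"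

locale pd_algebra =
  fixes k :: "('k, 'u) ring_scheme" and p :: nat and A :: "('k, 'a, 'v) pd_alg_scheme"
  assumes field: "field k"
    and prime: "prime p"
    and char_p: "[p] \<cdot>\<^bsub>k\<^esub> \<one>\<^bsub>k\<^esub> = \<zero>\<^bsub>k\<^esub>"
    and algebra: "algebra k A"
    and aug_hom: "aug A \<in> ring_hom A k"
    and aug_smult:
      "\<lbrakk>l \<in> carrier k; a \<in> carrier A\<rbrakk> \<Longrightarrow> aug A (l \<odot>\<^bsub>A\<^esub> a) = l \<otimes>\<^bsub>k\<^esub> aug A a"
    and pmap_closed: "x \<in> aug_ideal k A \<Longrightarrow> pmap A x \<in> aug_ideal k A"
    and pow_p: "x \<in> aug_ideal k A \<Longrightarrow> x [^]\<^bsub>A\<^esub> p = \<zero>\<^bsub>A\<^esub>"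
    and pmap_add:
      "\<lbrakk>x \<in> aug_ideal k A; y \<in> aug_ideal k A\<rbrakk> \<Longrightarrow>
        pmap A (x \<oplus>\<^bsub>A\<^esub> y) = pmap A x \<oplus>\<^bsub>A\<^esub> pmap A y \<oplus>\<^bsub>A\<^esub>
          (\<Oplus>\<^bsub>A\<^esub>j\<in>{1..p - 1}. pmap_coeff k j \<odot>\<^bsub>A\<^esub> (x [^]\<^bsub>A\<^esub> j \<otimes>\<^bsub>A\<^esub> y [^]\<^bsub>A\<^esub> (p - j)))"
    and pmap_mult:
      "\<lbrakk>x \<in> aug_ideal k A; y \<in> aug_ideal k A\<rbrakk> \<Longrightarrow> pmap A (x \<otimes>\<^bsub>A\<^esub> y) = \<zero>\<^bsub>A\<^esub>"
    and pmap_smult: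
      "\<lbrakk>l \<in> carrier k; x \<in> aug_ideal k A\<rbrakk> \<Longrightarrow>
        pmap A (l \<odot>\<^bsub>A\<^esub> x) = (l [^]\<^bsub>k\<^esub> p) \<odot>\<^bsub>A\<^esub> pmap A x"

definition p_ideal ::
  "('k, 'u) ring_scheme \<Rightarrow> ('k, 'a, 'v) pd_alg_scheme \<Rightarrow> 'a set \<Rightarrow> bool" where
  "p_ideal k A J \<longleftrightarrow> ideal J A \<and> J \<subseteq> aug_ideal k A \<and> pmap A ` J \<subseteq> J"

definition pd_quot :: "('k, 'a, 'v) pd_alg_scheme \<Rightarrow> 'a set \<Rightarrow> ('k, 'a set) pd_alg" where
  "pd_quot A J =
    \<lparr>carrier = carrier (A Quot J), mult = mult (A Quot J), one = one (A Quot J),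
     zero = zero (A Quot J), add = add (A Quot J),
     smult = (\<lambda>l X. \<Union>x\<in>X. J +>\<^bsub>A\<^esub> (l \<odot>\<^bsub>A\<^esub> x)),
     aug = (\<lambda>X. the_elem (aug A ` X)),
     pmap = (\<lambda>X. \<Union>x\<in>X. J +>\<^bsub>A\<^esub> pmap A x)\<rparr>"

section \<open>The ring V(A) and its modules\<close>

text \<open>
  Since \<open>k[P]\<close> is free as a left \<open>k\<close>-module on the powers of \<open>P\<close>, every element of
  \<open>A \<otimes> k[P]\<close> is uniquely a finite sum of terms \<open>f n \<otimes> P^n\<close>, and is encoded by
  the finitely supported function \<open>f\<close>. Writing \<open>b = \<epsilon>(b) + b\<^sub>+\<close>, the rules for
  \<open>P b\<close> combine to \<open>P^i b = \<epsilon>(b)^(p^i) P^i\<close> for \<open>i \<ge> 1\<close>, so that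
  \<open>P^i b = V_twist i b P^i\<close> for all \<open>i\<close>.
\<close>

definition V_twist ::
  "('k, 'u) ring_scheme \<Rightarrow> nat \<Rightarrow> ('k, 'a, 'v) pd_alg_scheme \<Rightarrow> nat \<Rightarrow> 'a \<Rightarrow> 'a" where
  "V_twist k p A i b =
    (if i = 0 then b else (aug A b [^]\<^bsub>k\<^esub> (p ^ i)) \<odot>\<^bsub>A\<^esub> \<one>\<^bsub>A\<^esub>)"

text \<open>\<open>V_monom A a n\<close> is \<open>a \<otimes> P^n\<close>.\<close>

definition V_monom :: "('a, 'u) ring_scheme \<Rightarrow> 'a \<Rightarrow> nat \<Rightarrow> nat \<Rightarrow> 'a" where
  "V_monom A a n = (\<lambda>m. if m = n then a else \<zero>\<^bsub>A\<^esub>)"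

definition V_ring ::
  "('k, 'u) ring_scheme \<Rightarrow> nat \<Rightarrow> ('k, 'a, 'v) pd_alg_scheme \<Rightarrow> (nat \<Rightarrow> 'a) ring" where
  "V_ring k p A =
    \<lparr>carrier = carrier (free_module A (UNIV :: nat set)),
     mult = (\<lambda>f g n. \<Oplus>\<^bsub>A\<^esub>i\<in>{..n}. f i \<otimes>\<^bsub>A\<^esub> V_twist k p A i (g (n - i))),
     one = V_monom A \<one>\<^bsub>A\<^esub> 0,
     zero = zero (free_module A (UNIV :: nat set)),
     add = add (free_module A (UNIV :: nat set))\<rparr>"

abbreviation V_const :: "('a, 'u) ring_scheme \<Rightarrow> 'a \<Rightarrow> nat \<Rightarrow> 'a" where
  "V_const A a \<equiv> V_monom A a 0"

abbreviation V_P :: "('a, 'u) ring_scheme \<Rightarrow> nat \<Rightarrow> 'a" where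
  "V_P A \<equiv> V_monom A \<one>\<^bsub>A\<^esub> 1"

lemma V_monom_mult:
  assumes "pd_algebra k p A" "a \<in> carrier A" "b \<in> carrier A"
  shows "V_monom A a i \<otimes>\<^bsub>V_ring k p A\<^esub> V_monom A b j
    = V_monom A (a \<otimes>\<^bsub>A\<^esub> V_twist k p A i b) (i + j)"
proof
  interpret pd_algebra k p A by fact
  interpret k: field k by (rule field)
  interpret R: cring A using algebra by (rule algebra.M_cring)
  interpret A: algebra k A by (rule algebra)
  interpret e: ring_hom_ring A k "aug A"
    by (rule ring_hom_ringI2) (simp_all add: R.ring_axioms k.ring_axioms aug_hom)
  fix n
  have tw: "V_twist k p A l c \<in> carrier A" if "c \<in> carrier A" for l c
    using that by (simp add: V_twist_def)
  have tw0: "V_twist k p A l \<zero>\<^bsub>A\<^esub> = \<zero>\<^bsub>A\<^esub>" for l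
    using prime by (simp add: V_twist_def k.nat_pow_zero prime_gt_0_nat)
  let ?g = "\<lambda>l. a \<otimes>\<^bsub>A\<^esub> V_twist k p A l (V_monom A b j (n - l))"
  have g: "?g \<in> {..n} \<rightarrow> carrier A"
    using assms(2,3) by (auto simp: V_monom_def intro!: tw)
  have "(V_monom A a i \<otimes>\<^bsub>V_ring k p A\<^esub> V_monom A b j) n
      = (\<Oplus>\<^bsub>A\<^esub>l\<in>{..n}. if i = l then ?g l else \<zero>\<^bsub>A\<^esub>)"
    using assms(2,3) g
    by (auto simp: V_ring_def V_monom_def tw tw0 intro!: R.finsum_cong')
  also have "\<dots> = V_monom A (a \<otimes>\<^bsub>A\<^esub> V_twist k p A i b) (i + j) n"
  proof (cases "i \<le> n")
    case True
    have "(\<Oplus>\<^bsub>A\<^esub>l\<in>{..n}. if i = l then ?g l else \<zero>\<^bsub>A\<^esub>) = ?g i"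
      by (rule R.finsum_singleton) (use True g in auto)
    with True assms(2) show ?thesis by (auto simp: V_monom_def tw0)
  next
    case False
    then have "(\<Oplus>\<^bsub>A\<^esub>l\<in>{..n}. if i = l then ?g l else \<zero>\<^bsub>A\<^esub>) = (\<Oplus>\<^bsub>A\<^esub>l\<in>{..n}. \<zero>\<^bsub>A\<^esub>)"
      by (intro R.finsum_cong') auto
    with False show ?thesis by (simp add: V_monom_def)
  qed
  finally show "(V_monom A a i \<otimes>\<^bsub>V_ring k p A\<^esub> V_monom A b j) n
    = V_monom A (a \<otimes>\<^bsub>A\<^esub> V_twist k p A i b) (i + j) n" .
qed

text \<open>
  The structure on a \<open>B\<close>-module \<open>M\<close> in which \<open>P\<close> acts as the operator \<open>F\<close>: the element
  \<open>\<Sum>n. f n \<otimes> P^n\<close> sends \<open>m\<close> to \<open>\<Sum>n. f n (F^n m)\<close>.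
\<close>

definition V_module_of ::
  "('b, 'u) ring_scheme \<Rightarrow> ('b, 'm, 'v) module_scheme \<Rightarrow> ('m \<Rightarrow> 'm)
    \<Rightarrow> (nat \<Rightarrow> 'b, 'm) module" where
  "V_module_of B M F =
    \<lparr>carrier = carrier M, mult = mult M, one = one M, zero = zero M, add = add M,
     smult = (\<lambda>f m. \<Oplus>\<^bsub>M\<^esub>n\<in>{n. f n \<noteq> \<zero>\<^bsub>B\<^esub>}. f n \<odot>\<^bsub>M\<^esub> (F ^^ n) m)\<rparr>"

text \<open>
  An \<open>A\<close>-module annihilated by \<open>J\<close> as an \<open>A/J\<close>-module: a coset acts through any of
  its elements.
\<close>

definition descend_scalars ::
  "('a, 'm, 'u) module_scheme \<Rightarrow> ('a set, 'm) module" where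
  "descend_scalars M = \<lparr>carrier = carrier M, mult = mult M, one = one M,
     zero = zero M, add = add M, smult = (\<lambda>X m. the_elem ((\<lambda>a. a \<odot>\<^bsub>M\<^esub> m) ` X))\<rparr>"

section \<open>Differentials\<close>

definition Omega_rels ::
  "('k, 'u) ring_scheme \<Rightarrow> nat \<Rightarrow> ('k, 'a, 'v) pd_alg_scheme \<Rightarrow> ('a \<Rightarrow> nat \<Rightarrow> 'a) set" where
  "Omega_rels k p A =
    (let V = V_ring k p A; F = free_module V (carrier A); e = free_gen V;
         c = (\<lambda>l. V_const A (l \<odot>\<^bsub>A\<^esub> \<one>\<^bsub>A\<^esub>))
     in
      {e (l \<odot>\<^bsub>A\<^esub> \<one>\<^bsub>A\<^esub>) | l. l \<in> carrier k}
    \<union> {e (l \<odot>\<^bsub>A\<^esub> a \<oplus>\<^bsub>A\<^esub> m \<odot>\<^bsub>A\<^esub> b) \<ominus>\<^bsub>F\<^esub> (c l \<odot>\<^bsub>F\<^esub> e a \<oplus>\<^bsub>F\<^esub> c m \<odot>\<^bsub>F\<^esub> e b) | l m a b.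
          l \<in> carrier k \<and> m \<in> carrier k \<and> a \<in> carrier A \<and> b \<in> carrier A}
    \<union> {e (a \<otimes>\<^bsub>A\<^esub> b) \<ominus>\<^bsub>F\<^esub> (V_const A a \<odot>\<^bsub>F\<^esub> e b \<oplus>\<^bsub>F\<^esub> V_const A b \<odot>\<^bsub>F\<^esub> e a) | a b.
          a \<in> carrier A \<and> b \<in> carrier A}
    \<union> {e (pmap A x) \<ominus>\<^bsub>F\<^esub>
          (V_P A \<odot>\<^bsub>F\<^esub> e x \<ominus>\<^bsub>F\<^esub> V_const A (x [^]\<^bsub>A\<^esub> (p - 1)) \<odot>\<^bsub>F\<^esub> e x) | x.
          x \<in> aug_ideal k A})"

definition Omega ::
  "('k, 'u) ring_scheme \<Rightarrow> nat \<Rightarrow> ('k, 'a, 'v) pd_alg_scheme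
    \<Rightarrow> (nat \<Rightarrow> 'a, ('a \<Rightarrow> nat \<Rightarrow> 'a) set) module" where
  "Omega k p A =
    (let V = V_ring k p A; F = free_module V (carrier A)
     in quot_module F (module_span V F (Omega_rels k p A)))"

definition Omega_d ::
  "('k, 'u) ring_scheme \<Rightarrow> nat \<Rightarrow> ('k, 'a, 'v) pd_alg_scheme
    \<Rightarrow> 'a \<Rightarrow> ('a \<Rightarrow> nat \<Rightarrow> 'a) set" where
  "Omega_d k p A a =
    (let V = V_ring k p A; F = free_module V (carrier A)
     in module_span V F (Omega_rels k p A) +>\<^bsub>F\<^esub> free_gen V a)"

section \<open>The modules over V(A/J)\<close>

text \<open>\<open>J/J\<^sup>2\<close>, where \<open>J\<^sup>2\<close> is the ideal product \<open>J \<cdot>\<^bsub>A\<^esub> J\<close>.\<close>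

definition conormal ::
  "('k, 'a, 'v) pd_alg_scheme \<Rightarrow> 'a set \<Rightarrow> (nat \<Rightarrow> 'a set, 'a set) module" where
  "conormal A J =
    V_module_of (pd_quot A J)
      (descend_scalars (quot_module (regular_module A\<lparr>carrier := J\<rparr>) (J \<cdot>\<^bsub>A\<^esub> J)))
      (\<lambda>X. \<Union>x\<in>X. (J \<cdot>\<^bsub>A\<^esub> J) +>\<^bsub>A\<^esub> pmap A x)"

definition Omega_as_A_module ::
  "('k, 'u) ring_scheme \<Rightarrow> nat \<Rightarrow> ('k, 'a, 'v) pd_alg_scheme
    \<Rightarrow> ('a, ('a \<Rightarrow> nat \<Rightarrow> 'a) set) module" where
  "Omega_as_A_module k p A = restrict_scalars (V_const A) (Omega k p A)"

definition Omega_tensor ::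
  "('k, 'u) ring_scheme \<Rightarrow> nat \<Rightarrow> ('k, 'a, 'v) pd_alg_scheme \<Rightarrow> 'a set
    \<Rightarrow> ('a, (('a \<Rightarrow> nat \<Rightarrow> 'a) set \<times> 'a set \<Rightarrow> 'a) set) module" where
  "Omega_tensor k p A J =
    tensor A (Omega_as_A_module k p A) (quot_module (regular_module A) J)"

definition Omega_tensor_elt ::
  "('k, 'u) ring_scheme \<Rightarrow> nat \<Rightarrow> ('k, 'a, 'v) pd_alg_scheme \<Rightarrow> 'a set
    \<Rightarrow> ('a \<Rightarrow> nat \<Rightarrow> 'a) set \<Rightarrow> 'a set \<Rightarrow> (('a \<Rightarrow> nat \<Rightarrow> 'a) set \<times> 'a set \<Rightarrow> 'a) set" where
  "Omega_tensor_elt k p A J w X =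
    tensor_elt A (Omega_as_A_module k p A) (quot_module (regular_module A) J) w X"

text \<open>The unique additive operator with \<open>P(w \<otimes> (a + J)) = a^p P w \<otimes> (1 + J)\<close>.\<close>

definition Omega_tensor_P ::
  "('k, 'u) ring_scheme \<Rightarrow> nat \<Rightarrow> ('k, 'a, 'v) pd_alg_scheme \<Rightarrow> 'a set
    \<Rightarrow> (('a \<Rightarrow> nat \<Rightarrow> 'a) set \<times> 'a set \<Rightarrow> 'a) set
    \<Rightarrow> (('a \<Rightarrow> nat \<Rightarrow> 'a) set \<times> 'a set \<Rightarrow> 'a) set" where
  "Omega_tensor_P k p A J =
    (let T = Omega_tensor k p A J; W = Omega k p A in
     THE F. F \<in> extensional (carrier T) \<and> F \<in> hom (add_monoid T) (add_monoid T) \<and>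
       (\<forall>w\<in>carrier W. \<forall>a\<in>carrier A.
          F (Omega_tensor_elt k p A J w (J +>\<^bsub>A\<^esub> a)) =
          Omega_tensor_elt k p A J
            (V_const A (a [^]\<^bsub>A\<^esub> p) \<odot>\<^bsub>W\<^esub> (V_P A \<odot>\<^bsub>W\<^esub> w)) (J +>\<^bsub>A\<^esub> \<one>\<^bsub>A\<^esub>)))"

definition Omega_base_change ::
  "('k, 'u) ring_scheme \<Rightarrow> nat \<Rightarrow> ('k, 'a, 'v) pd_alg_scheme \<Rightarrow> 'a set
    \<Rightarrow> (nat \<Rightarrow> 'a set, (('a \<Rightarrow> nat \<Rightarrow> 'a) set \<times> 'a set \<Rightarrow> 'a) set) module" where
  "Omega_base_change k p A J =
    V_module_of (pd_quot A J) (descend_scalars (Omega_tensor k p A J)) (Omega_tensor_P k p A J)"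

end

theory Submission
  imports Defs
begin

text \<open>
  Both \<open>\<Omega>\<^sub>p(A)\<close> and the tensor product are modules given by generators and relations, so all maps
  out of them come from one universal property. Every element of \<open>\<Omega>\<^sub>p(A) \<otimes> A/J\<close> has the form
  \<open>w \<otimes> 1\<close>, and \<open>w \<mapsto> w \<otimes> 1\<close> is linear over \<open>V(A) \<rightarrow> V(A/J)\<close>; hence \<open>\<psi>\<close> is determined by
  \<open>\<psi>(w \<otimes> 1) = \<Omega>(w)\<close>, where \<open>\<Omega>\<close> is the induced map \<open>\<Omega>\<^sub>p(A) \<rightarrow> \<Omega>\<^sub>p(A/J)\<close>. For exactness in the
  middle, \<open>t + J \<mapsto> d t \<otimes> 1\<close> is a well-defined derivation modulo the image of \<open>\<phi>\<close> that satisfies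
  the relation for the p-map, so it induces \<open>\<Omega>\<^sub>p(A/J) \<rightarrow> coker \<phi>\<close>, and composing with \<open>\<psi>\<close> gives
  back the projection onto \<open>coker \<phi>\<close>.
\<close>

section \<open>Left modules\<close>

text \<open>V(A) is in general not commutative, so the tensor product is formed over A alone and P
  has to be put on it afterwards. This rests on one computation: a = \<epsilon>(a) + a_+ and a_+^p =
  0 give a^p = \<epsilon>(a)^p. Hence the two rules for moving P past A merge into P a = a^p P for
  every a, and a V(A)-module amounts to an A-module with an additive operator that is semilinear
  over a \<mapsto> a^p. J/J^2 and the tensor product are built as such pairs, and \<phi> and \<psi>
  are obtained over A and then checked to commute with P. The p-map is not additive, but its defect
  consists of terms x^j y^(p-j) with both exponents positive. It is therefore additive modulo J as
  soon as one argument is in J, which lets it pass to A/J, and additive modulo J^2 when both are,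
  which makes it an operator on J/J^2. The term c^(p-1) dc in the relation for d(\<pi>(c)) threatens
  the compatibility of \<phi> with P; as p - 1 is positive, tensoring with A/J kills it when c lies
  in J.\<close>

lemma (in abelian_group) minus_eq_zero_iff:
  "\<lbrakk>x \<in> carrier G; y \<in> carrier G\<rbrakk> \<Longrightarrow> x \<ominus> y = \<zero> \<longleftrightarrow> x = y"
  using minus_equality[of x "\<ominus> y"] by (auto simp: a_minus_def r_neg)

text \<open>The module records below differ from one another in \<open>smult\<close>,
  \<open>mult\<close> and \<open>one\<close> while sharing the additive group, which is all that is
  carried across here.\<close>

lemma abelian_group_transfer:
  assumes "abelian_group G" "carrier H = carrier G" "add H = add G" "zero H = zero G"
  shows "abelian_group H"
proof -
  interpret abelian_group G by fact
  show ?thesis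
    by (rule abelian_groupI) (auto simp: assms(2-) a_assoc a_comm a_lcomm intro: add.l_inv_ex)
qed

lemma left_moduleI:
  fixes R (structure) and M (structure)
  assumes "ring R" "abelian_group M"
    and "\<And>a x. \<lbrakk>a \<in> carrier R; x \<in> carrier M\<rbrakk> \<Longrightarrow> a \<odot>\<^bsub>M\<^esub> x \<in> carrier M"
    and "\<And>a b x. \<lbrakk>a \<in> carrier R; b \<in> carrier R; x \<in> carrier M\<rbrakk> \<Longrightarrow>
      (a \<oplus>\<^bsub>R\<^esub> b) \<odot>\<^bsub>M\<^esub> x = a \<odot>\<^bsub>M\<^esub> x \<oplus>\<^bsub>M\<^esub> b \<odot>\<^bsub>M\<^esub> x"
    and "\<And>a x y. \<lbrakk>a \<in> carrier R; x \<in> carrier M; y \<in> carrier M\<rbrakk> \<Longrightarrow>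
      a \<odot>\<^bsub>M\<^esub> (x \<oplus>\<^bsub>M\<^esub> y) = a \<odot>\<^bsub>M\<^esub> x \<oplus>\<^bsub>M\<^esub> a \<odot>\<^bsub>M\<^esub> y"
    and "\<And>a b x. \<lbrakk>a \<in> carrier R; b \<in> carrier R; x \<in> carrier M\<rbrakk> \<Longrightarrow>
      (a \<otimes>\<^bsub>R\<^esub> b) \<odot>\<^bsub>M\<^esub> x = a \<odot>\<^bsub>M\<^esub> (b \<odot>\<^bsub>M\<^esub> x)"
    and "\<And>x. x \<in> carrier M \<Longrightarrow> \<one>\<^bsub>R\<^esub> \<odot>\<^bsub>M\<^esub> x = x"
  shows "left_module R M"
  using assms by (auto simp: left_module_def left_module_axioms_def)

context left_module
begin

lemma smult_l_null: "x \<in> carrier M \<Longrightarrow> \<zero>\<^bsub>R\<^esub> \<odot>\<^bsub>M\<^esub> x = \<zero>\<^bsub>M\<^esub>"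
  using smult_l_distr[of "\<zero>\<^bsub>R\<^esub>" "\<zero>\<^bsub>R\<^esub>" x] smult_closed[of "\<zero>\<^bsub>R\<^esub>" x]
  by (metis M.add.r_cancel_one' R.l_zero R.zero_closed)

lemma smult_r_null: "a \<in> carrier R \<Longrightarrow> a \<odot>\<^bsub>M\<^esub> \<zero>\<^bsub>M\<^esub> = \<zero>\<^bsub>M\<^esub>"
  using smult_r_distr[of a "\<zero>\<^bsub>M\<^esub>" "\<zero>\<^bsub>M\<^esub>"] smult_closed[of a "\<zero>\<^bsub>M\<^esub>"]
  by (metis M.add.r_cancel_one' M.l_zero M.zero_closed)

lemma smult_l_minus:
  "\<lbrakk>a \<in> carrier R; x \<in> carrier M\<rbrakk> \<Longrightarrow> (\<ominus>\<^bsub>R\<^esub> a) \<odot>\<^bsub>M\<^esub> x = \<ominus>\<^bsub>M\<^esub> (a \<odot>\<^bsub>M\<^esub> x)"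
  using smult_l_distr[of "\<ominus>\<^bsub>R\<^esub> a" a x] smult_closed smult_l_null
  by (metis M.minus_equality R.a_inv_closed R.l_neg)

lemma smult_r_minus:
  "\<lbrakk>a \<in> carrier R; x \<in> carrier M\<rbrakk> \<Longrightarrow> a \<odot>\<^bsub>M\<^esub> (\<ominus>\<^bsub>M\<^esub> x) = \<ominus>\<^bsub>M\<^esub> (a \<odot>\<^bsub>M\<^esub> x)"
  using smult_r_distr[of a "\<ominus>\<^bsub>M\<^esub> x" x] smult_closed smult_r_null
  by (metis M.minus_equality M.a_inv_closed M.l_neg)

lemma finsum_smult_r:
  "\<lbrakk>a \<in> carrier R; f \<in> S \<rightarrow> carrier M\<rbrakk> \<Longrightarrow>
    a \<odot>\<^bsub>M\<^esub> (\<Oplus>\<^bsub>M\<^esub>i\<in>S. f i) = (\<Oplus>\<^bsub>M\<^esub>i\<in>S. a \<odot>\<^bsub>M\<^esub> f i)"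
  by (induct S rule: infinite_finite_induct)
    (simp_all add: smult_r_null smult_r_distr smult_closed Pi_def)

lemma submoduleI:
  assumes "N \<subseteq> carrier M" "\<zero>\<^bsub>M\<^esub> \<in> N"
    and "\<And>x y. \<lbrakk>x \<in> N; y \<in> N\<rbrakk> \<Longrightarrow> x \<oplus>\<^bsub>M\<^esub> y \<in> N"
    and sm: "\<And>a x. \<lbrakk>a \<in> carrier R; x \<in> N\<rbrakk> \<Longrightarrow> a \<odot>\<^bsub>M\<^esub> x \<in> N"
  shows "submodule N R M"
proof -
  \<comment> \<open>Negatives come from acting by -1.\<close>
  have "\<ominus>\<^bsub>M\<^esub> x \<in> N" if "x \<in> N" for x
    using sm[of "\<ominus>\<^bsub>R\<^esub> \<one>\<^bsub>R\<^esub>" x] that assms(1) smult_l_minus[of "\<one>\<^bsub>R\<^esub>" x] smult_one[of x]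
    by (auto simp: subset_iff)
  then show ?thesis
    using assms by (intro submodule.intro subgroup.intro)
      (simp_all add: submodule_axioms_def a_inv_def)
qed

lemma submoduleD:
  assumes "submodule N R M"
  shows "N \<subseteq> carrier M" "\<zero>\<^bsub>M\<^esub> \<in> N"
    and "\<And>x y. \<lbrakk>x \<in> N; y \<in> N\<rbrakk> \<Longrightarrow> x \<oplus>\<^bsub>M\<^esub> y \<in> N"
    and "\<And>a x. \<lbrakk>a \<in> carrier R; x \<in> N\<rbrakk> \<Longrightarrow> a \<odot>\<^bsub>M\<^esub> x \<in> N"
    and "\<And>x. x \<in> N \<Longrightarrow> \<ominus>\<^bsub>M\<^esub> x \<in> N"
proof -
  interpret submodule N R M by fact
  show "N \<subseteq> carrier M" "\<zero>\<^bsub>M\<^esub> \<in> N" using subset one_closed by auto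
  show "\<And>x y. \<lbrakk>x \<in> N; y \<in> N\<rbrakk> \<Longrightarrow> x \<oplus>\<^bsub>M\<^esub> y \<in> N" using m_closed by auto
  show "\<And>a x. \<lbrakk>a \<in> carrier R; x \<in> N\<rbrakk> \<Longrightarrow> a \<odot>\<^bsub>M\<^esub> x \<in> N" by simp
  show "\<And>x. x \<in> N \<Longrightarrow> \<ominus>\<^bsub>M\<^esub> x \<in> N" using m_inv_closed by (simp add: a_inv_def)
qed

lemma submodule_abelian_subgroup: "submodule N R M \<Longrightarrow> abelian_subgroup N M"
  by (intro abelian_subgroupI3 additive_subgroup.intro M.abelian_group_axioms submodule.axioms)

end

lemma (in abelian_subgroup) a_coset_eq_iff:
  assumes "x \<in> carrier G" "y \<in> carrier G"
  shows "H +> x = H +> y \<longleftrightarrow> x \<ominus> y \<in> H"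
  using assms a_rcos_module[of y x] a_repr_independence'[of x y] a_rcos_self[of x]
  by (auto simp: a_minus_def)

lemma (in abelian_subgroup) a_coset_eq_self_iff:
  assumes "x \<in> carrier G"
  shows "H +> x = H \<longleftrightarrow> x \<in> H"
  using assms a_rcos_const a_rcos_self by blast

text \<open>Operations on cosets are defined through \<open>the_elem\<close> or a union over
  representatives. Once the value is the same at every representative, the image is a singleton and
  both forms return that value.\<close>

lemma (in abelian_subgroup) a_coset_image_eq:
  assumes "x \<in> carrier G" "\<And>y. y \<in> H +> x \<Longrightarrow> f y = f x"
  shows "f ` (H +> x) = {f x}"
  using assms(2) a_rcos_self[OF assms(1)] by blast

lemma regular_module_left_module: "ring R \<Longrightarrow> left_module R (regular_module R)"
proof -
  assume "ring R"
  then interpret ring R .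
  show ?thesis
  proof (rule left_moduleI)
    show "abelian_group (regular_module R)"
      by (rule abelian_groupI)
        (auto simp: regular_module_def a_assoc a_comm a_lcomm intro: add.l_inv_ex)
  qed (auto simp: regular_module_def \<open>ring R\<close> l_distr r_distr m_assoc)
qed

lemma restrict_scalars_left_module:
  assumes "left_module R M" "ring S" "h \<in> ring_hom S R"
  shows "left_module S (restrict_scalars h M)"
proof -
  interpret left_module R M by fact
  note h = ring_hom_closed[OF assms(3)] ring_hom_add[OF assms(3)] ring_hom_mult[OF assms(3)]
    ring_hom_one[OF assms(3)]
  show ?thesis
  proof (rule left_moduleI)
    show "abelian_group (restrict_scalars h M)"
      by (rule abelian_groupI)
        (auto simp: restrict_scalars_def M.a_assoc M.a_comm M.a_lcomm intro: M.add.l_inv_ex)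
  qed (auto simp: restrict_scalars_def \<open>ring S\<close> h smult_closed smult_l_distr smult_r_distr
        smult_assoc smult_one)
qed

section \<open>Homomorphisms of left modules\<close>

lemma left_module_homI:
  assumes "\<And>x. x \<in> carrier M \<Longrightarrow> h x \<in> carrier N"
    and "\<And>x y. \<lbrakk>x \<in> carrier M; y \<in> carrier M\<rbrakk> \<Longrightarrow> h (x \<oplus>\<^bsub>M\<^esub> y) = h x \<oplus>\<^bsub>N\<^esub> h y"
    and "\<And>r x. \<lbrakk>r \<in> carrier R; x \<in> carrier M\<rbrakk> \<Longrightarrow> h (r \<odot>\<^bsub>M\<^esub> x) = r \<odot>\<^bsub>N\<^esub> h x"
  shows "h \<in> left_module_hom R M N"
  using assms by (auto simp: left_module_hom_def hom_def)

lemma left_module_homD: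
  assumes "h \<in> left_module_hom R M N"
  shows "x \<in> carrier M \<Longrightarrow> h x \<in> carrier N"
    and "\<lbrakk>x \<in> carrier M; y \<in> carrier M\<rbrakk> \<Longrightarrow> h (x \<oplus>\<^bsub>M\<^esub> y) = h x \<oplus>\<^bsub>N\<^esub> h y"
    and "\<lbrakk>r \<in> carrier R; x \<in> carrier M\<rbrakk> \<Longrightarrow> h (r \<odot>\<^bsub>M\<^esub> x) = r \<odot>\<^bsub>N\<^esub> h x"
  using assms by (auto simp: left_module_hom_def hom_def)

text \<open>Stated for additive maps and not for module homomorphisms: it is applied to maps whose
  linearity is still to be shown.\<close>

lemma additive_hom_zero:
  assumes "h \<in> hom (add_monoid M) (add_monoid N)" "abelian_group M" "abelian_group N"
  shows "h \<zero>\<^bsub>M\<^esub> = \<zero>\<^bsub>N\<^esub>"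
proof -
  interpret abelian_group_hom M N h
    using assms by (intro abelian_group_homI group_hom.intro)
      (auto simp: group_hom_axioms_def abelian_group.a_group)
  show ?thesis by simp
qed

lemma additive_hom_minus:
  assumes "h \<in> hom (add_monoid M) (add_monoid N)" "abelian_group M" "abelian_group N"
    "x \<in> carrier M" "y \<in> carrier M"
  shows "h (x \<ominus>\<^bsub>M\<^esub> y) = h x \<ominus>\<^bsub>N\<^esub> h y"
proof -
  interpret abelian_group_hom M N h
    using assms by (intro abelian_group_homI group_hom.intro)
      (auto simp: group_hom_axioms_def abelian_group.a_group)
  show ?thesis using assms(4,5) by (simp add: a_minus_def)
qed

lemma left_module_hom_additive:
  "h \<in> left_module_hom R M N \<Longrightarrow> h \<in> hom (add_monoid M) (add_monoid N)"
  by (simp add: left_module_hom_def)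

lemma left_module_hom_zero:
  "\<lbrakk>h \<in> left_module_hom R M N; left_module R M; left_module S N\<rbrakk> \<Longrightarrow> h \<zero>\<^bsub>M\<^esub> = \<zero>\<^bsub>N\<^esub>"
  by (intro additive_hom_zero left_module_hom_additive left_module.axioms(2))

lemma left_module_hom_minus:
  "\<lbrakk>h \<in> left_module_hom R M N; left_module R M; left_module S N; x \<in> carrier M; y \<in> carrier M\<rbrakk>
    \<Longrightarrow> h (x \<ominus>\<^bsub>M\<^esub> y) = h x \<ominus>\<^bsub>N\<^esub> h y"
  by (intro additive_hom_minus left_module_hom_additive left_module.axioms(2))

lemma left_module_hom_comp:
  "\<lbrakk>h \<in> left_module_hom R M N; g \<in> left_module_hom R N L\<rbrakk>
    \<Longrightarrow> (\<lambda>x. g (h x)) \<in> left_module_hom R M L"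
  by (rule left_module_homI) (simp_all add: left_module_homD)

lemma left_module_hom_kernel_submodule:
  assumes "left_module R M" "left_module R N" "h \<in> left_module_hom R M N"
  shows "submodule {x \<in> carrier M. h x = \<zero>\<^bsub>N\<^esub>} R M"
proof -
  interpret M: left_module R M by fact
  interpret N: left_module R N by fact
  show ?thesis
    using left_module_hom_zero[OF assms(3,1,2)]
    by (intro M.submoduleI)
      (auto simp: left_module_homD[OF assms(3)] M.smult_closed N.smult_r_null)
qed

lemma left_module_hom_image_submodule:
  assumes "left_module R M" "left_module R N" "h \<in> left_module_hom R M N"
  shows "submodule (h ` carrier M) R N"
proof -
  interpret M: left_module R M by fact
  interpret N: left_module R N by fact
  note h = left_module_homD[OF assms(3)]
  show ?thesis
  proof (rule N.submoduleI)
    show "\<zero>\<^bsub>N\<^esub> \<in> h ` carrier M"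
      using left_module_hom_zero[OF assms(3,1,2)] by (metis M.M.zero_closed imageI)
    show "x \<oplus>\<^bsub>N\<^esub> y \<in> h ` carrier M" if "x \<in> h ` carrier M" "y \<in> h ` carrier M" for x y
      using that by (auto simp: image_iff intro!: bexI[of _ "_ \<oplus>\<^bsub>M\<^esub> _"] h(2)[symmetric])
    show "a \<odot>\<^bsub>N\<^esub> x \<in> h ` carrier M" if "a \<in> carrier R" "x \<in> h ` carrier M" for a x
      using that by (auto simp: image_iff M.smult_closed intro!: bexI[of _ "a \<odot>\<^bsub>M\<^esub> _"] h(3)[symmetric])
  qed (auto simp: h)
qed

text \<open>The source of uniqueness: homomorphisms that agree on generators agree on the submodule
  these generate.\<close>

lemma left_module_hom_equalizer_submodule:
  assumes "left_module R M" "left_module R N"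
    "h \<in> left_module_hom R M N" "g \<in> left_module_hom R M N"
  shows "submodule {x \<in> carrier M. h x = g x} R M"
proof -
  interpret M: left_module R M by fact
  show ?thesis
    using left_module_hom_zero[OF assms(3,1,2)] left_module_hom_zero[OF assms(4,1,2)]
    by (intro M.submoduleI)
      (auto simp: left_module_homD[OF assms(3)] left_module_homD[OF assms(4)] M.smult_closed)
qed

section \<open>Quotient modules\<close>

context
  fixes R :: "('r, 'u) ring_scheme" and M :: "('r, 'm, 'v) module_scheme" and N :: "'m set"
  assumes M: "left_module R M" and N: "submodule N R M"
begin

interpretation M: left_module R M by (rule M)
interpretation N: abelian_subgroup N M by (rule M.submodule_abelian_subgroup[OF N])

lemma quot_module_carrier: "carrier (quot_module M N) = {N +>\<^bsub>M\<^esub> x | x. x \<in> carrier M}"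
  by (auto simp: quot_module_def A_RCOSETS_def RCOSETS_def a_r_coset_def)

lemma quot_module_coset_closed: "x \<in> carrier M \<Longrightarrow> N +>\<^bsub>M\<^esub> x \<in> carrier (quot_module M N)"
  unfolding quot_module_carrier by blast

lemma quot_module_cosetE:
  assumes "X \<in> carrier (quot_module M N)"
  obtains x where "x \<in> carrier M" "X = N +>\<^bsub>M\<^esub> x"
  using assms unfolding quot_module_carrier by blast

lemma quot_module_zero: "\<zero>\<^bsub>quot_module M N\<^esub> = N"
  by (simp add: quot_module_def)

lemma quot_module_add:
  "\<lbrakk>x \<in> carrier M; y \<in> carrier M\<rbrakk> \<Longrightarrow>
    (N +>\<^bsub>M\<^esub> x) \<oplus>\<^bsub>quot_module M N\<^esub> (N +>\<^bsub>M\<^esub> y) = N +>\<^bsub>M\<^esub> (x \<oplus>\<^bsub>M\<^esub> y)"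
  by (simp add: quot_module_def N.a_rcos_sum)

lemma quot_module_smult:
  assumes r: "r \<in> carrier R" and x: "x \<in> carrier M"
  shows "r \<odot>\<^bsub>quot_module M N\<^esub> (N +>\<^bsub>M\<^esub> x) = N +>\<^bsub>M\<^esub> (r \<odot>\<^bsub>M\<^esub> x)"
proof -
  \<comment> \<open>Representatives differ by an element of \<open>N\<close>, and \<open>N\<close>
    is stable under \<open>r\<close>, so all cosets in the union that defines the action
    coincide.\<close>
  have "N +>\<^bsub>M\<^esub> (r \<odot>\<^bsub>M\<^esub> y) = N +>\<^bsub>M\<^esub> (r \<odot>\<^bsub>M\<^esub> x)" if "y \<in> N +>\<^bsub>M\<^esub> x" for y
  proof -
    have y: "y \<in> carrier M" using that x by (rule N.a_elemrcos_carrier[rotated])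
    have "y \<oplus>\<^bsub>M\<^esub> \<ominus>\<^bsub>M\<^esub> x \<in> N" using that x by (rule N.a_rcos_module_imp[rotated])
    then have "r \<odot>\<^bsub>M\<^esub> (y \<oplus>\<^bsub>M\<^esub> \<ominus>\<^bsub>M\<^esub> x) \<in> N" by (rule M.submoduleD(4)[OF N r])
    then show ?thesis
      using r x y by (subst N.a_coset_eq_iff)
        (auto simp: M.smult_closed M.smult_r_distr M.smult_r_minus a_minus_def)
  qed
  then have "(\<Union>y\<in>N +>\<^bsub>M\<^esub> x. N +>\<^bsub>M\<^esub> (r \<odot>\<^bsub>M\<^esub> y)) = N +>\<^bsub>M\<^esub> (r \<odot>\<^bsub>M\<^esub> x)"
    using N.a_coset_image_eq[OF x, of "\<lambda>y. N +>\<^bsub>M\<^esub> (r \<odot>\<^bsub>M\<^esub> y)"] by simp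
  then show ?thesis by (simp add: quot_module_def)
qed

lemma quot_module_left_module: "left_module R (quot_module M N)"
proof -
  note simps = quot_module_add quot_module_smult quot_module_coset_closed M.smult_closed
  have N0: "N +>\<^bsub>M\<^esub> \<zero>\<^bsub>M\<^esub> = N"
    by (rule N.a_rcos_const[OF M.submoduleD(2)[OF N]])
  have "abelian_group (quot_module M N)"
  proof (rule abelian_groupI)
    show "\<zero>\<^bsub>quot_module M N\<^esub> \<in> carrier (quot_module M N)"
      using quot_module_coset_closed[OF M.M.zero_closed] by (simp add: N0 quot_module_zero)
  next
    fix X assume "X \<in> carrier (quot_module M N)"
    then obtain x where x: "x \<in> carrier M" "X = N +>\<^bsub>M\<^esub> x" by (rule quot_module_cosetE)
    show "\<zero>\<^bsub>quot_module M N\<^esub> \<oplus>\<^bsub>quot_module M N\<^esub> X = X"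
      using quot_module_add[OF M.M.zero_closed x(1)] x by (simp add: N0 quot_module_zero)
    show "\<exists>Y\<in>carrier (quot_module M N). Y \<oplus>\<^bsub>quot_module M N\<^esub> X = \<zero>\<^bsub>quot_module M N\<^esub>"
      using x by (intro bexI[of _ "N +>\<^bsub>M\<^esub> (\<ominus>\<^bsub>M\<^esub> x)"])
        (simp_all add: simps M.M.l_neg quot_module_zero N0)
  qed (auto elim!: quot_module_cosetE simp: simps M.M.a_assoc M.M.a_comm M.M.a_lcomm)
  then show ?thesis
    by (intro left_moduleI) (auto elim!: quot_module_cosetE simp: simps
        M.smult_l_distr M.smult_r_distr M.smult_assoc M.smult_one M.R.ring_axioms)
qed

lemma quot_module_proj_hom: "(\<lambda>x. N +>\<^bsub>M\<^esub> x) \<in> left_module_hom R M (quot_module M N)"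
  by (rule left_module_homI)
    (simp_all add: quot_module_coset_closed quot_module_add quot_module_smult)

lemma quot_module_proj_eq_zero_iff:
  "x \<in> carrier M \<Longrightarrow> N +>\<^bsub>M\<^esub> x = \<zero>\<^bsub>quot_module M N\<^esub> \<longleftrightarrow> x \<in> N"
  by (simp add: quot_module_zero N.a_coset_eq_self_iff)

lemma quot_module_lift:
  assumes L: "left_module R L" and h: "h \<in> left_module_hom R M L"
    and ker: "\<And>x. x \<in> N \<Longrightarrow> h x = \<zero>\<^bsub>L\<^esub>"
  shows "\<exists>g\<in>left_module_hom R (quot_module M N) L. \<forall>x\<in>carrier M. g (N +>\<^bsub>M\<^esub> x) = h x"
proof -
  interpret L: left_module R L by (rule L)
  note hD = left_module_homD[OF h]
  \<comment> \<open>\<open>h\<close> vanishes on \<open>N\<close>, hence is constant on cosets, and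
    \<open>the_elem\<close> picks the common value.\<close>
  let ?g = "\<lambda>X. the_elem (h ` X)"
  have g: "?g (N +>\<^bsub>M\<^esub> x) = h x" if x: "x \<in> carrier M" for x
  proof -
    have "h y = h x" if "y \<in> N +>\<^bsub>M\<^esub> x" for y
    proof -
      have y: "y \<in> carrier M" using that x by (rule N.a_elemrcos_carrier[rotated])
      have "y \<ominus>\<^bsub>M\<^esub> x \<in> N"
        using N.a_rcos_module_imp[OF x that] by (simp add: a_minus_def)
      then have "h y \<ominus>\<^bsub>L\<^esub> h x = \<zero>\<^bsub>L\<^esub>"
        using ker left_module_hom_minus[OF h M L y x] by simp
      then show ?thesis using x y hD(1) by (metis L.M.minus_eq_zero_iff)
    qed
    then have "h ` (N +>\<^bsub>M\<^esub> x) = {h x}" by (rule N.a_coset_image_eq[OF x])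
    then show ?thesis by simp
  qed
  have "?g \<in> left_module_hom R (quot_module M N) L"
    by (rule left_module_homI)
      (auto elim!: quot_module_cosetE simp: quot_module_add quot_module_smult g hD M.smult_closed)
  then show ?thesis
    by (rule bexI[rotated]) (simp add: g)
qed

end

section \<open>Free modules and presentations\<close>

lemma module_span_submodule:
  assumes "left_module R M" "S \<subseteq> carrier M"
  shows "submodule (module_span R M S) R M"
proof -
  interpret left_module R M by fact
  have "submodule (carrier M) R M"
    by (rule submoduleI) (auto simp: smult_closed)
  moreover have mem: "x \<in> module_span R M S \<longleftrightarrow> (\<forall>N. submodule N R M \<and> S \<subseteq> N \<longrightarrow> x \<in> N)" for x
    by (simp add: module_span_def)
  ultimately have "module_span R M S \<subseteq> carrier M" using assms(2) by blast
  then show ?thesis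
  proof (rule submoduleI)
    show "\<zero>\<^bsub>M\<^esub> \<in> module_span R M S" by (simp add: mem submoduleD(2))
    show "x \<oplus>\<^bsub>M\<^esub> y \<in> module_span R M S" if "x \<in> module_span R M S" "y \<in> module_span R M S" for x y
      using that submoduleD(3) unfolding mem by simp
    show "a \<odot>\<^bsub>M\<^esub> x \<in> module_span R M S" if "a \<in> carrier R" "x \<in> module_span R M S" for a x
      using that submoduleD(4) unfolding mem by simp
  qed
qed

lemma module_span_superset: "S \<subseteq> module_span R M S"
  by (auto simp: module_span_def)

lemma module_span_minimal: "\<lbrakk>submodule N R M; S \<subseteq> N\<rbrakk> \<Longrightarrow> module_span R M S \<subseteq> N"
  by (auto simp: module_span_def)

context
  fixes R :: "('r, 'u) ring_scheme" and X :: "'x set"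
  assumes R: "ring R"
begin

interpretation R: ring R by (rule R)

lemma free_module_apply_closed: "f \<in> carrier (free_module R X) \<Longrightarrow> f x \<in> carrier R"
  by (cases "x \<in> X") (simp_all add: free_module_def)

lemma free_module_carrierI:
  assumes "\<And>x. x \<in> X \<Longrightarrow> f x \<in> carrier R" "\<And>x. x \<notin> X \<Longrightarrow> f x = \<zero>\<^bsub>R\<^esub>"
    and "finite S" "\<And>x. x \<notin> S \<Longrightarrow> f x = \<zero>\<^bsub>R\<^esub>"
  shows "f \<in> carrier (free_module R X)"
proof -
  have "finite {x. f x \<noteq> \<zero>\<^bsub>R\<^esub>}"
    using assms(4) by (intro finite_subset[OF _ assms(3)]) blast
  with assms(1,2) show ?thesis by (simp add: free_module_def)
qed

lemma free_module_support:
  assumes "f \<in> carrier (free_module R X)"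
  shows "x \<notin> X \<Longrightarrow> f x = \<zero>\<^bsub>R\<^esub>" "finite {x. f x \<noteq> \<zero>\<^bsub>R\<^esub>}"
  using assms by (simp_all add: free_module_def)

lemma free_module_ops:
  "\<zero>\<^bsub>free_module R X\<^esub> = (\<lambda>x. \<zero>\<^bsub>R\<^esub>)"
  "f \<oplus>\<^bsub>free_module R X\<^esub> g = (\<lambda>x. f x \<oplus>\<^bsub>R\<^esub> g x)"
  "r \<odot>\<^bsub>free_module R X\<^esub> f = (\<lambda>x. r \<otimes>\<^bsub>R\<^esub> f x)"
  by (simp_all add: free_module_def)

lemma free_module_left_module: "left_module R (free_module R X)"
proof (rule left_moduleI)
  show "abelian_group (free_module R X)"
  proof (rule abelian_groupI)
    fix f assume f: "f \<in> carrier (free_module R X)"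
    note [simp] = free_module_apply_closed[OF f] free_module_support(1)[OF f]
    have "(\<lambda>x. \<ominus>\<^bsub>R\<^esub> f x) \<in> carrier (free_module R X)"
      by (rule free_module_carrierI[OF _ _ free_module_support(2)[OF f]]) (use f in auto)
    then show "\<exists>g\<in>carrier (free_module R X). g \<oplus>\<^bsub>free_module R X\<^esub> f = \<zero>\<^bsub>free_module R X\<^esub>"
      by (rule rev_bexI) (use f in \<open>simp add: free_module_ops R.l_neg\<close>)
    show "\<zero>\<^bsub>free_module R X\<^esub> \<oplus>\<^bsub>free_module R X\<^esub> f = f"
      using f by (simp add: free_module_ops)
  next
    fix f g assume fg: "f \<in> carrier (free_module R X)" "g \<in> carrier (free_module R X)"
    note [simp] = fg[THEN free_module_apply_closed] fg[THEN free_module_support(1)]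
    have "finite ({x. f x \<noteq> \<zero>\<^bsub>R\<^esub>} \<union> {x. g x \<noteq> \<zero>\<^bsub>R\<^esub>})"
      using fg by (simp add: free_module_support)
    then show "f \<oplus>\<^bsub>free_module R X\<^esub> g \<in> carrier (free_module R X)"
      unfolding free_module_ops by (rule free_module_carrierI[rotated 2]) (use fg in auto)
    show "f \<oplus>\<^bsub>free_module R X\<^esub> g = g \<oplus>\<^bsub>free_module R X\<^esub> f"
      using fg by (simp add: free_module_ops R.a_comm)
    fix h assume "h \<in> carrier (free_module R X)"
    note [simp] = free_module_apply_closed[OF this]
    show "f \<oplus>\<^bsub>free_module R X\<^esub> g \<oplus>\<^bsub>free_module R X\<^esub> h =
        f \<oplus>\<^bsub>free_module R X\<^esub> (g \<oplus>\<^bsub>free_module R X\<^esub> h)"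
      using fg by (simp add: free_module_ops R.a_assoc)
  qed (simp add: free_module_def)
  fix a f assume a: "a \<in> carrier R" and f: "f \<in> carrier (free_module R X)"
  note [simp] = a free_module_apply_closed[OF f] free_module_support(1)[OF f]
  show "a \<odot>\<^bsub>free_module R X\<^esub> f \<in> carrier (free_module R X)"
    unfolding free_module_ops
    by (rule free_module_carrierI[OF _ _ free_module_support(2)[OF f]]) auto
  fix b assume [simp]: "b \<in> carrier R"
  show "(a \<oplus>\<^bsub>R\<^esub> b) \<odot>\<^bsub>free_module R X\<^esub> f =
      a \<odot>\<^bsub>free_module R X\<^esub> f \<oplus>\<^bsub>free_module R X\<^esub> b \<odot>\<^bsub>free_module R X\<^esub> f"
    "(a \<otimes>\<^bsub>R\<^esub> b) \<odot>\<^bsub>free_module R X\<^esub> f =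
      a \<odot>\<^bsub>free_module R X\<^esub> (b \<odot>\<^bsub>free_module R X\<^esub> f)"
    by (simp_all add: free_module_ops R.l_distr R.m_assoc)
next
  fix f assume "f \<in> carrier (free_module R X)"
  then show "\<one>\<^bsub>R\<^esub> \<odot>\<^bsub>free_module R X\<^esub> f = f"
    by (simp add: free_module_ops free_module_apply_closed[of f])
next
  fix a f g assume "a \<in> carrier R" and fg: "f \<in> carrier (free_module R X)" "g \<in> carrier (free_module R X)"
  then show "a \<odot>\<^bsub>free_module R X\<^esub> (f \<oplus>\<^bsub>free_module R X\<^esub> g) =
      a \<odot>\<^bsub>free_module R X\<^esub> f \<oplus>\<^bsub>free_module R X\<^esub> a \<odot>\<^bsub>free_module R X\<^esub> g"
    by (simp add: free_module_ops R.r_distr fg[THEN free_module_apply_closed])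
qed (rule R)

lemma free_gen_closed: "x \<in> X \<Longrightarrow> free_gen R x \<in> carrier (free_module R X)"
  by (auto simp: free_gen_def free_module_def)

lemma free_module_induct [consumes 1, case_names zero smult_gen add]:
  assumes "f \<in> carrier (free_module R X)"
    and "P \<zero>\<^bsub>free_module R X\<^esub>"
    and sg: "\<And>r x. \<lbrakk>r \<in> carrier R; x \<in> X\<rbrakk> \<Longrightarrow> P (r \<odot>\<^bsub>free_module R X\<^esub> free_gen R x)"
    and add: "\<And>f g. \<lbrakk>f \<in> carrier (free_module R X); g \<in> carrier (free_module R X); P f; P g\<rbrakk>
      \<Longrightarrow> P (f \<oplus>\<^bsub>free_module R X\<^esub> g)"
  shows "P f"
proof -
  interpret F: left_module R "free_module R X" by (rule free_module_left_module)
  have "finite {x. f x \<noteq> \<zero>\<^bsub>R\<^esub>}" using assms(1) by (simp add: free_module_def)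
  then show ?thesis
    using assms(1)
  proof (induction "{x. f x \<noteq> \<zero>\<^bsub>R\<^esub>}" arbitrary: f rule: finite_induct)
    case empty
    then have "f = \<zero>\<^bsub>free_module R X\<^esub>" by (auto simp: free_module_def)
    then show ?case using assms(2) by simp
  next
    case (insert x S)
    \<comment> \<open>Induction on the support: \<open>f\<close> is its part at \<open>x\<close>
      plus \<open>?g\<close>, whose support has lost \<open>x\<close>.\<close>
    let ?g = "f(x := \<zero>\<^bsub>R\<^esub>)"
    let ?m = "f x \<odot>\<^bsub>free_module R X\<^esub> free_gen R x"
    have S: "S = {y. ?g y \<noteq> \<zero>\<^bsub>R\<^esub>}" using insert.hyps(2,4) by auto
    have x: "x \<in> X" "f x \<in> carrier R"
      using insert.hyps(4) insert.prems by (auto simp: free_module_def)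
    have g: "?g \<in> carrier (free_module R X)"
      using insert.prems by (auto simp: free_module_def elim!: rev_finite_subset)
    have fc: "f y \<in> carrier R" for y
      using insert.prems by (cases "y \<in> X") (auto simp: free_module_def)
    have "f = ?m \<oplus>\<^bsub>free_module R X\<^esub> ?g"
      using fc by (auto simp: free_module_def free_gen_def)
    moreover have "P (?m \<oplus>\<^bsub>free_module R X\<^esub> ?g)"
      using insert.hyps(3)[OF S g] sg[OF x(2,1)] g x
      by (intro add) (auto intro: F.smult_closed free_gen_closed)
    ultimately show ?case by simp
  qed
qed

lemma free_module_gens_generate:
  assumes "submodule N R (free_module R X)" "\<And>x. x \<in> X \<Longrightarrow> free_gen R x \<in> N"
  shows "carrier (free_module R X) \<subseteq> N"
proof
  interpret F: left_module R "free_module R X" by (rule free_module_left_module)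
  note N = F.submoduleD[OF assms(1)]
  show "f \<in> N" if "f \<in> carrier (free_module R X)" for f
    using that by (induct f rule: free_module_induct) (auto intro: N assms(2))
qed

lemma free_module_extension:
  assumes M: "left_module R M" and u: "u \<in> X \<rightarrow> carrier M"
  defines "h \<equiv> \<lambda>f. \<Oplus>\<^bsub>M\<^esub>x\<in>{x. f x \<noteq> \<zero>\<^bsub>R\<^esub>}. f x \<odot>\<^bsub>M\<^esub> u x"
  shows "h \<in> left_module_hom R (free_module R X) M"
    and "x \<in> X \<Longrightarrow> h (free_gen R x) = u x"
proof -
  interpret M: left_module R M by (rule M)
  let ?F = "free_module R X"
  let ?supp = "\<lambda>f. {x. f x \<noteq> \<zero>\<^bsub>R\<^esub>}"
  let ?h = "\<lambda>f. \<Oplus>\<^bsub>M\<^esub>x\<in>?supp f. f x \<odot>\<^bsub>M\<^esub> u x"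
  have suppX: "?supp f \<subseteq> X" "finite (?supp f)" if "f \<in> carrier ?F" for f
    using that by (auto simp: free_module_def)
  have cl: "(\<lambda>x. f x \<odot>\<^bsub>M\<^esub> u x) \<in> S \<rightarrow> carrier M" if "f \<in> carrier ?F" "S \<subseteq> X" for f S
    using that u by (auto simp: free_module_def Pi_iff intro!: M.smult_closed)
  \<comment> \<open>The range of summation is the support, which changes with \<open>f\<close>. It
    is enlarged here to any finite set, so that the sums for \<open>f\<close>, \<open>g\<close> and
    \<open>f\<close> plus \<open>g\<close> can be compared over the union of the supports.\<close>
  have ext: "?h f = (\<Oplus>\<^bsub>M\<^esub>x\<in>S. f x \<odot>\<^bsub>M\<^esub> u x)"
    if f: "f \<in> carrier ?F" and S: "finite S" "?supp f \<subseteq> S" "S \<subseteq> X" for f S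
  proof (rule M.add.finprod_mono_neutral_cong_left)
    show "f x \<odot>\<^bsub>M\<^esub> u x = \<zero>\<^bsub>M\<^esub>" if "x \<in> S - ?supp f" for x
      using that u S(3) by (auto simp: Pi_iff intro!: M.smult_l_null)
  qed (use S cl[OF f S(3)] in auto)
  interpret F: left_module R ?F by (rule free_module_left_module)
  show "h \<in> left_module_hom R (free_module R X) M"
    unfolding h_def
  proof (rule left_module_homI)
    show "?h f \<in> carrier M" if "f \<in> carrier ?F" for f
      using that suppX by (intro M.finsum_closed cl) auto
  next
    fix f g assume fg: "f \<in> carrier ?F" "g \<in> carrier ?F"
    let ?S = "?supp f \<union> ?supp g"
    have S: "finite ?S" "?S \<subseteq> X" using fg suppX by blast+
    have "?h (f \<oplus>\<^bsub>?F\<^esub> g) = (\<Oplus>\<^bsub>M\<^esub>x\<in>?S. (f \<oplus>\<^bsub>?F\<^esub> g) x \<odot>\<^bsub>M\<^esub> u x)"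
      using fg S by (intro ext F.a_closed) (auto simp: free_module_def)
    also have "\<dots> = (\<Oplus>\<^bsub>M\<^esub>x\<in>?S. f x \<odot>\<^bsub>M\<^esub> u x \<oplus>\<^bsub>M\<^esub> g x \<odot>\<^bsub>M\<^esub> u x)"
    proof (rule M.finsum_cong')
      show "(\<lambda>x. f x \<odot>\<^bsub>M\<^esub> u x \<oplus>\<^bsub>M\<^esub> g x \<odot>\<^bsub>M\<^esub> u x) \<in> ?S \<rightarrow> carrier M"
        using cl[OF fg(1) S(2)] cl[OF fg(2) S(2)] by (auto simp: Pi_iff)
      show "(f \<oplus>\<^bsub>?F\<^esub> g) x \<odot>\<^bsub>M\<^esub> u x = f x \<odot>\<^bsub>M\<^esub> u x \<oplus>\<^bsub>M\<^esub> g x \<odot>\<^bsub>M\<^esub> u x" if "x \<in> ?S" for x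
        using that fg u S(2) by (auto simp: free_module_def intro!: M.smult_l_distr)
    qed auto
    also have "\<dots> = (\<Oplus>\<^bsub>M\<^esub>x\<in>?S. f x \<odot>\<^bsub>M\<^esub> u x) \<oplus>\<^bsub>M\<^esub> (\<Oplus>\<^bsub>M\<^esub>x\<in>?S. g x \<odot>\<^bsub>M\<^esub> u x)"
      by (rule M.finsum_addf[OF cl[OF fg(1) S(2)] cl[OF fg(2) S(2)]])
    also have "\<dots> = ?h f \<oplus>\<^bsub>M\<^esub> ?h g"
      using ext[OF fg(1) S(1) _ S(2)] ext[OF fg(2) S(1) _ S(2)] by simp
    finally show "?h (f \<oplus>\<^bsub>?F\<^esub> g) = ?h f \<oplus>\<^bsub>M\<^esub> ?h g" .
  next
    fix r f assume r: "r \<in> carrier R" and f: "f \<in> carrier ?F"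
    let ?S = "?supp f"
    note S = suppX[OF f]
    have "?h (r \<odot>\<^bsub>?F\<^esub> f) = (\<Oplus>\<^bsub>M\<^esub>x\<in>?S. (r \<odot>\<^bsub>?F\<^esub> f) x \<odot>\<^bsub>M\<^esub> u x)"
      using r f S by (intro ext F.smult_closed) (auto simp: free_module_def)
    also have "\<dots> = (\<Oplus>\<^bsub>M\<^esub>x\<in>?S. r \<odot>\<^bsub>M\<^esub> (f x \<odot>\<^bsub>M\<^esub> u x))"
      using r f u S(1) cl[OF f S(1)]
      by (intro M.finsum_cong') (auto simp: free_module_def Pi_iff M.smult_assoc subset_iff
          intro!: M.smult_closed)
    also have "\<dots> = r \<odot>\<^bsub>M\<^esub> ?h f"
      using M.finsum_smult_r[OF r cl[OF f S(1)]] by simp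
    finally show "?h (r \<odot>\<^bsub>?F\<^esub> f) = r \<odot>\<^bsub>M\<^esub> ?h f" .
  qed
  show "h (free_gen R x) = u x" if x: "x \<in> X"
  proof -
    have "?h (free_gen R x) = (\<Oplus>\<^bsub>M\<^esub>y\<in>{x}. free_gen R x y \<odot>\<^bsub>M\<^esub> u y)"
      using x by (intro ext free_gen_closed) (auto simp: free_gen_def)
    also have "\<dots> = u x"
      using x u by (simp add: Pi_iff free_gen_def M.smult_one M.smult_closed)
    finally show ?thesis unfolding h_def .
  qed
qed


end

section \<open>Modules presented by generators and relations\<close>

definition presentation ::
  "('r, 'u) ring_scheme \<Rightarrow> 'x set \<Rightarrow> ('x \<Rightarrow> 'r) set \<Rightarrow> ('r, ('x \<Rightarrow> 'r) set) module" where
  "presentation R X S = quot_module (free_module R X) (module_span R (free_module R X) S)"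

definition presentation_proj ::
  "('r, 'u) ring_scheme \<Rightarrow> 'x set \<Rightarrow> ('x \<Rightarrow> 'r) set \<Rightarrow> ('x \<Rightarrow> 'r) \<Rightarrow> ('x \<Rightarrow> 'r) set" where
  "presentation_proj R X S f = module_span R (free_module R X) S +>\<^bsub>free_module R X\<^esub> f"

context
  fixes R :: "('r, 'u) ring_scheme" and X :: "'x set" and S :: "('x \<Rightarrow> 'r) set"
  assumes R: "ring R" and S: "S \<subseteq> carrier (free_module R X)"
begin

interpretation F: left_module R "free_module R X" by (rule free_module_left_module[OF R])

lemma span_submodule:
  "submodule (module_span R (free_module R X) S) R (free_module R X)"
  by (rule module_span_submodule[OF F.left_module_axioms S])

lemma presentation_left_module: "left_module R (presentation R X S)"
  unfolding presentation_def by (rule quot_module_left_module[OF F.left_module_axioms span_submodule])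

lemma presentation_proj_hom:
  "presentation_proj R X S \<in> left_module_hom R (free_module R X) (presentation R X S)"
  using quot_module_proj_hom[OF F.left_module_axioms span_submodule]
  unfolding presentation_def presentation_proj_def by simp

lemma presentation_rel:
  "s \<in> S \<Longrightarrow> presentation_proj R X S s = \<zero>\<^bsub>presentation R X S\<^esub>"
  using quot_module_proj_eq_zero_iff[OF F.left_module_axioms span_submodule, of s]
    module_span_superset[of S R "free_module R X"] S
  unfolding presentation_def presentation_proj_def by auto

lemma presentation_rel_eq:
  assumes "f \<ominus>\<^bsub>free_module R X\<^esub> g \<in> S" "f \<in> carrier (free_module R X)"
    "g \<in> carrier (free_module R X)"
  shows "presentation_proj R X S f = presentation_proj R X S g"
proof -
  interpret P: left_module R "presentation R X S" by (rule presentation_left_module)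
  show ?thesis
    using presentation_rel[OF assms(1)]
      left_module_hom_minus[OF presentation_proj_hom F.left_module_axioms P.left_module_axioms assms(2,3)]
      left_module_homD(1)[OF presentation_proj_hom] assms(2,3)
    by (metis P.M.minus_eq_zero_iff)
qed

lemma presentation_gens_generate:
  assumes N: "submodule N R (presentation R X S)"
    and gens: "\<And>x. x \<in> X \<Longrightarrow> presentation_proj R X S (free_gen R x) \<in> N"
  shows "carrier (presentation R X S) = N"
proof
  interpret P: left_module R "presentation R X S" by (rule presentation_left_module)
  note ND = P.submoduleD[OF N]
  note pD = left_module_homD[OF presentation_proj_hom]
  \<comment> \<open>The preimage of \<open>N\<close> in the free module is a submodule that contains
    the free generators, so it is everything.\<close>
  let ?N = "{f \<in> carrier (free_module R X). presentation_proj R X S f \<in> N}"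
  have "submodule ?N R (free_module R X)"
    by (rule F.submoduleI)
      (auto simp: ND pD F.smult_closed
        left_module_hom_zero[OF presentation_proj_hom F.left_module_axioms P.left_module_axioms])
  then have "carrier (free_module R X) \<subseteq> ?N"
    using gens by (intro free_module_gens_generate[OF R]) (auto intro: free_gen_closed[OF R])
  then show "carrier (presentation R X S) \<subseteq> N"
    unfolding presentation_def presentation_proj_def
      quot_module_carrier[OF F.left_module_axioms span_submodule] by auto
  show "N \<subseteq> carrier (presentation R X S)" by (rule ND)
qed

lemma presentation_hom_eqI:
  assumes M: "left_module R M" and h: "h \<in> left_module_hom R (presentation R X S) M"
    and g: "g \<in> left_module_hom R (presentation R X S) M"
    and gens: "\<And>x. x \<in> X \<Longrightarrow> h (presentation_proj R X S (free_gen R x)) =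
      g (presentation_proj R X S (free_gen R x))"
    and w: "w \<in> carrier (presentation R X S)"
  shows "h w = g w"
proof -
  have "carrier (presentation R X S) = {w \<in> carrier (presentation R X S). h w = g w}"
    using gens
    by (intro presentation_gens_generate
        left_module_hom_equalizer_submodule[OF presentation_left_module M h g])
      (auto intro: left_module_homD(1)[OF presentation_proj_hom] free_gen_closed[OF R])
  then show ?thesis using w by blast
qed

text \<open>\<open>rels\<close> speaks of any homomorphism \<open>h\<close> with the prescribed
  values on the generators. The relations are then evaluated by linearity alone, without the sum
  that defines the extension.\<close>

lemma presentation_lift:
  assumes M: "left_module R M" and u: "u \<in> X \<rightarrow> carrier M"
    and rels: "\<And>h s. \<lbrakk>h \<in> left_module_hom R (free_module R X) M;
      \<And>x. x \<in> X \<Longrightarrow> h (free_gen R x) = u x; s \<in> S\<rbrakk> \<Longrightarrow> h s = \<zero>\<^bsub>M\<^esub>"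
  shows "\<exists>g\<in>left_module_hom R (presentation R X S) M.
    \<forall>x\<in>X. g (presentation_proj R X S (free_gen R x)) = u x"
proof -
  obtain h where h: "h \<in> left_module_hom R (free_module R X) M"
    "\<And>x. x \<in> X \<Longrightarrow> h (free_gen R x) = u x"
    using free_module_extension[OF R M u] by blast
  have "module_span R (free_module R X) S
      \<subseteq> {f \<in> carrier (free_module R X). h f = \<zero>\<^bsub>M\<^esub>}"
    using S rels[OF h]
    by (intro module_span_minimal left_module_hom_kernel_submodule[OF F.left_module_axioms M h(1)])
      auto
  then have ker: "\<And>f. f \<in> module_span R (free_module R X) S \<Longrightarrow> h f = \<zero>\<^bsub>M\<^esub>" by blast
  obtain g where g: "g \<in> left_module_hom R (presentation R X S) M"
    "\<forall>f\<in>carrier (free_module R X). g (presentation_proj R X S f) = h f"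
    using quot_module_lift[OF F.left_module_axioms span_submodule M h(1) ker]
    unfolding presentation_def presentation_proj_def by blast
  show ?thesis
    by (rule bexI[OF _ g(1)]) (simp add: g(2) h(2) free_gen_closed[OF R])
qed

end

section \<open>The Frobenius map\<close>

lemma (in cring) binomial:
  assumes x: "x \<in> carrier R" and y: "y \<in> carrier R"
  shows "(x \<oplus> y) [^] n = (\<Oplus>i\<in>{..n}. [(n choose i)] \<cdot>\<^bsub>R\<^esub> (x [^] i \<otimes> y [^] (n - i)))"
proof (induction n)
  case 0
  then show ?case by simp
next
  case (Suc n)
  let ?f = "\<lambda>n i. [(n choose i)] \<cdot>\<^bsub>R\<^esub> (x [^] i \<otimes> y [^] (n - i))"
  have f: "?f n i \<in> carrier R" for n i using x y by simp
  have step: "?f (Suc n) (Suc i) = ?f n i \<otimes> x \<oplus> ?f n (Suc i) \<otimes> y" if "i \<le> n" for i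
  proof -
    have 1: "?f n i \<otimes> x = [(n choose i)] \<cdot>\<^bsub>R\<^esub> (x [^] Suc i \<otimes> y [^] (n - i))"
      using x y by (simp add: add_pow_ldistr m_assoc m_comm[of x])
    have 2: "?f n (Suc i) \<otimes> y = [(n choose Suc i)] \<cdot>\<^bsub>R\<^esub> (x [^] Suc i \<otimes> y [^] (n - i))"
    \<comment> \<open>For \<open>i = n\<close> the subtraction \<open>n - Suc i\<close> is truncated
      to 0, but the coefficient \<open>n choose Suc n\<close> vanishes, so both sides are
      zero.\<close>
    proof (cases "i = n")
      case True
      then show ?thesis using x y by (simp add: binomial_eq_0)
    next
      case False
      with that have "n - i = Suc (n - Suc i)" by simp
      then show ?thesis using x y by (simp add: add_pow_ldistr m_assoc)
    qed
    show ?thesis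
      unfolding 1 2 using x y by (simp add: add.nat_pow_mult)
  qed
  define S where "S = (\<Oplus>i\<in>{..n}. ?f n i)"
  have S_closed: "S \<in> carrier R" unfolding S_def using f by (intro finsum_closed) auto
  \<comment> \<open>The added term at \<open>Suc n\<close> has binomial coefficient 0. Splitting off
    the term at 0 instead of the last one aligns the index with Pascal's rule
    \<open>step\<close>.\<close>
  have "S = (\<Oplus>i\<in>{..Suc n}. ?f n i)"
    using f x y unfolding S_def by (subst finsum_Suc) (simp_all add: Pi_def binomial_eq_0)
  also have "\<dots> = (\<Oplus>i\<in>{..n}. ?f n (Suc i)) \<oplus> ?f n 0"
    using f by (simp only: finsum_Suc2 Pi_I)
  finally have shift: "S = (\<Oplus>i\<in>{..n}. ?f n (Suc i)) \<oplus> ?f n 0" .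
  have "(x \<oplus> y) [^] Suc n = S \<otimes> x \<oplus> S \<otimes> y"
    using x y S_closed by (simp add: Suc r_distr flip: S_def)
  also have "S \<otimes> y = ((\<Oplus>i\<in>{..n}. ?f n (Suc i)) \<oplus> ?f n 0) \<otimes> y"
    by (simp only: shift)
  also have "S \<otimes> x \<oplus> \<dots> = S \<otimes> x \<oplus> ((\<Oplus>i\<in>{..n}. ?f n (Suc i) \<otimes> y) \<oplus> ?f n 0 \<otimes> y)"
    using x y f by (subst l_distr) (simp_all only: finsum_ldistr finsum_closed Pi_I finite_atMost)
  also have "\<dots> = S \<otimes> x \<oplus> (\<Oplus>i\<in>{..n}. ?f n (Suc i) \<otimes> y) \<oplus> ?f n 0 \<otimes> y"
    using x y f S_closed by (intro a_assoc[symmetric] finsum_closed m_closed Pi_I)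
  also have "S \<otimes> x = (\<Oplus>i\<in>{..n}. ?f n i \<otimes> x)"
    unfolding S_def using x f by (intro finsum_ldistr) auto
  also have "(\<Oplus>i\<in>{..n}. ?f n i \<otimes> x) \<oplus> (\<Oplus>i\<in>{..n}. ?f n (Suc i) \<otimes> y) =
      (\<Oplus>i\<in>{..n}. ?f n i \<otimes> x \<oplus> ?f n (Suc i) \<otimes> y)"
    using x y f by (intro finsum_addf[symmetric]) auto
  also have "\<dots> = (\<Oplus>i\<in>{..n}. ?f (Suc n) (Suc i))"
    using f by (intro finsum_cong' step[symmetric] Pi_I refl) (simp_all only: atMost_iff)
  also have "?f n 0 \<otimes> y = ?f (Suc n) 0"
    using x y by simp
  also have "(\<Oplus>i\<in>{..n}. ?f (Suc n) (Suc i)) \<oplus> ?f (Suc n) 0 = (\<Oplus>i\<in>{..Suc n}. ?f (Suc n) i)"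
    using f by (simp only: finsum_Suc2 Pi_I)
  finally show ?case .
qed

lemma (in cring) frobenius_add:
  fixes p :: nat
  assumes p: "prime p" and char: "[p] \<cdot>\<^bsub>R\<^esub> \<one> = \<zero>" and x: "x \<in> carrier R" and y: "y \<in> carrier R"
  shows "(x \<oplus> y) [^] p = x [^] p \<oplus> y [^] p"
proof -
  \<comment> \<open>Writing \<open>p\<close> as m + 2 exposes the two end terms. The inner indices
    are \<open>Suc i\<close> with \<open>i \<le> m\<close>, and their binomial coefficients are
    divisible by \<open>p\<close>.\<close>
  obtain m where m: "p = Suc (Suc m)"
    using le_Suc_ex[OF prime_ge_2_nat[OF p]] by auto
  let ?f = "\<lambda>i. [(p choose i)] \<cdot>\<^bsub>R\<^esub> (x [^] i \<otimes> y [^] (p - i))"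
  have f: "?f i \<in> carrier R" for i using x y by simp
  have van: "[p] \<cdot>\<^bsub>R\<^esub> z = \<zero>" if "z \<in> carrier R" for z
    using add_pow_ldistr[OF one_closed that, of p] char that by simp
  have mid: "?f (Suc i) = \<zero>" if "i \<le> m" for i
  proof -
    have "p dvd p choose Suc i"
      using that m by (intro dvd_choose_prime p) auto
    then obtain c where c: "p choose Suc i = p * c" by (auto simp: dvd_def)
    show ?thesis using x y unfolding c by (simp add: add.nat_pow_pow[symmetric] van)
  qed
  have "(x \<oplus> y) [^] p = (\<Oplus>i\<in>{..Suc (Suc m)}. ?f i)"
    using binomial[OF x y, of p] m by simp
  also have "\<dots> = ?f (Suc (Suc m)) \<oplus> (\<Oplus>i\<in>{..Suc m}. ?f i)"
    using f by (intro finsum_Suc Pi_I)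
  also have "(\<Oplus>i\<in>{..Suc m}. ?f i) = (\<Oplus>i\<in>{..m}. ?f (Suc i)) \<oplus> ?f 0"
    using f by (intro finsum_Suc2 Pi_I)
  also have "(\<Oplus>i\<in>{..m}. ?f (Suc i)) = \<zero>"
    using mid by (intro add.finprod_one_eqI) auto
  also have "?f (Suc (Suc m)) \<oplus> (\<zero> \<oplus> ?f 0) = x [^] p \<oplus> y [^] p"
    using x y m by simp
  finally show ?thesis .
qed

section \<open>Structure of divided powers algebras\<close>

context pd_algebra
begin

sublocale k: field k by (rule field)
sublocale R: cring A by (rule algebra.M_cring[OF algebra])
sublocale alg: algebra k A by (rule algebra)
sublocale e: ring_hom_ring A k "aug A"
  by (rule ring_hom_ringI2) (simp_all add: R.ring_axioms k.ring_axioms aug_hom)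

text \<open>The structure map from \<open>k\<close> to \<open>A\<close>. It is a section of
  \<open>aug A\<close>, which splits every element into a scalar and a part in the augmentation
  ideal.\<close>

definition scal where "scal l = l \<odot>\<^bsub>A\<^esub> \<one>\<^bsub>A\<^esub>"

lemma scal_closed [simp]: "l \<in> carrier k \<Longrightarrow> scal l \<in> carrier A"
  by (simp add: scal_def)

lemma scal_mult: "\<lbrakk>l \<in> carrier k; a \<in> carrier A\<rbrakk> \<Longrightarrow> scal l \<otimes>\<^bsub>A\<^esub> a = l \<odot>\<^bsub>A\<^esub> a"
  by (simp add: scal_def alg.smult_assoc2)

lemma scal_hom: "scal \<in> ring_hom k A"
  by (rule ring_hom_memI)
    (simp_all add: scal_mult, simp_all add: scal_def alg.smult_assoc1 alg.smult_l_distr)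

sublocale s: ring_hom_ring k A scal
  by (rule ring_hom_ringI2) (simp_all add: R.ring_axioms k.ring_axioms scal_hom)

lemma aug_scal [simp]: "l \<in> carrier k \<Longrightarrow> aug A (scal l) = l"
  by (simp add: scal_def aug_smult)

lemma char_p_A: "[p] \<cdot>\<^bsub>A\<^esub> \<one>\<^bsub>A\<^esub> = \<zero>\<^bsub>A\<^esub>"
proof -
  have "[n] \<cdot>\<^bsub>A\<^esub> \<one>\<^bsub>A\<^esub> = scal ([n] \<cdot>\<^bsub>k\<^esub> \<one>\<^bsub>k\<^esub>)" for n :: nat
    by (induction n) auto
  then show ?thesis by (simp add: char_p)
qed

lemma aug_ideal_iff: "x \<in> aug_ideal k A \<longleftrightarrow> x \<in> carrier A \<and> aug A x = \<zero>\<^bsub>k\<^esub>"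
  unfolding aug_ideal_def a_kernel_def kernel_def by simp

lemma aug_ideal_decomp:
  assumes "a \<in> carrier A"
  shows "a \<ominus>\<^bsub>A\<^esub> scal (aug A a) \<in> aug_ideal k A"
    and "a = scal (aug A a) \<oplus>\<^bsub>A\<^esub> (a \<ominus>\<^bsub>A\<^esub> scal (aug A a))"
proof -
  show "a \<ominus>\<^bsub>A\<^esub> scal (aug A a) \<in> aug_ideal k A"
    using assms by (simp add: aug_ideal_iff a_minus_def k.r_neg)
  show "a = scal (aug A a) \<oplus>\<^bsub>A\<^esub> (a \<ominus>\<^bsub>A\<^esub> scal (aug A a))"
    using assms R.a_lcomm[of "scal (aug A a)" a "\<ominus>\<^bsub>A\<^esub> scal (aug A a)"]
    by (simp add: a_minus_def R.r_neg)
qed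

text \<open>Frobenius is additive and kills the augmentation ideal, so only the scalar part of
  \<open>a\<close> survives. This ties the twist of V(A), defined through \<open>aug A\<close>, to
  powers in \<open>A\<close>.\<close>

lemma pow_p_eq_scal:
  assumes a: "a \<in> carrier A"
  shows "a [^]\<^bsub>A\<^esub> p = scal (aug A a [^]\<^bsub>k\<^esub> p)"
proof -
  let ?x = "a \<ominus>\<^bsub>A\<^esub> scal (aug A a)"
  have "a [^]\<^bsub>A\<^esub> p = (scal (aug A a) \<oplus>\<^bsub>A\<^esub> ?x) [^]\<^bsub>A\<^esub> p"
    using aug_ideal_decomp(2)[OF a] by simp
  also have "\<dots> = scal (aug A a) [^]\<^bsub>A\<^esub> p \<oplus>\<^bsub>A\<^esub> ?x [^]\<^bsub>A\<^esub> p"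
    using a by (intro R.frobenius_add prime char_p_A) auto
  also have "?x [^]\<^bsub>A\<^esub> p = \<zero>\<^bsub>A\<^esub>"
    by (rule pow_p[OF aug_ideal_decomp(1)[OF a]])
  finally show ?thesis using a by (simp add: s.hom_nat_pow)
qed

lemma frobenius_hom: "(\<lambda>a. a [^]\<^bsub>A\<^esub> p) \<in> ring_hom A A"
  by (rule ring_hom_memI) (simp_all add: R.nat_pow_distrib R.frobenius_add prime char_p_A)

lemma frobenius_k_add:
  "\<lbrakk>x \<in> carrier k; y \<in> carrier k\<rbrakk>
    \<Longrightarrow> (x \<oplus>\<^bsub>k\<^esub> y) [^]\<^bsub>k\<^esub> (p ^ i) = x [^]\<^bsub>k\<^esub> (p ^ i) \<oplus>\<^bsub>k\<^esub> y [^]\<^bsub>k\<^esub> (p ^ i)"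
proof (induction i)
  case (Suc i)
  have pw: "z [^]\<^bsub>k\<^esub> (p ^ Suc i) = (z [^]\<^bsub>k\<^esub> (p ^ i)) [^]\<^bsub>k\<^esub> p" if "z \<in> carrier k" for z
    using that by (simp add: k.nat_pow_pow mult.commute)
  show ?case
    using Suc by (simp add: pw k.frobenius_add prime char_p del: power_Suc)
qed simp

section \<open>The ring V(A)\<close>

abbreviation "tw \<equiv> V_twist k p A"
abbreviation "V \<equiv> V_ring k p A"

lemma tw_hom: "tw i \<in> ring_hom A A"
proof (cases "i = 0")
  case True
  then show ?thesis by (auto intro: ring_hom_memI simp: V_twist_def)
next
  case False
  then have "tw i b = scal (aug A b [^]\<^bsub>k\<^esub> (p ^ i))" for b
    by (simp add: V_twist_def scal_def)
  then show ?thesis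
    by (intro ring_hom_memI) (simp_all add: k.nat_pow_distrib frobenius_k_add)
qed

sublocale tw: ring_hom_ring A A "tw i" for i
  by (rule ring_hom_ringI2) (simp_all add: R.ring_axioms tw_hom)

lemma tw_0: "tw 0 b = b"
  by (simp add: V_twist_def)

text \<open>A twist of positive order has scalar values, and on scalars \<open>aug A\<close> undoes
  \<open>scal\<close>, so the exponents multiply. Together with \<open>tw_hom\<close> this is what
  associativity of V(A) needs.\<close>

lemma tw_tw: "b \<in> carrier A \<Longrightarrow> tw i (tw j b) = tw (i + j) b"
  by (auto simp: V_twist_def scal_def[symmetric] k.nat_pow_pow power_add mult.commute)

text \<open>On A_+ both sides vanish and on scalars both are the p-th power. This is how the two
  commutation rules for P become P a = a^p P.\<close>

lemma tw_1: "b \<in> carrier A \<Longrightarrow> tw (Suc 0) b = b [^]\<^bsub>A\<^esub> p"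
  by (simp add: V_twist_def pow_p_eq_scal scal_def)

lemma V_ring_simps:
  "carrier V = carrier (free_module A (UNIV :: nat set))"
  "\<zero>\<^bsub>V\<^esub> = \<zero>\<^bsub>free_module A UNIV\<^esub>"
  "f \<oplus>\<^bsub>V\<^esub> g = f \<oplus>\<^bsub>free_module A UNIV\<^esub> g"
  "\<one>\<^bsub>V\<^esub> = V_const A \<one>\<^bsub>A\<^esub>"
  "(f \<otimes>\<^bsub>V\<^esub> g) n = (\<Oplus>\<^bsub>A\<^esub>i\<in>{..n}. f i \<otimes>\<^bsub>A\<^esub> tw i (g (n - i)))"
  by (simp_all add: V_ring_def)

lemma V_apply_closed: "f \<in> carrier V \<Longrightarrow> f n \<in> carrier A"
  unfolding V_ring_simps by (rule free_module_apply_closed[OF R.ring_axioms])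

lemma V_add_apply: "(f \<oplus>\<^bsub>V\<^esub> g) n = f n \<oplus>\<^bsub>A\<^esub> g n"
  by (simp add: V_ring_simps free_module_def)

lemma V_zero_apply: "\<zero>\<^bsub>V\<^esub> n = \<zero>\<^bsub>A\<^esub>"
  by (simp add: V_ring_simps free_module_def)

lemma V_monom_eq: "a \<in> carrier A \<Longrightarrow> V_monom A a n = a \<odot>\<^bsub>free_module A UNIV\<^esub> free_gen A n"
  by (auto simp: V_monom_def free_module_def free_gen_def)

lemma V_monom_closed [simp]: "a \<in> carrier A \<Longrightarrow> V_monom A a n \<in> carrier V"
  unfolding V_ring_simps V_monom_def
  by (rule free_module_carrierI[OF R.ring_axioms, where S = "{n}"]) auto

text \<open>The products in a ring identity are additive in each factor, so this induction reduces
  the identity to terms a P^n, where \<open>V_monom_mult\<close> computes.\<close>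

lemma V_induct [consumes 1, case_names zero monom add]:
  assumes "f \<in> carrier V" "P \<zero>\<^bsub>V\<^esub>"
    and monom: "\<And>a n. a \<in> carrier A \<Longrightarrow> P (V_monom A a n)"
    and add: "\<And>f g. \<lbrakk>f \<in> carrier V; g \<in> carrier V; P f; P g\<rbrakk> \<Longrightarrow> P (f \<oplus>\<^bsub>V\<^esub> g)"
  shows "P f"
  using assms(1) unfolding V_ring_simps(1)
proof (induction f rule: free_module_induct[OF R.ring_axioms, consumes 1,
        case_names zero smult_gen add])
  case zero
  then show ?case using assms(2) by (simp add: V_ring_simps)
next
  case (smult_gen a n)
  then show ?case using monom[of a n] by (simp add: V_monom_eq)
next
  case (add f g)
  then show ?case using assms(4)[of f g] by (simp add: V_ring_simps)
qed

lemma V_abelian_group: "abelian_group V"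
  by (rule abelian_group_transfer[OF left_module.axioms(2)[OF
        free_module_left_module[OF R.ring_axioms, of UNIV]]])
    (auto simp: V_ring_def)

interpretation Vg: abelian_group V by (rule V_abelian_group)

lemma V_l_distr:
  assumes "f \<in> carrier V" "g \<in> carrier V" "h \<in> carrier V"
  shows "(f \<oplus>\<^bsub>V\<^esub> g) \<otimes>\<^bsub>V\<^esub> h = f \<otimes>\<^bsub>V\<^esub> h \<oplus>\<^bsub>V\<^esub> g \<otimes>\<^bsub>V\<^esub> h"
proof
  fix n
  note [simp] = assms[THEN V_apply_closed]
  show "((f \<oplus>\<^bsub>V\<^esub> g) \<otimes>\<^bsub>V\<^esub> h) n = (f \<otimes>\<^bsub>V\<^esub> h \<oplus>\<^bsub>V\<^esub> g \<otimes>\<^bsub>V\<^esub> h) n"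
    by (simp add: V_add_apply V_ring_simps(5) R.l_distr R.finsum_addf Pi_def)
qed

lemma V_r_distr:
  assumes "f \<in> carrier V" "g \<in> carrier V" "h \<in> carrier V"
  shows "h \<otimes>\<^bsub>V\<^esub> (f \<oplus>\<^bsub>V\<^esub> g) = h \<otimes>\<^bsub>V\<^esub> f \<oplus>\<^bsub>V\<^esub> h \<otimes>\<^bsub>V\<^esub> g"
proof
  fix n
  note [simp] = assms[THEN V_apply_closed]
  show "(h \<otimes>\<^bsub>V\<^esub> (f \<oplus>\<^bsub>V\<^esub> g)) n = (h \<otimes>\<^bsub>V\<^esub> f \<oplus>\<^bsub>V\<^esub> h \<otimes>\<^bsub>V\<^esub> g) n"
    by (simp add: V_add_apply V_ring_simps(5) R.r_distr R.finsum_addf Pi_def)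
qed

lemma V_l_null: "f \<in> carrier V \<Longrightarrow> \<zero>\<^bsub>V\<^esub> \<otimes>\<^bsub>V\<^esub> f = \<zero>\<^bsub>V\<^esub>"
  by (rule ext) (simp add: V_zero_apply V_ring_simps(5) V_apply_closed)

lemma V_r_null: "f \<in> carrier V \<Longrightarrow> f \<otimes>\<^bsub>V\<^esub> \<zero>\<^bsub>V\<^esub> = \<zero>\<^bsub>V\<^esub>"
  by (rule ext) (simp add: V_zero_apply V_ring_simps(5) V_apply_closed)

lemmas V_monom_mult' = V_monom_mult[OF pd_algebra_axioms]

lemma V_mult_closed:
  assumes "f \<in> carrier V" "g \<in> carrier V"
  shows "f \<otimes>\<^bsub>V\<^esub> g \<in> carrier V"
  using assms(1)
proof (induction f rule: V_induct)
  case (monom a n)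
  show ?case
    using assms(2)
    by (induction g rule: V_induct)
      (simp_all add: V_r_null V_r_distr V_monom_mult' monom)
qed (simp_all add: V_l_null V_l_distr assms(2))

text \<open>For a P^i, b P^j and c P^l both bracketings are a tw_i(b) tw_(i+j)(c) P^(i+j+l), since
  twists are ring homomorphisms and compose by adding their orders.\<close>

lemma V_assoc:
  assumes "f \<in> carrier V" "g \<in> carrier V" "h \<in> carrier V"
  shows "(f \<otimes>\<^bsub>V\<^esub> g) \<otimes>\<^bsub>V\<^esub> h = f \<otimes>\<^bsub>V\<^esub> (g \<otimes>\<^bsub>V\<^esub> h)"
  using assms(1)
proof (induction f rule: V_induct)
  case (monom a i)
  show ?case
    using assms(2)
  proof (induction g rule: V_induct)
    case (monom b j)
    show ?case
      using assms(3)
      by (induction h rule: V_induct)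
        (simp_all add: V_r_null V_r_distr V_monom_mult' V_mult_closed tw_tw R.m_assoc add.assoc
          monom \<open>a \<in> carrier A\<close>)
  qed (simp_all add: V_r_null V_l_null V_l_distr V_r_distr V_mult_closed assms(3) \<open>a \<in> carrier A\<close>)
qed (simp_all add: V_l_null V_l_distr V_mult_closed assms(2,3))

lemma V_ring_ring: "ring V"
proof (rule ringI)
  show "monoid V"
  proof (rule monoidI)
    show "\<one>\<^bsub>V\<^esub> \<otimes>\<^bsub>V\<^esub> f = f" if "f \<in> carrier V" for f
      using that by (induction f rule: V_induct)
        (simp_all add: V_ring_simps(4) V_r_null V_r_distr V_monom_mult' tw_0)
    show "f \<otimes>\<^bsub>V\<^esub> \<one>\<^bsub>V\<^esub> = f" if "f \<in> carrier V" for f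
      using that by (induction f rule: V_induct)
        (simp_all add: V_ring_simps(4) V_l_null V_l_distr V_monom_mult')
  qed (simp_all add: V_mult_closed V_assoc V_ring_simps(4) del: V_ring_simps(1-3,5))
qed (simp_all add: V_abelian_group V_l_distr V_r_distr)

lemma V_const_hom: "V_const A \<in> ring_hom A V"
  by (rule ring_hom_memI)
    (auto simp: V_monom_mult' tw_0 V_ring_simps(4) V_add_apply fun_eq_iff, simp_all add: V_monom_def)

section \<open>Modules over V(A) and their homomorphisms\<close>

lemma V_monom_decomp:
  assumes "a \<in> carrier A"
  shows "V_monom A a (Suc n) = V_monom A a n \<otimes>\<^bsub>V\<^esub> V_P A"
  using assms by (simp add: V_monom_mult')

text \<open>The constants and P generate V(A) as a ring. In a P^(n+1) = (a P^n) P the factor P is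
  split off on the right and acts first, which is why the induction on n runs over all x.\<close>

lemma left_module_V_homI:
  assumes M: "left_module V M" and N: "left_module V N"
    and h: "h \<in> hom (add_monoid M) (add_monoid N)"
    and c: "\<And>a x. \<lbrakk>a \<in> carrier A; x \<in> carrier M\<rbrakk>
      \<Longrightarrow> h (V_const A a \<odot>\<^bsub>M\<^esub> x) = V_const A a \<odot>\<^bsub>N\<^esub> h x"
    and P: "\<And>x. x \<in> carrier M \<Longrightarrow> h (V_P A \<odot>\<^bsub>M\<^esub> x) = V_P A \<odot>\<^bsub>N\<^esub> h x"
  shows "h \<in> left_module_hom V M N"
proof (rule left_module_homI)
  interpret M: left_module V M by (rule M)
  interpret N: left_module V N by (rule N)
  show hc: "h x \<in> carrier N" if "x \<in> carrier M" for x
    using h that by (auto simp: hom_def)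
  show ha: "h (x \<oplus>\<^bsub>M\<^esub> y) = h x \<oplus>\<^bsub>N\<^esub> h y" if "x \<in> carrier M" "y \<in> carrier M" for x y
    using h that by (auto simp: hom_def)
  have h0: "h \<zero>\<^bsub>M\<^esub> = \<zero>\<^bsub>N\<^esub>"
    by (rule additive_hom_zero[OF h M.M.abelian_group_axioms N.M.abelian_group_axioms])
  show "h (r \<odot>\<^bsub>M\<^esub> x) = r \<odot>\<^bsub>N\<^esub> h x" if "r \<in> carrier V" "x \<in> carrier M" for r x
    using that
  proof (induction r arbitrary: x rule: V_induct)
    case zero
    then show ?case by (simp add: M.smult_l_null N.smult_l_null hc h0)
  next
    case (monom a n)
    then show ?case
    proof (induction n arbitrary: x)
      case (Suc n)
      let ?P = "V_P A" and ?a = "V_monom A a n"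
      have cl: "?P \<in> carrier V" "?a \<in> carrier V" using Suc.prems by simp_all
      have "h (V_monom A a (Suc n) \<odot>\<^bsub>M\<^esub> x) = h (?a \<odot>\<^bsub>M\<^esub> (?P \<odot>\<^bsub>M\<^esub> x))"
        using Suc.prems cl by (simp only: V_monom_decomp M.smult_assoc)
      also have "\<dots> = ?a \<odot>\<^bsub>N\<^esub> (?P \<odot>\<^bsub>N\<^esub> h x)"
        using Suc cl by (simp only: M.smult_closed P)
      also have "\<dots> = V_monom A a (Suc n) \<odot>\<^bsub>N\<^esub> h x"
        using Suc.prems cl hc by (simp only: V_monom_decomp N.smult_assoc)
      finally show ?case .
    qed (simp add: c)
  next
    case (add f g)
    then show ?case
      by (simp add: M.smult_l_distr N.smult_l_distr M.smult_closed N.smult_closed hc ha)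
  qed
qed

text \<open>Semilinearity of \<open>F\<close> is the relation P a = a^p P read on the module; it is
  what makes the action of a product of monomials come out right.\<close>

lemma V_module_of_left_module:
  assumes M: "left_module A M" and F: "F \<in> hom (add_monoid M) (add_monoid M)"
    and semi: "\<And>a m. \<lbrakk>a \<in> carrier A; m \<in> carrier M\<rbrakk>
      \<Longrightarrow> F (a \<odot>\<^bsub>M\<^esub> m) = (a [^]\<^bsub>A\<^esub> p) \<odot>\<^bsub>M\<^esub> F m"
  shows "left_module V (V_module_of A M F)"
    and "\<lbrakk>a \<in> carrier A; m \<in> carrier M\<rbrakk> \<Longrightarrow> V_monom A a n \<odot>\<^bsub>V_module_of A M F\<^esub> m = a \<odot>\<^bsub>M\<^esub> (F ^^ n) m"
proof -
  interpret M: left_module A M by (rule M)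
  interpret Fr: left_module A "free_module A (UNIV :: nat set)"
    by (rule free_module_left_module[OF R.ring_axioms])
  let ?M = "V_module_of A M F"
  have Fc [simp]: "F m \<in> carrier M" if "m \<in> carrier M" for m
    using F that by (auto simp: hom_def)
  have Fa: "F (m \<oplus>\<^bsub>M\<^esub> m') = F m \<oplus>\<^bsub>M\<^esub> F m'" if "m \<in> carrier M" "m' \<in> carrier M" for m m'
    using F that by (auto simp: hom_def)
  have Fn [simp]: "(F ^^ n) m \<in> carrier M" if "m \<in> carrier M" for n m
    using that by (induction n) auto
  have Fna: "(F ^^ n) (m \<oplus>\<^bsub>M\<^esub> m') = (F ^^ n) m \<oplus>\<^bsub>M\<^esub> (F ^^ n) m'"
    if "m \<in> carrier M" "m' \<in> carrier M" for n m m'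
    using that by (induction n) (auto simp: Fa)
  \<comment> \<open>By \<open>tw_1\<close> the p-th power is the twist of order 1, so iterating
    semilinearity n times produces the twist of order n.\<close>
  have Fns: "(F ^^ n) (a \<odot>\<^bsub>M\<^esub> m) = tw n a \<odot>\<^bsub>M\<^esub> (F ^^ n) m"
    if "a \<in> carrier A" "m \<in> carrier M" for n a m
    using that by (induction n) (simp_all add: tw_0 semi tw_1[symmetric] tw_tw)
  have act: "f \<odot>\<^bsub>?M\<^esub> m = (\<Oplus>\<^bsub>M\<^esub>n\<in>{n. f n \<noteq> \<zero>\<^bsub>A\<^esub>}. f n \<odot>\<^bsub>M\<^esub> (F ^^ n) m)" for f m
    by (simp add: V_module_of_def)
  have sel: "carrier ?M = carrier M" "add ?M = add M" "zero ?M = zero M"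
    by (simp_all add: V_module_of_def)
  \<comment> \<open>For fixed \<open>m\<close> the action is the linear extension of n \<mapsto> F^n
    m from the free module underlying V(A). This settles additivity in the ring element; additivity
    in \<open>m\<close> and associativity are then reduced to monomials.\<close>
  have hom: "(\<lambda>f. f \<odot>\<^bsub>?M\<^esub> m) \<in> left_module_hom A (free_module A UNIV) M"
    and gen: "free_gen A n \<odot>\<^bsub>?M\<^esub> m = (F ^^ n) m" if "m \<in> carrier M" for m n
    unfolding act using that
    by (intro free_module_extension[OF R.ring_axioms M, where X = UNIV]; simp)+
  have mono: "V_monom A a n \<odot>\<^bsub>?M\<^esub> m = a \<odot>\<^bsub>M\<^esub> (F ^^ n) m"
    if "a \<in> carrier A" "m \<in> carrier M" for a m n
    using left_module_homD(3)[OF hom[OF that(2)] that(1) free_gen_closed[OF R.ring_axioms UNIV_I]] that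
    by (simp add: V_monom_eq gen)
  then show "\<lbrakk>a \<in> carrier A; m \<in> carrier M\<rbrakk> \<Longrightarrow> V_monom A a n \<odot>\<^bsub>?M\<^esub> m = a \<odot>\<^bsub>M\<^esub> (F ^^ n) m" .
  have cl: "f \<odot>\<^bsub>?M\<^esub> m \<in> carrier M" if "f \<in> carrier V" "m \<in> carrier M" for f m
    using left_module_homD(1)[OF hom[OF that(2)]] that(1) by (simp add: V_ring_simps)
  have addl: "(f \<oplus>\<^bsub>V\<^esub> g) \<odot>\<^bsub>?M\<^esub> m = f \<odot>\<^bsub>?M\<^esub> m \<oplus>\<^bsub>M\<^esub> g \<odot>\<^bsub>?M\<^esub> m"
    if "f \<in> carrier V" "g \<in> carrier V" "m \<in> carrier M" for f g m
    using left_module_homD(2)[OF hom[OF that(3)]] that(1,2) by (simp add: V_ring_simps)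
  have zl: "\<zero>\<^bsub>V\<^esub> \<odot>\<^bsub>?M\<^esub> m = \<zero>\<^bsub>M\<^esub>" if "m \<in> carrier M" for m
    using left_module_hom_zero[OF hom[OF that] Fr.left_module_axioms M] by (simp add: V_ring_simps)
  have addr: "f \<odot>\<^bsub>?M\<^esub> (m \<oplus>\<^bsub>M\<^esub> m') = f \<odot>\<^bsub>?M\<^esub> m \<oplus>\<^bsub>M\<^esub> f \<odot>\<^bsub>?M\<^esub> m'"
    if "f \<in> carrier V" "m \<in> carrier M" "m' \<in> carrier M" for f m m'
    using that(1)
  proof (induction f rule: V_induct)
    case (add f g)
    then show ?case
      using that(2,3) by (simp add: addl cl M.M.a_assoc M.M.a_comm M.M.a_lcomm)
  qed (use that(2,3) in \<open>simp_all add: zl mono M.smult_r_distr Fna\<close>)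
  have zr: "f \<odot>\<^bsub>?M\<^esub> \<zero>\<^bsub>M\<^esub> = \<zero>\<^bsub>M\<^esub>" if "f \<in> carrier V" for f
    using addr[OF that, of "\<zero>\<^bsub>M\<^esub>" "\<zero>\<^bsub>M\<^esub>"] cl[OF that, of "\<zero>\<^bsub>M\<^esub>"]
    by (metis M.M.add.r_cancel_one' M.M.l_zero M.M.zero_closed)
  have assoc: "(f \<otimes>\<^bsub>V\<^esub> g) \<odot>\<^bsub>?M\<^esub> m = f \<odot>\<^bsub>?M\<^esub> (g \<odot>\<^bsub>?M\<^esub> m)"
    if "f \<in> carrier V" "g \<in> carrier V" "m \<in> carrier M" for f g m
    using that(1)
  proof (induction f rule: V_induct)
    case (monom a i)
    show ?case
      using that(2)
    proof (induction g rule: V_induct)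
      case (monom b j)
      then show ?case
        using \<open>a \<in> carrier A\<close> that(3)
        by (simp add: V_monom_mult' mono M.smult_closed M.smult_assoc Fns funpow_add)
    qed (use \<open>a \<in> carrier A\<close> that(3) in
        \<open>simp_all add: zl zr addl addr cl V_r_null V_r_distr V_mult_closed\<close>)
  qed (use that(2,3) in \<open>simp_all add: zl addl cl V_l_null V_l_distr V_mult_closed\<close>)
  show "left_module V ?M"
  proof (rule left_moduleI)
    show "abelian_group ?M"
      by (rule abelian_group_transfer[OF M.M.abelian_group_axioms sel])
  qed (simp_all add: V_ring_ring sel cl addl addr assoc V_ring_simps(4) mono M.smult_one
      del: V_ring_simps(1-3,5))
qed

end

text \<open>The twist is made of the augmentation and the structure map. A ring homomorphism that
  respects both commutes with twists, so applying it to coefficients is multiplicative.\<close>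

lemma V_ring_map_hom:
  assumes A: "pd_algebra k p A" and B: "pd_algebra k p B"
    and q: "q \<in> ring_hom A B"
    and aug: "\<And>a. a \<in> carrier A \<Longrightarrow> aug B (q a) = aug A a"
    and smult: "\<And>l. l \<in> carrier k \<Longrightarrow> q (l \<odot>\<^bsub>A\<^esub> \<one>\<^bsub>A\<^esub>) = l \<odot>\<^bsub>B\<^esub> \<one>\<^bsub>B\<^esub>"
  shows "(\<lambda>f n. q (f n)) \<in> ring_hom (V_ring k p A) (V_ring k p B)"
proof -
  interpret A: pd_algebra k p A by (rule A)
  interpret B: pd_algebra k p B by (rule B)
  interpret q: ring_hom_cring A B q
    by (intro ring_hom_cring.intro ring_hom_cring_axioms.intro A.R.cring_axioms B.R.cring_axioms q)
  have tw: "q (A.tw i b) = B.tw i (q b)" if "b \<in> carrier A" for i b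
    using that by (simp add: V_twist_def aug smult)
  show ?thesis
  proof (rule ring_hom_memI)
    fix f g assume f: "f \<in> carrier A.V" and g: "g \<in> carrier A.V"
    note [simp] = A.V_apply_closed[OF f] A.V_apply_closed[OF g]
    show "(\<lambda>n. q (f n)) \<in> carrier B.V"
      using free_module_support(2)[OF A.R.ring_axioms f[unfolded A.V_ring_simps(1)]]
      unfolding B.V_ring_simps(1) by (rule free_module_carrierI[OF B.R.ring_axioms, rotated 2]) auto
    show "(\<lambda>n. q ((f \<otimes>\<^bsub>A.V\<^esub> g) n)) = (\<lambda>n. q (f n)) \<otimes>\<^bsub>B.V\<^esub> (\<lambda>n. q (g n))"
      by (rule ext) (simp add: A.V_ring_simps(5) B.V_ring_simps(5) q.hom_finsum tw Pi_def o_def)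
    show "(\<lambda>n. q ((f \<oplus>\<^bsub>A.V\<^esub> g) n)) = (\<lambda>n. q (f n)) \<oplus>\<^bsub>B.V\<^esub> (\<lambda>n. q (g n))"
      by (rule ext) (simp add: A.V_add_apply B.V_add_apply)
  next
    show "(\<lambda>n. q (\<one>\<^bsub>A.V\<^esub> n)) = \<one>\<^bsub>B.V\<^esub>"
      by (rule ext) (simp add: A.V_ring_simps(4) B.V_ring_simps(4) V_monom_def)
  qed
qed

section \<open>The quotient by a p-ideal\<close>

lemma (in ideal) finsum_in_ideal:
  "f \<in> S \<rightarrow> I \<Longrightarrow> finsum R f S \<in> I"
  by (induction S rule: infinite_finite_induct)
    (auto simp: Pi_def Icarr finsum_insert)

context pd_algebra
begin

lemma aug_ideal_carrier: "x \<in> aug_ideal k A \<Longrightarrow> x \<in> carrier A"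
  by (simp add: aug_ideal_iff)

lemma pmap_carrier: "x \<in> aug_ideal k A \<Longrightarrow> pmap A x \<in> carrier A"
  using pmap_closed by (simp add: aug_ideal_iff)

lemma aug_ideal_smult:
  "\<lbrakk>l \<in> carrier k; x \<in> aug_ideal k A\<rbrakk> \<Longrightarrow> l \<odot>\<^bsub>A\<^esub> x \<in> aug_ideal k A"
  by (simp add: aug_ideal_iff aug_smult)

lemma aug_ideal_mult:
  "\<lbrakk>a \<in> carrier A; x \<in> aug_ideal k A\<rbrakk> \<Longrightarrow> a \<otimes>\<^bsub>A\<^esub> x \<in> aug_ideal k A"
  by (simp add: aug_ideal_iff)

lemma ideal_smult:
  "\<lbrakk>ideal I A; l \<in> carrier k; x \<in> I\<rbrakk> \<Longrightarrow> l \<odot>\<^bsub>A\<^esub> x \<in> I"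
  using ideal.I_l_closed[of I A x "scal l"] ideal.Icarr[of I A x] by (simp add: scal_mult)

text \<open>\<open>inv\<close> has a meaning only at units, so \<open>j\<close> must be non-zero in
  \<open>k\<close>. If it were zero, a Bezout relation u j = v p + 1 would turn into 0 = 1.\<close>

lemma pmap_coeff_closed: "j \<in> {1..p - 1} \<Longrightarrow> pmap_coeff k j \<in> carrier k"
proof -
  assume j: "j \<in> {1..p - 1}"
  have "[j] \<cdot>\<^bsub>k\<^esub> \<one>\<^bsub>k\<^esub> \<noteq> \<zero>\<^bsub>k\<^esub>"
  proof
    assume j0: "[j] \<cdot>\<^bsub>k\<^esub> \<one>\<^bsub>k\<^esub> = \<zero>\<^bsub>k\<^esub>"
    have "coprime j p"
      using j prime by (intro prime_imp_coprime[THEN coprime_commute[THEN iffD1]])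
        (auto dest: dvd_imp_le)
    then obtain u v where uv: "u * j = Suc (v * p)"
      using j coprime_bezout_strong[of j p] prime_gt_1_nat[OF prime] by (metis Suc_eq_plus1 mult.commute less_not_refl2)
    have mult0: "[(n * m)] \<cdot>\<^bsub>k\<^esub> \<one>\<^bsub>k\<^esub> = \<zero>\<^bsub>k\<^esub>" if "[m] \<cdot>\<^bsub>k\<^esub> \<one>\<^bsub>k\<^esub> = \<zero>\<^bsub>k\<^esub>" for m n :: nat
      using that k.add.nat_pow_pow[of "\<one>\<^bsub>k\<^esub>" n m] by (simp add: mult.commute[of n m])
    have "[(u * j)] \<cdot>\<^bsub>k\<^esub> \<one>\<^bsub>k\<^esub> = [(v * p)] \<cdot>\<^bsub>k\<^esub> \<one>\<^bsub>k\<^esub> \<oplus>\<^bsub>k\<^esub> \<one>\<^bsub>k\<^esub>"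
      unfolding uv by simp
    then show False using mult0[OF j0, of u] mult0[OF char_p, of v] by simp
  qed
  then have "[j] \<cdot>\<^bsub>k\<^esub> \<one>\<^bsub>k\<^esub> \<in> Units k" by (simp add: k.field_Units)
  then show ?thesis by (simp add: pmap_coeff_def)
qed

text \<open>The deviation of \<open>pmap\<close> from additivity only involves mixed products.\<close>

lemma pmap_add_mod_ideal:
  assumes I: "ideal I A" and x: "x \<in> aug_ideal k A" and y: "y \<in> aug_ideal k A"
    and mixed: "\<And>a b. \<lbrakk>a \<in> carrier A; b \<in> carrier A\<rbrakk> \<Longrightarrow> (a \<otimes>\<^bsub>A\<^esub> x) \<otimes>\<^bsub>A\<^esub> (b \<otimes>\<^bsub>A\<^esub> y) \<in> I"
  shows "pmap A (x \<oplus>\<^bsub>A\<^esub> y) \<ominus>\<^bsub>A\<^esub> (pmap A x \<oplus>\<^bsub>A\<^esub> pmap A y) \<in> I"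
proof -
  interpret I: ideal I A by (rule I)
  have xc: "x \<in> carrier A" "y \<in> carrier A" using x y by (simp_all add: aug_ideal_iff)
  have pc: "pmap A x \<in> carrier A" "pmap A y \<in> carrier A"
    using pmap_closed[OF x] pmap_closed[OF y] by (simp_all add: aug_ideal_iff)
  let ?s = "\<lambda>j. pmap_coeff k j \<odot>\<^bsub>A\<^esub> (x [^]\<^bsub>A\<^esub> j \<otimes>\<^bsub>A\<^esub> y [^]\<^bsub>A\<^esub> (p - j))"
  have "?s j \<in> I" if j: "j \<in> {1..p - 1}" for j
  proof (rule ideal_smult[OF I pmap_coeff_closed[OF j]])
    \<comment> \<open>For j between 1 and p - 1 both exponents are positive, so one factor
      \<open>x\<close> and one factor \<open>y\<close> can be split off; the remaining powers are
      the coefficients in \<open>mixed\<close>.\<close>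
    obtain m n where mn: "j = Suc m" "p - j = Suc n"
      using j by (cases j; cases "p - j") auto
    show "x [^]\<^bsub>A\<^esub> j \<otimes>\<^bsub>A\<^esub> y [^]\<^bsub>A\<^esub> (p - j) \<in> I"
      unfolding mn(2) unfolding mn(1) using mixed[of "x [^]\<^bsub>A\<^esub> m" "y [^]\<^bsub>A\<^esub> n"] xc by simp
  qed
  then have "(\<Oplus>\<^bsub>A\<^esub>j\<in>{1..p - 1}. ?s j) \<in> I"
    by (intro I.finsum_in_ideal) auto
  moreover from this have "(\<Oplus>\<^bsub>A\<^esub>j\<in>{1..p - 1}. ?s j) \<in> carrier A" by (rule I.Icarr)
  moreover have "(u \<oplus>\<^bsub>A\<^esub> s) \<ominus>\<^bsub>A\<^esub> u = s" if "u \<in> carrier A" "s \<in> carrier A" for u s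
    using that by (simp add: a_minus_def R.a_comm[of u s] R.a_assoc R.r_neg)
  ultimately show ?thesis
    unfolding pmap_add[OF x y] using pc by (simp only: R.a_closed)
qed

end

locale pd_quotient = pd_algebra k p A
  for k :: "('k, 'u) ring_scheme" and p :: nat and A :: "('k, 'a, 'v) pd_alg_scheme" +
  fixes J :: "'a set"
  assumes p_ideal: "p_ideal k A J"
begin

sublocale J: ideal J A
  using p_ideal by (simp add: p_ideal_def)

abbreviation q :: "'a \<Rightarrow> 'a set" where "q a \<equiv> J +>\<^bsub>A\<^esub> a"
abbreviation B :: "('k, 'a set) pd_alg" where "B \<equiv> pd_quot A J"

lemma J_aug: "x \<in> J \<Longrightarrow> x \<in> aug_ideal k A"
  using p_ideal by (auto simp: p_ideal_def)

lemma J_pmap: "x \<in> J \<Longrightarrow> pmap A x \<in> J"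
  using p_ideal by (auto simp: p_ideal_def)

lemma J_subgroup: "abelian_subgroup J A"
  by (rule abelian_subgroupI3[OF J.additive_subgroup_axioms R.abelian_group_axioms])

lemma q_eq_iff: "\<lbrakk>a \<in> carrier A; b \<in> carrier A\<rbrakk> \<Longrightarrow> q a = q b \<longleftrightarrow> a \<ominus>\<^bsub>A\<^esub> b \<in> J"
  by (rule abelian_subgroup.a_coset_eq_iff[OF J_subgroup])

lemma q_eqD:
  assumes "b \<in> q a" "a \<in> carrier A"
  shows "b \<in> carrier A" "b \<ominus>\<^bsub>A\<^esub> a \<in> J" "b = (b \<ominus>\<^bsub>A\<^esub> a) \<oplus>\<^bsub>A\<^esub> a"
proof -
  show b: "b \<in> carrier A"
    by (rule abelian_subgroup.a_elemrcos_carrier[OF J_subgroup assms(2,1)])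
  show "b \<ominus>\<^bsub>A\<^esub> a \<in> J"
    using abelian_subgroup.a_rcos_module_imp[OF J_subgroup assms(2,1)] by (simp add: a_minus_def)
  show "b = (b \<ominus>\<^bsub>A\<^esub> a) \<oplus>\<^bsub>A\<^esub> a"
    using b assms(2) by (simp add: a_minus_def R.a_assoc R.l_neg)
qed

lemma B_sel:
  "carrier B = carrier (A Quot J)" "mult B = mult (A Quot J)" "one B = one (A Quot J)"
  "zero B = zero (A Quot J)" "add B = add (A Quot J)"
  by (simp_all add: pd_quot_def)

lemma B_carrier: "carrier B = q ` carrier A"
  by (auto simp: B_sel FactRing_def A_RCOSETS_def RCOSETS_def a_r_coset_def)

lemma B_cring: "cring B"
proof -
  interpret Q: cring "A Quot J" by (rule J.quotient_is_cring[OF R.cring_axioms])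
  show ?thesis
  proof (rule cringI)
    show "abelian_group B"
      by (rule abelian_group_transfer[OF Q.abelian_group_axioms]) (simp_all add: B_sel)
    show "comm_monoid B"
      by (rule comm_monoidI) (simp_all add: B_sel Q.m_assoc, simp add: Q.m_comm)
  qed (simp add: B_sel Q.l_distr)
qed

lemma q_hom: "q \<in> ring_hom A B"
  using J.rcos_ring_hom unfolding ring_hom_def B_sel .

sublocale B: cring B by (rule B_cring)

sublocale q: ring_hom_ring A B q
  by (rule ring_hom_ringI2[OF R.ring_axioms B.ring_axioms q_hom])

lemma B_zero: "\<zero>\<^bsub>B\<^esub> = J"
  unfolding B_sel FactRing_def by simp

lemma q_zero_iff: "a \<in> carrier A \<Longrightarrow> q a = \<zero>\<^bsub>B\<^esub> \<longleftrightarrow> a \<in> J"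
  unfolding B_zero by (rule abelian_subgroup.a_coset_eq_self_iff[OF J_subgroup])

lemma B_cosetE:
  assumes "X \<in> carrier B"
  obtains a where "a \<in> carrier A" "X = q a"
  using assms unfolding B_carrier by blast

lemma B_smult:
  assumes l: "l \<in> carrier k" and a: "a \<in> carrier A"
  shows "l \<odot>\<^bsub>B\<^esub> q a = q (l \<odot>\<^bsub>A\<^esub> a)"
proof -
  have "q (l \<odot>\<^bsub>A\<^esub> b) = q (l \<odot>\<^bsub>A\<^esub> a)" if "b \<in> q a" for b
  proof -
    note b = q_eqD[OF that a]
    have "l \<odot>\<^bsub>A\<^esub> (b \<ominus>\<^bsub>A\<^esub> a) \<in> J" by (rule ideal_smult[OF J.ideal_axioms l b(2)])
    then show ?thesis
      using l a b(1) by (subst q_eq_iff)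
        (auto simp: a_minus_def alg.smult_r_distr alg.smult_r_minus)
  qed
  then have "(\<lambda>b. q (l \<odot>\<^bsub>A\<^esub> b)) ` q a = {q (l \<odot>\<^bsub>A\<^esub> a)}"
    by (rule abelian_subgroup.a_coset_image_eq[OF J_subgroup a])
  then show ?thesis by (simp add: pd_quot_def)
qed

lemma B_aug:
  assumes a: "a \<in> carrier A"
  shows "aug B (q a) = aug A a"
proof -
  have "aug A b = aug A a" if "b \<in> q a" for b
  proof -
    note b = q_eqD[OF that a]
    have "aug A (b \<ominus>\<^bsub>A\<^esub> a) = \<zero>\<^bsub>k\<^esub>" using J_aug[OF b(2)] by (simp add: aug_ideal_iff)
    moreover have "aug A b = aug A (b \<ominus>\<^bsub>A\<^esub> a) \<oplus>\<^bsub>k\<^esub> aug A a"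
      using b a by (metis R.minus_closed e.hom_add)
    ultimately show ?thesis using a by simp
  qed
  then have "aug A ` q a = {aug A a}"
    by (rule abelian_subgroup.a_coset_image_eq[OF J_subgroup a])
  then show ?thesis by (simp add: pd_quot_def)
qed

lemma B_aug_ideal_iff: "a \<in> carrier A \<Longrightarrow> q a \<in> aug_ideal k B \<longleftrightarrow> a \<in> aug_ideal k A"
  unfolding aug_ideal_iff unfolding aug_ideal_def a_kernel_def kernel_def
  by (simp add: B_aug)

lemma B_aug_idealE:
  assumes "X \<in> aug_ideal k B"
  obtains x where "x \<in> carrier A" "x \<in> aug_ideal k A" "X = q x"
proof -
  have "X \<in> carrier B"
    using assms unfolding aug_ideal_def a_kernel_def kernel_def by simp
  then obtain x where x: "x \<in> carrier A" "X = q x" by (rule B_cosetE)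
  with assms show thesis using B_aug_ideal_iff[of x] by (intro that[of x]) simp_all
qed

text \<open>For j in J every mixed product of j and a lies in J, so \<pi>(j + a) and \<pi>(j) +
  \<pi>(a) agree modulo J, and \<pi>(j) is in J because J is a p-ideal.\<close>

lemma B_pmap:
  assumes a: "a \<in> aug_ideal k A"
  shows "pmap B (q a) = q (pmap A a)"
proof -
  have ac: "a \<in> carrier A" using a by (simp add: aug_ideal_iff)
  have "q (pmap A b) = q (pmap A a)" if "b \<in> q a" for b
  proof -
    note b = q_eqD[OF that ac]
    let ?j = "b \<ominus>\<^bsub>A\<^esub> a"
    have j: "?j \<in> carrier A" using b(2) by (rule J.Icarr)
    have bA: "b \<in> aug_ideal k A"
      using b(1) ac J_aug[OF b(2)] a b(3) unfolding aug_ideal_iff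
      by (metis e.hom_add k.l_zero k.zero_closed)
    have "pmap A (?j \<oplus>\<^bsub>A\<^esub> a) \<ominus>\<^bsub>A\<^esub> (pmap A ?j \<oplus>\<^bsub>A\<^esub> pmap A a) \<in> J"
      using ac by (intro pmap_add_mod_ideal[OF J.ideal_axioms J_aug[OF b(2)] a])
        (simp add: J.I_l_closed J.I_r_closed b(2))
    then have "pmap A b \<ominus>\<^bsub>A\<^esub> (pmap A ?j \<oplus>\<^bsub>A\<^esub> pmap A a) \<in> J" using b(3) by simp
    moreover have c: "pmap A b \<in> carrier A" "pmap A a \<in> carrier A" "pmap A ?j \<in> carrier A"
      using pmap_closed[OF bA] pmap_closed[OF a] J_pmap[OF b(2)]
      by (simp_all add: aug_ideal_iff J.Icarr)
    ultimately have "q (pmap A b) = q (pmap A ?j \<oplus>\<^bsub>A\<^esub> pmap A a)"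
      by (subst q_eq_iff) simp_all
    also have "\<dots> = q (pmap A ?j) \<oplus>\<^bsub>B\<^esub> q (pmap A a)"
      using c by (intro q.hom_add)
    also have "q (pmap A ?j) = \<zero>\<^bsub>B\<^esub>"
      using c J_pmap[OF b(2)] by (simp add: q_zero_iff)
    finally show ?thesis using c by simp
  qed
  then have "(\<lambda>b. q (pmap A b)) ` q a = {q (pmap A a)}"
    by (rule abelian_subgroup.a_coset_image_eq[OF J_subgroup ac])
  then show ?thesis by (simp add: pd_quot_def)
qed

lemma B_algebra: "algebra k B"
proof (rule algebraI)
  note simps = B_smult q.hom_add[symmetric] q.hom_mult[symmetric]
  show "cring k" by (rule k.cring_axioms)
  show "cring B" by (rule B_cring)
  show "\<one>\<^bsub>k\<^esub> \<odot>\<^bsub>B\<^esub> X = X" if "X \<in> carrier B" for X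
    using that by (elim B_cosetE) (simp add: B_smult)
  fix l X assume l: "l \<in> carrier k" and "X \<in> carrier B"
  then obtain a where a: "a \<in> carrier A" "X = q a" by (elim B_cosetE)
  show "l \<odot>\<^bsub>B\<^esub> X \<in> carrier B" using l a(1) unfolding a(2) by (simp only: simps q.hom_closed alg.smult_closed)
  {
    fix m assume m: "m \<in> carrier k"
    show "(l \<oplus>\<^bsub>k\<^esub> m) \<odot>\<^bsub>B\<^esub> X = l \<odot>\<^bsub>B\<^esub> X \<oplus>\<^bsub>B\<^esub> m \<odot>\<^bsub>B\<^esub> X"
      "(l \<otimes>\<^bsub>k\<^esub> m) \<odot>\<^bsub>B\<^esub> X = l \<odot>\<^bsub>B\<^esub> (m \<odot>\<^bsub>B\<^esub> X)"
      using l m a(1) unfolding a(2)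
      by (simp_all only: simps alg.smult_closed alg.smult_l_distr alg.smult_assoc1 k.a_closed k.m_closed)
  }
  {
    fix Y assume "Y \<in> carrier B"
    then obtain b where b: "b \<in> carrier A" "Y = q b" by (elim B_cosetE)
    show "l \<odot>\<^bsub>B\<^esub> (X \<oplus>\<^bsub>B\<^esub> Y) = l \<odot>\<^bsub>B\<^esub> X \<oplus>\<^bsub>B\<^esub> l \<odot>\<^bsub>B\<^esub> Y"
      "l \<odot>\<^bsub>B\<^esub> X \<otimes>\<^bsub>B\<^esub> Y = l \<odot>\<^bsub>B\<^esub> (X \<otimes>\<^bsub>B\<^esub> Y)"
      using l a(1) b(1) unfolding a(2) b(2)
      by (simp_all only: simps alg.smult_closed alg.smult_r_distr alg.smult_assoc2 R.a_closed R.m_closed)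
  }
qed

lemma q_finsum: "f \<in> S \<rightarrow> carrier A \<Longrightarrow> q (finsum A f S) = finsum B (\<lambda>i. q (f i)) S"
  by (induction S rule: infinite_finite_induct) (simp_all add: Pi_def)

text \<open>Elements of the augmentation ideal of A/J lift to A_+, and \<open>q\<close> carries each
  axiom over from there. For the correction sum this uses that its coefficients lie in
  \<open>k\<close>, so that \<open>q\<close> commutes with them.\<close>

lemma B_pd_algebra: "pd_algebra k p B"
proof (rule pd_algebra.intro)
  show "field k" "prime p" "[p] \<cdot>\<^bsub>k\<^esub> \<one>\<^bsub>k\<^esub> = \<zero>\<^bsub>k\<^esub>" by (rule field prime char_p)+
  show "algebra k B" by (rule B_algebra)
  show "aug B \<in> ring_hom B k"
  proof (rule ring_hom_memI)
    fix X Y assume "X \<in> carrier B" "Y \<in> carrier B"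
    then obtain a b where ab: "a \<in> carrier A" "X = q a" "b \<in> carrier A" "Y = q b"
      by (elim B_cosetE)
    show "aug B X \<in> carrier k"
      "aug B (X \<otimes>\<^bsub>B\<^esub> Y) = aug B X \<otimes>\<^bsub>k\<^esub> aug B Y" "aug B (X \<oplus>\<^bsub>B\<^esub> Y) = aug B X \<oplus>\<^bsub>k\<^esub> aug B Y"
      unfolding ab(2,4) using ab(1,3)
      by (simp_all add: B_aug q.hom_add[symmetric] q.hom_mult[symmetric] del: q.hom_add q.hom_mult)
  next
    show "aug B \<one>\<^bsub>B\<^esub> = \<one>\<^bsub>k\<^esub>"
      using B_aug[OF R.one_closed] by simp
  qed
next
  fix l X assume l: "l \<in> carrier k" and "X \<in> carrier B"
  then obtain a where a: "a \<in> carrier A" "X = q a" by (elim B_cosetE)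
  show "aug B (l \<odot>\<^bsub>B\<^esub> X) = l \<otimes>\<^bsub>k\<^esub> aug B X"
    unfolding a(2) using l a(1) by (simp add: B_smult B_aug aug_smult)
next
  fix X assume "X \<in> aug_ideal k B"
  then obtain x where x: "x \<in> carrier A" "x \<in> aug_ideal k A" "X = q x" by (rule B_aug_idealE)
  have px: "pmap A x \<in> carrier A" "pmap A x \<in> aug_ideal k A"
    using pmap_closed[OF x(2)] by (simp_all add: aug_ideal_iff)
  show "pmap B X \<in> aug_ideal k B"
    unfolding x(3) B_pmap[OF x(2)] B_aug_ideal_iff[OF px(1)] by (rule px(2))
  have "X [^]\<^bsub>B\<^esub> p = q (x [^]\<^bsub>A\<^esub> p)"
    unfolding x(3) using x(1) by (simp add: q.hom_nat_pow)
  then show "X [^]\<^bsub>B\<^esub> p = \<zero>\<^bsub>B\<^esub>" by (simp add: pow_p[OF x(2)])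
  {
    fix l assume l: "l \<in> carrier k"
    show "pmap B (l \<odot>\<^bsub>B\<^esub> X) = (l [^]\<^bsub>k\<^esub> p) \<odot>\<^bsub>B\<^esub> pmap B X"
      unfolding x(3) using l x(1,2) px(1)
      by (simp add: B_smult B_pmap aug_ideal_smult pmap_smult)
  }
  fix Y assume "Y \<in> aug_ideal k B"
  then obtain y where y: "y \<in> carrier A" "y \<in> aug_ideal k A" "Y = q y" by (rule B_aug_idealE)
  have py: "pmap A y \<in> carrier A"
    using pmap_closed[OF y(2)] by (simp_all add: aug_ideal_iff)
  have "pmap B (q (x \<otimes>\<^bsub>A\<^esub> y)) = q (pmap A (x \<otimes>\<^bsub>A\<^esub> y))"
    using x(1) y(2) by (intro B_pmap aug_ideal_mult)
  then show "pmap B (X \<otimes>\<^bsub>B\<^esub> Y) = \<zero>\<^bsub>B\<^esub>"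
    unfolding x(3) y(3) using x(1) y(1) by (simp add: pmap_mult[OF x(2) y(2)])
  have xy: "x \<oplus>\<^bsub>A\<^esub> y \<in> aug_ideal k A" using x y by (simp add: aug_ideal_iff)
  let ?s = "\<lambda>j. pmap_coeff k j \<odot>\<^bsub>A\<^esub> (x [^]\<^bsub>A\<^esub> j \<otimes>\<^bsub>A\<^esub> y [^]\<^bsub>A\<^esub> (p - j))"
  have s: "?s \<in> {1..p - 1} \<rightarrow> carrier A"
    using x(1) y(1) by (intro Pi_I alg.smult_closed pmap_coeff_closed) simp_all
  have sc: "finsum A ?s {1..p - 1} \<in> carrier A" by (rule R.finsum_closed[OF s])
  have "pmap B (q (x \<oplus>\<^bsub>A\<^esub> y)) = q (pmap A x \<oplus>\<^bsub>A\<^esub> pmap A y \<oplus>\<^bsub>A\<^esub> finsum A ?s {1..p - 1})"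
    unfolding B_pmap[OF xy] pmap_add[OF x(2) y(2)] ..
  also have "\<dots> = pmap B X \<oplus>\<^bsub>B\<^esub> pmap B Y \<oplus>\<^bsub>B\<^esub> q (finsum A ?s {1..p - 1})"
    unfolding x(3) y(3) B_pmap[OF x(2)] B_pmap[OF y(2)] using px(1) py sc by simp
  also have "q (finsum A ?s {1..p - 1}) = (\<Oplus>\<^bsub>B\<^esub>j\<in>{1..p - 1}. q (?s j))"
    by (rule q_finsum[OF s])
  also have "\<dots> = (\<Oplus>\<^bsub>B\<^esub>j\<in>{1..p - 1}. pmap_coeff k j \<odot>\<^bsub>B\<^esub> (X [^]\<^bsub>B\<^esub> j \<otimes>\<^bsub>B\<^esub> Y [^]\<^bsub>B\<^esub> (p - j)))"
  proof (rule B.finsum_cong')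
    have eq: "pmap_coeff k j \<odot>\<^bsub>B\<^esub> (X [^]\<^bsub>B\<^esub> j \<otimes>\<^bsub>B\<^esub> Y [^]\<^bsub>B\<^esub> (p - j)) = q (?s j)"
      if "j \<in> {1..p - 1}" for j
      unfolding x(3) y(3) using x(1) y(1) pmap_coeff_closed[OF that]
      by (simp add: B_smult q.hom_nat_pow[symmetric] q.hom_mult[symmetric]
          del: q.hom_nat_pow q.hom_mult)
    then show "q (?s j) = pmap_coeff k j \<odot>\<^bsub>B\<^esub> (X [^]\<^bsub>B\<^esub> j \<otimes>\<^bsub>B\<^esub> Y [^]\<^bsub>B\<^esub> (p - j))"
      if "j \<in> {1..p - 1}" for j using that by simp
    show "(\<lambda>j. pmap_coeff k j \<odot>\<^bsub>B\<^esub> (X [^]\<^bsub>B\<^esub> j \<otimes>\<^bsub>B\<^esub> Y [^]\<^bsub>B\<^esub> (p - j))) \<in> {1..p - 1} \<rightarrow> carrier B"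
      using s by (intro Pi_I) (simp only: eq Pi_iff q.hom_closed)
  qed simp
  finally show "pmap B (X \<oplus>\<^bsub>B\<^esub> Y) = pmap B X \<oplus>\<^bsub>B\<^esub> pmap B Y \<oplus>\<^bsub>B\<^esub>
      (\<Oplus>\<^bsub>B\<^esub>j\<in>{1..p - 1}. pmap_coeff k j \<odot>\<^bsub>B\<^esub> (X [^]\<^bsub>B\<^esub> j \<otimes>\<^bsub>B\<^esub> Y [^]\<^bsub>B\<^esub> (p - j)))"
    unfolding x(3) y(3) using x(1) y(1) by simp
qed

sublocale Bp: pd_algebra k p B by (rule B_pd_algebra)

abbreviation "VB \<equiv> V_ring k p B"
text \<open>The ring homomorphism from A through A/J to V(A/J). Restriction along it makes a
  V(A/J)-module an A-module, so that maps into it can be lifted over A.\<close>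

abbreviation "c a \<equiv> V_const B (q a)"
abbreviation qV :: "(nat \<Rightarrow> 'a) \<Rightarrow> nat \<Rightarrow> 'a set" where "qV f \<equiv> \<lambda>n. q (f n)"

lemma qV_hom: "qV \<in> ring_hom V VB"
proof (rule V_ring_map_hom[OF pd_algebra_axioms B_pd_algebra q_hom B_aug])
  show "q (l \<odot>\<^bsub>A\<^esub> \<one>\<^bsub>A\<^esub>) = l \<odot>\<^bsub>B\<^esub> \<one>\<^bsub>B\<^esub>" if "l \<in> carrier k" for l
    using B_smult[OF that R.one_closed] by simp
qed

lemma c_hom: "c \<in> ring_hom A VB"
  using ring_hom_trans[OF q_hom Bp.V_const_hom] by (simp add: o_def)

lemma qV_monom: "a \<in> carrier A \<Longrightarrow> qV (V_monom A a n) = V_monom B (q a) n"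
  by (rule ext) (simp add: V_monom_def)

lemma descend_scalars:
  assumes M: "left_module A M"
    and kill: "\<And>j m. \<lbrakk>j \<in> J; m \<in> carrier M\<rbrakk> \<Longrightarrow> j \<odot>\<^bsub>M\<^esub> m = \<zero>\<^bsub>M\<^esub>"
  shows "left_module B (descend_scalars M)"
    and "\<lbrakk>a \<in> carrier A; m \<in> carrier M\<rbrakk> \<Longrightarrow> q a \<odot>\<^bsub>descend_scalars M\<^esub> m = a \<odot>\<^bsub>M\<^esub> m"
proof -
  interpret M: left_module A M by (rule M)
  let ?D = "descend_scalars M"
  have sel: "carrier ?D = carrier M" "add ?D = add M" "zero ?D = zero M"
    by (simp_all add: descend_scalars_def)
  have act: "q a \<odot>\<^bsub>?D\<^esub> m = a \<odot>\<^bsub>M\<^esub> m" if a: "a \<in> carrier A" and m: "m \<in> carrier M" for a m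
  proof -
    have "b \<odot>\<^bsub>M\<^esub> m = a \<odot>\<^bsub>M\<^esub> m" if "b \<in> q a" for b
    proof -
      note b = q_eqD[OF that a]
      \<comment> \<open>The difference of two representatives lies in \<open>J\<close> and acts as
        0.\<close>
      have "b \<odot>\<^bsub>M\<^esub> m = (b \<ominus>\<^bsub>A\<^esub> a) \<odot>\<^bsub>M\<^esub> m \<oplus>\<^bsub>M\<^esub> a \<odot>\<^bsub>M\<^esub> m"
        using b(1,3) a m by (metis M.smult_l_distr R.minus_closed)
      then show ?thesis using kill[OF b(2) m] a m by (simp add: M.smult_closed)
    qed
    then have "(\<lambda>b. b \<odot>\<^bsub>M\<^esub> m) ` q a = {a \<odot>\<^bsub>M\<^esub> m}"
      by (rule abelian_subgroup.a_coset_image_eq[OF J_subgroup a])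
    then show ?thesis by (simp add: descend_scalars_def)
  qed
  then show "\<lbrakk>a \<in> carrier A; m \<in> carrier M\<rbrakk> \<Longrightarrow> q a \<odot>\<^bsub>?D\<^esub> m = a \<odot>\<^bsub>M\<^esub> m" .
  note simps = sel act M.smult_closed q.hom_add[symmetric] q.hom_mult[symmetric]
  show "left_module B ?D"
  proof (rule left_moduleI)
    show "ring B" by (rule B.ring_axioms)
    show "abelian_group ?D" by (rule abelian_group_transfer[OF M.M.abelian_group_axioms sel])
    show "\<one>\<^bsub>B\<^esub> \<odot>\<^bsub>?D\<^esub> m = m" if "m \<in> carrier ?D" for m
      using act[OF R.one_closed, of m] that by (simp add: sel M.smult_one)
    fix X m assume "X \<in> carrier B" and m: "m \<in> carrier ?D"
    then obtain a where a: "a \<in> carrier A" "X = q a" by (elim B_cosetE)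
    show "X \<odot>\<^bsub>?D\<^esub> m \<in> carrier ?D" using a(1) m unfolding a(2) by (simp only: simps)
    show "X \<odot>\<^bsub>?D\<^esub> (m \<oplus>\<^bsub>?D\<^esub> n) = X \<odot>\<^bsub>?D\<^esub> m \<oplus>\<^bsub>?D\<^esub> X \<odot>\<^bsub>?D\<^esub> n" if "n \<in> carrier ?D" for n
      using that a(1) m unfolding a(2) by (simp only: simps M.M.a_closed M.smult_r_distr)
    fix Y assume "Y \<in> carrier B"
    then obtain b where b: "b \<in> carrier A" "Y = q b" by (elim B_cosetE)
    show "(X \<oplus>\<^bsub>B\<^esub> Y) \<odot>\<^bsub>?D\<^esub> m = X \<odot>\<^bsub>?D\<^esub> m \<oplus>\<^bsub>?D\<^esub> Y \<odot>\<^bsub>?D\<^esub> m"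
      "(X \<otimes>\<^bsub>B\<^esub> Y) \<odot>\<^bsub>?D\<^esub> m = X \<odot>\<^bsub>?D\<^esub> (Y \<odot>\<^bsub>?D\<^esub> m)"
      using a(1) b(1) m unfolding a(2) b(2)
      by (simp_all only: simps R.a_closed R.m_closed M.smult_l_distr M.smult_assoc)
  qed
qed

end

section \<open>The conormal module\<close>

context pd_quotient
begin

abbreviation JJ :: "'a set" where "JJ \<equiv> J \<cdot>\<^bsub>A\<^esub> J"
abbreviation JM :: "('a, 'a) module" where "JM \<equiv> regular_module A\<lparr>carrier := J\<rparr>"
abbreviation C :: "(nat \<Rightarrow> 'a set, 'a set) module" where "C \<equiv> conormal A J"

lemma JJ_ideal: "ideal JJ A"
  by (rule R.ideal_prod_is_ideal[OF J.ideal_axioms J.ideal_axioms])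

lemma JJ_subset: "JJ \<subseteq> J"
  using R.ideal_prod_inter[OF J.ideal_axioms J.ideal_axioms] by simp

lemma JM_sel:
  "carrier JM = J" "add JM = add A" "zero JM = zero A" "smult JM = mult A"
  by (simp_all add: regular_module_def)

lemma JM_left_module: "left_module A JM"
proof (rule left_moduleI)
  show "abelian_group JM"
  proof (rule abelian_groupI)
    show "\<exists>y\<in>carrier JM. y \<oplus>\<^bsub>JM\<^esub> x = \<zero>\<^bsub>JM\<^esub>" if "x \<in> carrier JM" for x
      using that J.Icarr[of x] unfolding JM_sel
      by (intro bexI[of _ "\<ominus>\<^bsub>A\<^esub> x"] R.l_neg) simp_all
  qed (simp_all add: JM_sel J.Icarr R.a_assoc, simp add: J.Icarr R.a_comm)
qed (simp_all add: JM_sel R.ring_axioms J.Icarr J.I_l_closed R.l_distr R.r_distr R.m_assoc)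

lemma JJ_submodule: "submodule JJ A JM"
proof -
  interpret JM: left_module A JM by (rule JM_left_module)
  interpret JJ: ideal JJ A by (rule JJ_ideal)
  show ?thesis
    using JJ_subset by (intro JM.submoduleI) (simp_all add: JM_sel JJ.I_l_closed)
qed

text \<open>Forming a coset uses only the addition, so shrinking the carrier to \<open>J\<close>
  changes nothing. This translates the general lemmas on quotient modules into statements about
  cosets in \<open>A\<close>.\<close>

lemma JM_coset: "JJ +>\<^bsub>JM\<^esub> x = JJ +>\<^bsub>A\<^esub> x"
  by (simp add: a_r_coset_def r_coset_def regular_module_def)

abbreviation r :: "'a \<Rightarrow> 'a set" where "r x \<equiv> JJ +>\<^bsub>A\<^esub> x"

lemmas conormal_lemmas = JM_left_module JJ_submodule

lemmas r_add = quot_module_add[OF conormal_lemmas, unfolded JM_coset JM_sel]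
  and r_smult = quot_module_smult[OF conormal_lemmas, unfolded JM_coset JM_sel]
  and r_closed = quot_module_coset_closed[OF conormal_lemmas, unfolded JM_coset JM_sel]
  and rE = quot_module_cosetE[OF conormal_lemmas, unfolded JM_coset JM_sel]

lemma JJ_subgroup: "abelian_subgroup JJ A"
  by (rule abelian_subgroupI3[OF ideal.axioms(1)[OF JJ_ideal] R.abelian_group_axioms])

lemma r_eq_iff: "\<lbrakk>x \<in> carrier A; y \<in> carrier A\<rbrakk> \<Longrightarrow> r x = r y \<longleftrightarrow> x \<ominus>\<^bsub>A\<^esub> y \<in> JJ"
  by (rule abelian_subgroup.a_coset_eq_iff[OF JJ_subgroup])

lemma r_zero_iff: "x \<in> carrier A \<Longrightarrow> r x = \<zero>\<^bsub>quot_module JM JJ\<^esub> \<longleftrightarrow> x \<in> JJ"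
  by (simp add: quot_module_zero[OF conormal_lemmas]
      abelian_subgroup.a_coset_eq_self_iff[OF JJ_subgroup])

text \<open>With both arguments in J, every mixed product is a product of two elements of J.\<close>

lemma r_pmap_add:
  assumes "x \<in> J" "y \<in> J"
  shows "r (pmap A (x \<oplus>\<^bsub>A\<^esub> y)) = r (pmap A x) \<oplus>\<^bsub>quot_module JM JJ\<^esub> r (pmap A y)"
proof -
  have xy: "x \<oplus>\<^bsub>A\<^esub> y \<in> J" using assms by simp
  note c = assms[THEN J_pmap] assms[THEN J_pmap, THEN J.Icarr] J.Icarr[OF J_pmap[OF xy]]
  have "pmap A (x \<oplus>\<^bsub>A\<^esub> y) \<ominus>\<^bsub>A\<^esub> (pmap A x \<oplus>\<^bsub>A\<^esub> pmap A y) \<in> JJ"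
    using assms
    by (intro pmap_add_mod_ideal[OF JJ_ideal] J_aug ideal_prod.prod J.I_l_closed)
  then have "r (pmap A (x \<oplus>\<^bsub>A\<^esub> y)) = r (pmap A x \<oplus>\<^bsub>A\<^esub> pmap A y)"
    using c by (subst r_eq_iff) simp_all
  then show ?thesis using c by (simp add: r_add)
qed

text \<open>Needed for the p-map to be constant on cosets of J^2. It kills products, and by
  \<open>r_pmap_add\<close> it is additive modulo J^2, so the claim passes to sums of
  products.\<close>

lemma pmap_JJ: "z \<in> JJ \<Longrightarrow> pmap A z \<in> JJ"
proof (induction z rule: ideal_prod.induct)
  case (prod i j)
  then show ?case
    using ideal.axioms(1)[OF JJ_ideal] by (simp add: pmap_mult J_aug additive_subgroup.zero_closed)
next
  case (sum s t)
  interpret Q: left_module A "quot_module JM JJ"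
    by (rule quot_module_left_module[OF conormal_lemmas])
  have st: "s \<in> J" "t \<in> J" "s \<oplus>\<^bsub>A\<^esub> t \<in> J" using sum JJ_subset by auto
  note c = st[THEN J_pmap, THEN J.Icarr]
  have "r (pmap A s) = \<zero>\<^bsub>quot_module JM JJ\<^esub>" "r (pmap A t) = \<zero>\<^bsub>quot_module JM JJ\<^esub>"
    using sum c by (simp_all add: r_zero_iff)
  then have "r (pmap A (s \<oplus>\<^bsub>A\<^esub> t)) = \<zero>\<^bsub>quot_module JM JJ\<^esub>"
    by (simp add: r_pmap_add[OF st(1,2)])
  then show ?case using c by (simp add: r_zero_iff)
qed

text \<open>Write a as \<epsilon>(a) + a_+. Then \<pi>(a_+ x) is 0, as a_+ and x are both in A_+,
  and \<pi>(\<epsilon>(a) x) brings out \<epsilon>(a)^p, which is a^p. This is the semilinearity of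
  P on J/J^2.\<close>

lemma r_pmap_mult:
  assumes a: "a \<in> carrier A" and x: "x \<in> J"
  shows "r (pmap A (a \<otimes>\<^bsub>A\<^esub> x)) = r (a [^]\<^bsub>A\<^esub> p \<otimes>\<^bsub>A\<^esub> pmap A x)"
proof -
  interpret Q: left_module A "quot_module JM JJ"
    by (rule quot_module_left_module[OF conormal_lemmas])
  let ?l = "aug A a" and ?a = "a \<ominus>\<^bsub>A\<^esub> scal (aug A a)"
  have xc: "x \<in> carrier A" using x by (rule J.Icarr)
  have l: "?l \<in> carrier k" "?a \<in> carrier A" using a by simp_all
  have "a \<otimes>\<^bsub>A\<^esub> x = (scal ?l \<oplus>\<^bsub>A\<^esub> ?a) \<otimes>\<^bsub>A\<^esub> x"
    using aug_ideal_decomp(2)[OF a] by simp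
  also have "\<dots> = ?l \<odot>\<^bsub>A\<^esub> x \<oplus>\<^bsub>A\<^esub> ?a \<otimes>\<^bsub>A\<^esub> x"
    using l xc by (simp only: R.l_distr scal_closed scal_mult)
  finally have "r (pmap A (a \<otimes>\<^bsub>A\<^esub> x)) =
      r (pmap A (?l \<odot>\<^bsub>A\<^esub> x)) \<oplus>\<^bsub>quot_module JM JJ\<^esub> r (pmap A (?a \<otimes>\<^bsub>A\<^esub> x))"
    using l x by (simp only: r_pmap_add ideal_smult[OF J.ideal_axioms] J.I_l_closed)
  also have "pmap A (?a \<otimes>\<^bsub>A\<^esub> x) = \<zero>\<^bsub>A\<^esub>"
    by (rule pmap_mult[OF aug_ideal_decomp(1)[OF a] J_aug[OF x]])
  also have "r \<zero>\<^bsub>A\<^esub> = \<zero>\<^bsub>quot_module JM JJ\<^esub>"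
    using ideal.axioms(1)[OF JJ_ideal] by (simp add: r_zero_iff additive_subgroup.zero_closed)
  also have "pmap A (?l \<odot>\<^bsub>A\<^esub> x) = a [^]\<^bsub>A\<^esub> p \<otimes>\<^bsub>A\<^esub> pmap A x"
    using l a J.Icarr[OF J_pmap[OF x]]
    by (simp add: pmap_smult J_aug x pow_p_eq_scal scal_mult)
  also have "r (a [^]\<^bsub>A\<^esub> p \<otimes>\<^bsub>A\<^esub> pmap A x) \<oplus>\<^bsub>quot_module JM JJ\<^esub> \<zero>\<^bsub>quot_module JM JJ\<^esub> =
      r (a [^]\<^bsub>A\<^esub> p \<otimes>\<^bsub>A\<^esub> pmap A x)"
    using a by (intro Q.M.r_zero r_closed J.I_l_closed J_pmap x) simp
  finally show ?thesis .
qed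

text \<open>Another representative is z + x with z in J^2; modulo J^2 its p-map is \<pi>(z) +
  \<pi>(x), and \<pi>(z) lies in J^2.\<close>

lemma UN_pmap_coset:
  assumes x: "x \<in> J"
  shows "(\<Union>y\<in>r x. r (pmap A y)) = r (pmap A x)"
proof -
  interpret Q: left_module A "quot_module JM JJ"
    by (rule quot_module_left_module[OF conormal_lemmas])
  have xc: "x \<in> carrier A" using x by (rule J.Icarr)
  have "r (pmap A y) = r (pmap A x)" if "y \<in> r x" for y
  proof -
    have "y \<oplus>\<^bsub>A\<^esub> \<ominus>\<^bsub>A\<^esub> x \<in> JJ"
      by (rule abelian_subgroup.a_rcos_module_imp[OF JJ_subgroup xc that])
    moreover define z where "z = y \<oplus>\<^bsub>A\<^esub> \<ominus>\<^bsub>A\<^esub> x"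
    moreover have "y \<in> carrier A"
      by (rule abelian_subgroup.a_elemrcos_carrier[OF JJ_subgroup xc that])
    ultimately have y: "y = z \<oplus>\<^bsub>A\<^esub> x" and z: "z \<in> JJ"
      using xc by (simp_all add: R.a_assoc R.l_neg)
    have zJ: "z \<in> J" using z JJ_subset by auto
    have "r (pmap A z) = \<zero>\<^bsub>quot_module JM JJ\<^esub>"
      using pmap_JJ[OF z] J.Icarr[OF J_pmap[OF zJ]] by (simp add: r_zero_iff)
    then show ?thesis
      unfolding y r_pmap_add[OF zJ x] using r_closed[OF J_pmap[OF x]] by simp
  qed
  then have "(\<lambda>y. r (pmap A y)) ` r x = {r (pmap A x)}"
    by (rule abelian_subgroup.a_coset_image_eq[OF JJ_subgroup xc])
  then show ?thesis by simp
qed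

lemma quot_JM_kill: "\<lbrakk>j \<in> J; m \<in> carrier (quot_module JM JJ)\<rbrakk>
  \<Longrightarrow> j \<odot>\<^bsub>quot_module JM JJ\<^esub> m = \<zero>\<^bsub>quot_module JM JJ\<^esub>"
  by (elim rE) (simp add: r_smult J.Icarr r_zero_iff ideal_prod.prod)

lemma conormal_descend:
  shows "left_module B (descend_scalars (quot_module JM JJ))"
    and "\<lbrakk>a \<in> carrier A; x \<in> J\<rbrakk> \<Longrightarrow> q a \<odot>\<^bsub>descend_scalars (quot_module JM JJ)\<^esub> r x = r (a \<otimes>\<^bsub>A\<^esub> x)"
  using descend_scalars[OF quot_module_left_module[OF conormal_lemmas], OF quot_JM_kill]
  by (simp_all add: r_closed r_smult)

lemma conormal_pmap_hom:
  "(\<lambda>X. \<Union>x\<in>X. r (pmap A x)) \<in> hom (add_monoid (descend_scalars (quot_module JM JJ)))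
    (add_monoid (descend_scalars (quot_module JM JJ)))"
proof (rule homI)
  fix X Y
  assume "X \<in> carrier (add_monoid (descend_scalars (quot_module JM JJ)))"
    "Y \<in> carrier (add_monoid (descend_scalars (quot_module JM JJ)))"
  then obtain x y where xy: "x \<in> J" "X = r x" "y \<in> J" "Y = r y"
    by (auto simp: descend_scalars_def elim!: rE)
  show "(\<Union>x\<in>X. r (pmap A x)) \<in> carrier (add_monoid (descend_scalars (quot_module JM JJ)))"
    unfolding xy(2) UN_pmap_coset[OF xy(1)]
    using r_closed[OF J_pmap[OF xy(1)]] by (simp add: descend_scalars_def)
  have "r x \<oplus>\<^bsub>quot_module JM JJ\<^esub> r y = r (x \<oplus>\<^bsub>A\<^esub> y)" using xy(1,3) by (rule r_add)
  then show "(\<Union>x\<in>X \<otimes>\<^bsub>add_monoid (descend_scalars (quot_module JM JJ))\<^esub> Y. r (pmap A x)) =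
      (\<Union>x\<in>X. r (pmap A x)) \<otimes>\<^bsub>add_monoid (descend_scalars (quot_module JM JJ))\<^esub> (\<Union>x\<in>Y. r (pmap A x))"
    using xy(1,3) unfolding xy(2,4)
    by (simp add: descend_scalars_def UN_pmap_coset r_pmap_add)
qed

lemma descend_sel:
  "carrier (descend_scalars M) = carrier M" "add (descend_scalars M) = add M"
  "zero (descend_scalars M) = zero M"
  by (simp_all add: descend_scalars_def)

lemma conormal_semilinear:
  assumes "X \<in> carrier B" "m \<in> carrier (descend_scalars (quot_module JM JJ))"
  shows "(\<Union>x\<in>X \<odot>\<^bsub>descend_scalars (quot_module JM JJ)\<^esub> m. r (pmap A x)) =
    (X [^]\<^bsub>B\<^esub> p) \<odot>\<^bsub>descend_scalars (quot_module JM JJ)\<^esub> (\<Union>x\<in>m. r (pmap A x))"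
proof -
  obtain a where a: "a \<in> carrier A" "X = q a" using assms(1) by (rule B_cosetE)
  obtain x where x: "x \<in> J" "m = r x" using assms(2) unfolding descend_sel by (rule rE)
  have "X [^]\<^bsub>B\<^esub> p = q (a [^]\<^bsub>A\<^esub> p)" unfolding a(2) using a(1) by (simp add: q.hom_nat_pow)
  then show ?thesis
    unfolding x(2) a(2) UN_pmap_coset[OF x(1)]
    using a(1) x(1) J_pmap[OF x(1)]
    by (simp add: conormal_descend(2) r_closed r_smult UN_pmap_coset J.I_l_closed r_pmap_mult)
qed

lemmas conormal_V_module = Bp.V_module_of_left_module[OF conormal_descend(1) conormal_pmap_hom,
    OF conormal_semilinear, folded conormal_def]

lemma C_left_module: "left_module VB C"
  by (rule conormal_V_module(1))

lemma C_sel: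
  "carrier C = carrier (quot_module JM JJ)" "add C = add (quot_module JM JJ)"
  "zero C = zero (quot_module JM JJ)"
  by (simp_all add: conormal_def V_module_of_def descend_scalars_def)

lemma C_const: "\<lbrakk>a \<in> carrier A; x \<in> J\<rbrakk> \<Longrightarrow> c a \<odot>\<^bsub>C\<^esub> r x = r (a \<otimes>\<^bsub>A\<^esub> x)"
  using conormal_V_module(2)[of "q a" "r x" 0]
  by (simp add: descend_sel r_closed conormal_descend(2) r_smult)

lemma C_P: "x \<in> J \<Longrightarrow> V_P B \<odot>\<^bsub>C\<^esub> r x = r (pmap A x)"
  using conormal_V_module(2)[of "q \<one>\<^bsub>A\<^esub>" "r x" 1]
    conormal_descend(2)[OF R.one_closed J_pmap, of x]
  by (simp add: descend_sel r_closed r_smult UN_pmap_coset J_pmap J.Icarr)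

text \<open>The map is first obtained over A, with \<open>N\<close> restricted along
  \<open>c\<close>. The hypothesis on \<open>pmap\<close> then makes it commute with P, hence linear
  over V(A/J).\<close>

lemma C_lift:
  assumes N: "left_module VB N" and g: "\<And>x. x \<in> J \<Longrightarrow> g x \<in> carrier N"
    and add: "\<And>x y. \<lbrakk>x \<in> J; y \<in> J\<rbrakk> \<Longrightarrow> g (x \<oplus>\<^bsub>A\<^esub> y) = g x \<oplus>\<^bsub>N\<^esub> g y"
    and mult: "\<And>a x. \<lbrakk>a \<in> carrier A; x \<in> J\<rbrakk> \<Longrightarrow> g (a \<otimes>\<^bsub>A\<^esub> x) = c a \<odot>\<^bsub>N\<^esub> g x"
    and JJ: "\<And>x. x \<in> JJ \<Longrightarrow> g x = \<zero>\<^bsub>N\<^esub>"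
    and P: "\<And>x. x \<in> J \<Longrightarrow> g (pmap A x) = V_P B \<odot>\<^bsub>N\<^esub> g x"
  shows "\<exists>\<phi>\<in>left_module_hom VB C N. \<forall>x\<in>J. \<phi> (r x) = g x"
proof -
  have L: "left_module A (restrict_scalars c N)"
    by (rule restrict_scalars_left_module[OF N R.ring_axioms c_hom])
  have "g \<in> left_module_hom A JM (restrict_scalars c N)"
    by (rule left_module_homI) (simp_all add: JM_sel restrict_scalars_def g add mult)
  then obtain \<phi> where \<phi>: "\<phi> \<in> left_module_hom A (quot_module JM JJ) (restrict_scalars c N)"
      "\<forall>x\<in>J. \<phi> (r x) = g x"
    using quot_module_lift[OF conormal_lemmas L, of g] JJ
    by (auto simp: JM_coset JM_sel restrict_scalars_def)
  note \<phi>D = left_module_homD[OF \<phi>(1)]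
  have "\<phi> \<in> left_module_hom VB C N"
  proof (rule Bp.left_module_V_homI[OF C_left_module N])
    show "\<phi> \<in> hom (add_monoid C) (add_monoid N)"
      using \<phi>D(1,2) by (intro homI) (simp_all add: C_sel restrict_scalars_def)
    fix m assume "m \<in> carrier C"
    then obtain x where x: "x \<in> J" "m = r x" unfolding C_sel by (rule rE)
    show "\<phi> (V_P B \<odot>\<^bsub>C\<^esub> m) = V_P B \<odot>\<^bsub>N\<^esub> \<phi> m"
      unfolding x(2) C_P[OF x(1)] using x(1) J_pmap[OF x(1)] \<phi>(2) P by simp
    show "\<phi> (V_const B X \<odot>\<^bsub>C\<^esub> m) = V_const B X \<odot>\<^bsub>N\<^esub> \<phi> m" if X: "X \<in> carrier B" for X
    proof -
      obtain a where a: "a \<in> carrier A" "X = q a" using X by (rule B_cosetE)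
      show ?thesis
        unfolding x(2) a(2) C_const[OF a(1) x(1)]
        using x(1) a(1) \<phi>(2) mult by (simp add: J.I_l_closed)
    qed
  qed
  then show ?thesis using \<phi>(2) by blast
qed

end

section \<open>The module of differentials\<close>

context pd_algebra
begin

abbreviation W :: "(nat \<Rightarrow> 'a, ('a \<Rightarrow> nat \<Rightarrow> 'a) set) module" where "W \<equiv> Omega k p A"
abbreviation d :: "'a \<Rightarrow> ('a \<Rightarrow> nat \<Rightarrow> 'a) set" where "d \<equiv> Omega_d k p A"

context
begin

private abbreviation "F \<equiv> free_module V (carrier A)"
private abbreviation "e \<equiv> free_gen V"
private abbreviation "pr \<equiv> presentation_proj V (carrier A) (Omega_rels k p A)"

interpretation F: left_module V F
  by (rule free_module_left_module[OF V_ring_ring])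

lemma Omega_gen_closed: "a \<in> carrier A \<Longrightarrow> e a \<in> carrier F"
  by (rule free_gen_closed[OF V_ring_ring])

lemma Omega_eq: "W = presentation V (carrier A) (Omega_rels k p A)"
  by (simp add: Omega_def presentation_def Let_def)

lemma Omega_d_eq: "d a = pr (e a)"
  by (simp add: Omega_d_def presentation_proj_def Let_def)

lemma Omega_rels_eq:
  "Omega_rels k p A =
      {e (scal l) | l. l \<in> carrier k}
    \<union> {e (l \<odot>\<^bsub>A\<^esub> a \<oplus>\<^bsub>A\<^esub> m \<odot>\<^bsub>A\<^esub> b) \<ominus>\<^bsub>F\<^esub>
        (V_const A (scal l) \<odot>\<^bsub>F\<^esub> e a \<oplus>\<^bsub>F\<^esub> V_const A (scal m) \<odot>\<^bsub>F\<^esub> e b) | l m a b.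
          l \<in> carrier k \<and> m \<in> carrier k \<and> a \<in> carrier A \<and> b \<in> carrier A}
    \<union> {e (a \<otimes>\<^bsub>A\<^esub> b) \<ominus>\<^bsub>F\<^esub> (V_const A a \<odot>\<^bsub>F\<^esub> e b \<oplus>\<^bsub>F\<^esub> V_const A b \<odot>\<^bsub>F\<^esub> e a) | a b.
          a \<in> carrier A \<and> b \<in> carrier A}
    \<union> {e (pmap A x) \<ominus>\<^bsub>F\<^esub>
          (V_P A \<odot>\<^bsub>F\<^esub> e x \<ominus>\<^bsub>F\<^esub> V_const A (x [^]\<^bsub>A\<^esub> (p - 1)) \<odot>\<^bsub>F\<^esub> e x) | x.
          x \<in> aug_ideal k A}"
  unfolding Omega_rels_def Let_def scal_def ..

lemmas Omega_closed = Omega_gen_closed F.smult_closed F.M.a_closed F.M.minus_closed V_monom_closed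
  R.one_closed R.a_closed R.m_closed R.nat_pow_closed alg.smult_closed scal_closed
  pmap_carrier

lemma Omega_rels_subset: "Omega_rels k p A \<subseteq> carrier F"
  unfolding Omega_rels_eq by (auto simp only: intro!: Omega_closed intro: aug_ideal_carrier)

lemmas Omega_pres = V_ring_ring Omega_rels_subset

lemma Omega_left_module: "left_module V W"
  unfolding Omega_eq by (rule presentation_left_module[OF Omega_pres])

lemmas prD = left_module_homD[OF presentation_proj_hom[OF Omega_pres], folded Omega_eq]

lemma pr_minus: "\<lbrakk>f \<in> carrier F; g \<in> carrier F\<rbrakk> \<Longrightarrow> pr (f \<ominus>\<^bsub>F\<^esub> g) = pr f \<ominus>\<^bsub>W\<^esub> pr g"
  unfolding Omega_eq
  by (rule left_module_hom_minus[OF presentation_proj_hom[OF Omega_pres] F.left_module_axioms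
      presentation_left_module[OF Omega_pres]])

lemma d_closed: "a \<in> carrier A \<Longrightarrow> d a \<in> carrier W"
  unfolding Omega_d_eq by (intro prD Omega_gen_closed)

lemma d_scal: "l \<in> carrier k \<Longrightarrow> d (scal l) = \<zero>\<^bsub>W\<^esub>"
  unfolding Omega_d_eq Omega_eq
  by (rule presentation_rel[OF Omega_pres]) (auto simp: Omega_rels_eq)

lemma d_linear:
  assumes "l \<in> carrier k" "m \<in> carrier k" "a \<in> carrier A" "b \<in> carrier A"
  shows "d (l \<odot>\<^bsub>A\<^esub> a \<oplus>\<^bsub>A\<^esub> m \<odot>\<^bsub>A\<^esub> b) =
    V_const A (scal l) \<odot>\<^bsub>W\<^esub> d a \<oplus>\<^bsub>W\<^esub> V_const A (scal m) \<odot>\<^bsub>W\<^esub> d b"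
proof -
  have "pr (e (l \<odot>\<^bsub>A\<^esub> a \<oplus>\<^bsub>A\<^esub> m \<odot>\<^bsub>A\<^esub> b)) =
      pr (V_const A (scal l) \<odot>\<^bsub>F\<^esub> e a \<oplus>\<^bsub>F\<^esub> V_const A (scal m) \<odot>\<^bsub>F\<^esub> e b)"
    using assms by (intro presentation_rel_eq[OF Omega_pres] Omega_closed)
      (unfold Omega_rels_eq, blast)
  then show ?thesis
    using assms by (simp add: Omega_d_eq prD Omega_gen_closed F.smult_closed)
qed

lemma d_add:
  assumes "a \<in> carrier A" "b \<in> carrier A"
  shows "d (a \<oplus>\<^bsub>A\<^esub> b) = d a \<oplus>\<^bsub>W\<^esub> d b"
proof -
  interpret W: left_module V W by (rule Omega_left_module)
  have "scal \<one>\<^bsub>k\<^esub> = \<one>\<^bsub>A\<^esub>" by simp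
  then show ?thesis
    using d_linear[of "\<one>\<^bsub>k\<^esub>" "\<one>\<^bsub>k\<^esub>" a b] assms W.smult_one
    by (simp add: d_closed V_ring_simps(4)[symmetric] del: V_ring_simps)
qed

lemma d_mult:
  assumes "a \<in> carrier A" "b \<in> carrier A"
  shows "d (a \<otimes>\<^bsub>A\<^esub> b) = V_const A a \<odot>\<^bsub>W\<^esub> d b \<oplus>\<^bsub>W\<^esub> V_const A b \<odot>\<^bsub>W\<^esub> d a"
proof -
  have "pr (e (a \<otimes>\<^bsub>A\<^esub> b)) = pr (V_const A a \<odot>\<^bsub>F\<^esub> e b \<oplus>\<^bsub>F\<^esub> V_const A b \<odot>\<^bsub>F\<^esub> e a)"
    using assms by (intro presentation_rel_eq[OF Omega_pres] Omega_closed)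
      (unfold Omega_rels_eq, blast)
  then show ?thesis
    using assms by (simp add: Omega_d_eq prD Omega_gen_closed F.smult_closed)
qed

lemma d_pmap:
  assumes x: "x \<in> aug_ideal k A"
  shows "d (pmap A x) = V_P A \<odot>\<^bsub>W\<^esub> d x \<ominus>\<^bsub>W\<^esub> V_const A (x [^]\<^bsub>A\<^esub> (p - 1)) \<odot>\<^bsub>W\<^esub> d x"
proof -
  have xc: "x \<in> carrier A" using x by (rule aug_ideal_carrier)
  have "pr (e (pmap A x)) =
      pr (V_P A \<odot>\<^bsub>F\<^esub> e x \<ominus>\<^bsub>F\<^esub> V_const A (x [^]\<^bsub>A\<^esub> (p - 1)) \<odot>\<^bsub>F\<^esub> e x)"
    using x xc by (intro presentation_rel_eq[OF Omega_pres] Omega_closed)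
      (unfold Omega_rels_eq, blast)
  also have "\<dots> = V_P A \<odot>\<^bsub>W\<^esub> pr (e x) \<ominus>\<^bsub>W\<^esub> V_const A (x [^]\<^bsub>A\<^esub> (p - 1)) \<odot>\<^bsub>W\<^esub> pr (e x)"
    using xc by (simp only: pr_minus prD Omega_closed)
  finally show ?thesis unfolding Omega_d_eq .
qed

lemma Omega_generate:
  assumes "submodule N V W" "\<And>a. a \<in> carrier A \<Longrightarrow> d a \<in> N"
  shows "carrier W = N"
  using presentation_gens_generate[OF Omega_pres] assms unfolding Omega_d_eq Omega_eq by blast

lemma Omega_hom_eqI:
  assumes "left_module V M" "h \<in> left_module_hom V W M" "g \<in> left_module_hom V W M"
    and "\<And>a. a \<in> carrier A \<Longrightarrow> h (d a) = g (d a)" and "w \<in> carrier W"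
  shows "h w = g w"
  using presentation_hom_eqI[OF Omega_pres] assms unfolding Omega_d_eq Omega_eq by blast

lemma Omega_lift:
  assumes M: "left_module V M" and u: "\<And>a. a \<in> carrier A \<Longrightarrow> u a \<in> carrier M"
    and scal: "\<And>l. l \<in> carrier k \<Longrightarrow> u (scal l) = \<zero>\<^bsub>M\<^esub>"
    and add: "\<And>a b. \<lbrakk>a \<in> carrier A; b \<in> carrier A\<rbrakk> \<Longrightarrow> u (a \<oplus>\<^bsub>A\<^esub> b) = u a \<oplus>\<^bsub>M\<^esub> u b"
    and mult: "\<And>a b. \<lbrakk>a \<in> carrier A; b \<in> carrier A\<rbrakk> \<Longrightarrow>
      u (a \<otimes>\<^bsub>A\<^esub> b) = V_const A a \<odot>\<^bsub>M\<^esub> u b \<oplus>\<^bsub>M\<^esub> V_const A b \<odot>\<^bsub>M\<^esub> u a"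
    and pmap: "\<And>x. x \<in> aug_ideal k A \<Longrightarrow>
      u (pmap A x) = V_P A \<odot>\<^bsub>M\<^esub> u x \<ominus>\<^bsub>M\<^esub> V_const A (x [^]\<^bsub>A\<^esub> (p - 1)) \<odot>\<^bsub>M\<^esub> u x"
  shows "\<exists>g\<in>left_module_hom V W M. \<forall>a\<in>carrier A. g (d a) = u a"
  unfolding Omega_d_eq Omega_eq
proof (rule presentation_lift[OF Omega_pres M])
  interpret M: left_module V M by (rule M)
  show "u \<in> carrier A \<rightarrow> carrier M" using u by blast
  \<comment> \<open>In the Leibniz rule for a scalar times \<open>a\<close> the term with
    \<open>u (scal l)\<close> is zero, and what remains is k-linearity. The linear relations thus
    follow from \<open>scal\<close>, \<open>add\<close> and \<open>mult\<close>.\<close>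
  have smult: "u (l \<odot>\<^bsub>A\<^esub> a) = V_const A (scal l) \<odot>\<^bsub>M\<^esub> u a"
    if "l \<in> carrier k" "a \<in> carrier A" for l a
    using that mult[of "scal l" a] u
    by (simp add: scal scal_mult M.smult_r_null M.smult_closed)
  fix h s
  assume h: "h \<in> left_module_hom V F M" and hu: "\<And>a. a \<in> carrier A \<Longrightarrow> h (e a) = u a"
    and s: "s \<in> Omega_rels k p A"
  note hD = left_module_homD[OF h] left_module_hom_minus[OF h F.left_module_axioms M]
  have eq0: "h (f \<ominus>\<^bsub>F\<^esub> g) = \<zero>\<^bsub>M\<^esub>" if "f \<in> carrier F" "g \<in> carrier F" "h f = h g" for f g
    using that hD(1)[of g] by (simp add: hD(4) M.M.minus_eq_zero_iff)
  from s show "h s = \<zero>\<^bsub>M\<^esub>"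
    unfolding Omega_rels_eq
  proof (elim UnE CollectE exE conjE)
    fix l assume "s = e (scal l)" "l \<in> carrier k"
    then show ?thesis by (simp add: hu scal)
  next
    fix l m a b
    assume s: "s = e (l \<odot>\<^bsub>A\<^esub> a \<oplus>\<^bsub>A\<^esub> m \<odot>\<^bsub>A\<^esub> b) \<ominus>\<^bsub>F\<^esub>
        (V_const A (scal l) \<odot>\<^bsub>F\<^esub> e a \<oplus>\<^bsub>F\<^esub> V_const A (scal m) \<odot>\<^bsub>F\<^esub> e b)"
      and [simp]: "l \<in> carrier k" "m \<in> carrier k" "a \<in> carrier A" "b \<in> carrier A"
    show ?thesis
      unfolding s
      by (rule eq0) (simp_all add: Omega_gen_closed F.smult_closed hD(2,3) hu add smult)
  next
    fix a b
    assume s: "s = e (a \<otimes>\<^bsub>A\<^esub> b) \<ominus>\<^bsub>F\<^esub> (V_const A a \<odot>\<^bsub>F\<^esub> e b \<oplus>\<^bsub>F\<^esub> V_const A b \<odot>\<^bsub>F\<^esub> e a)"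
      and [simp]: "a \<in> carrier A" "b \<in> carrier A"
    show ?thesis
      unfolding s by (rule eq0) (simp_all add: Omega_gen_closed F.smult_closed hD(2,3) hu mult)
  next
    fix x
    assume s: "s = e (pmap A x) \<ominus>\<^bsub>F\<^esub>
        (V_P A \<odot>\<^bsub>F\<^esub> e x \<ominus>\<^bsub>F\<^esub> V_const A (x [^]\<^bsub>A\<^esub> (p - 1)) \<odot>\<^bsub>F\<^esub> e x)"
      and x: "x \<in> aug_ideal k A"
    note [simp] = aug_ideal_carrier[OF x] aug_ideal_carrier[OF pmap_closed[OF x]]
    show ?thesis
      unfolding s by (rule eq0) (simp_all only: Omega_closed hD(3,4) hu pmap[OF x] \<open>x \<in> carrier A\<close> \<open>pmap A x \<in> carrier A\<close>)
  qed
qed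

end

end

section \<open>Tensor products\<close>

context
  fixes R :: "('r, 'u) ring_scheme" and M :: "('r, 'm, 'v) module_scheme"
    and N :: "('r, 'n, 'w) module_scheme"
  assumes M: "left_module R M" and N: "left_module R N"
begin

interpretation M: left_module R M by (rule M)
interpretation N: left_module R N by (rule N)

private abbreviation "X \<equiv> carrier M \<times> carrier N"
private abbreviation "F \<equiv> free_module R X"
private abbreviation "e \<equiv> free_gen R"
private abbreviation "pr \<equiv> presentation_proj R X (tensor_rels R M N)"
private abbreviation "T \<equiv> tensor R M N"
private abbreviation "t \<equiv> tensor_elt R M N"

interpretation F: left_module R F
  by (rule free_module_left_module[OF M.R.ring_axioms])

lemma tensor_eq: "T = presentation R X (tensor_rels R M N)"
  by (simp add: tensor_def presentation_def Let_def)

lemma tensor_elt_eq: "t x y = pr (e (x, y))"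
  by (simp add: tensor_elt_def presentation_proj_def Let_def)

lemma tensor_gen_closed: "\<lbrakk>x \<in> carrier M; y \<in> carrier N\<rbrakk> \<Longrightarrow> e (x, y) \<in> carrier F"
  by (rule free_gen_closed[OF M.R.ring_axioms]) simp

lemmas tensor_closed = tensor_gen_closed F.smult_closed F.M.a_closed F.M.minus_closed
  M.smult_closed N.smult_closed M.M.a_closed N.M.a_closed

lemma tensor_rels_subset: "tensor_rels R M N \<subseteq> carrier F"
  unfolding tensor_rels_def Let_def by (auto simp only: intro!: tensor_closed)

lemmas tensor_pres = M.R.ring_axioms tensor_rels_subset

lemma tensor_left_module: "left_module R T"
  unfolding tensor_eq by (rule presentation_left_module[OF tensor_pres])

lemmas tensor_prD = left_module_homD[OF presentation_proj_hom[OF tensor_pres], folded tensor_eq]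

lemma tensor_elt_closed: "\<lbrakk>x \<in> carrier M; y \<in> carrier N\<rbrakk> \<Longrightarrow> t x y \<in> carrier T"
  unfolding tensor_elt_eq by (intro tensor_prD tensor_gen_closed)

lemma tensor_elt_add_left:
  assumes "x \<in> carrier M" "x' \<in> carrier M" "y \<in> carrier N"
  shows "t (x \<oplus>\<^bsub>M\<^esub> x') y = t x y \<oplus>\<^bsub>T\<^esub> t x' y"
proof -
  have "pr (e (x \<oplus>\<^bsub>M\<^esub> x', y)) = pr (e (x, y) \<oplus>\<^bsub>F\<^esub> e (x', y))"
    using assms by (intro presentation_rel_eq[OF tensor_pres] tensor_closed)
      (unfold tensor_rels_def Let_def, blast)
  then show ?thesis using assms by (simp add: tensor_elt_eq tensor_prD tensor_closed)
qed

lemma tensor_elt_smult_left: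
  assumes "a \<in> carrier R" "x \<in> carrier M" "y \<in> carrier N"
  shows "t (a \<odot>\<^bsub>M\<^esub> x) y = a \<odot>\<^bsub>T\<^esub> t x y"
proof -
  have "pr (e (a \<odot>\<^bsub>M\<^esub> x, y)) = pr (a \<odot>\<^bsub>F\<^esub> e (x, y))"
    using assms by (intro presentation_rel_eq[OF tensor_pres] tensor_closed)
      (unfold tensor_rels_def Let_def, blast)
  then show ?thesis using assms by (simp add: tensor_elt_eq tensor_prD tensor_closed)
qed

lemma tensor_elt_smult_right:
  assumes "a \<in> carrier R" "x \<in> carrier M" "y \<in> carrier N"
  shows "t x (a \<odot>\<^bsub>N\<^esub> y) = a \<odot>\<^bsub>T\<^esub> t x y"
proof -
  have "pr (e (x, a \<odot>\<^bsub>N\<^esub> y)) = pr (a \<odot>\<^bsub>F\<^esub> e (x, y))"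
    using assms by (intro presentation_rel_eq[OF tensor_pres] tensor_closed)
      (unfold tensor_rels_def Let_def, blast)
  then show ?thesis using assms by (simp add: tensor_elt_eq tensor_prD tensor_closed)
qed

lemma tensor_generate:
  assumes "submodule U R T" "\<And>x y. \<lbrakk>x \<in> carrier M; y \<in> carrier N\<rbrakk> \<Longrightarrow> t x y \<in> U"
  shows "carrier T = U"
  using presentation_gens_generate[OF tensor_pres] assms unfolding tensor_elt_eq tensor_eq by blast

lemma tensor_lift:
  assumes L: "left_module R L"
    and b: "\<And>x y. \<lbrakk>x \<in> carrier M; y \<in> carrier N\<rbrakk> \<Longrightarrow> b x y \<in> carrier L"
    and add_left: "\<And>x x' y. \<lbrakk>x \<in> carrier M; x' \<in> carrier M; y \<in> carrier N\<rbrakk>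
      \<Longrightarrow> b (x \<oplus>\<^bsub>M\<^esub> x') y = b x y \<oplus>\<^bsub>L\<^esub> b x' y"
    and add_right: "\<And>x y y'. \<lbrakk>x \<in> carrier M; y \<in> carrier N; y' \<in> carrier N\<rbrakk>
      \<Longrightarrow> b x (y \<oplus>\<^bsub>N\<^esub> y') = b x y \<oplus>\<^bsub>L\<^esub> b x y'"
    and smult_left: "\<And>a x y. \<lbrakk>a \<in> carrier R; x \<in> carrier M; y \<in> carrier N\<rbrakk>
      \<Longrightarrow> b (a \<odot>\<^bsub>M\<^esub> x) y = a \<odot>\<^bsub>L\<^esub> b x y"
    and smult_right: "\<And>a x y. \<lbrakk>a \<in> carrier R; x \<in> carrier M; y \<in> carrier N\<rbrakk>
      \<Longrightarrow> b x (a \<odot>\<^bsub>N\<^esub> y) = a \<odot>\<^bsub>L\<^esub> b x y"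
  shows "\<exists>g\<in>left_module_hom R T L. \<forall>x\<in>carrier M. \<forall>y\<in>carrier N. g (t x y) = b x y"
proof -
  interpret L: left_module R L by (rule L)
  have "\<exists>g\<in>left_module_hom R T L. \<forall>z\<in>X. g (pr (e z)) = b (fst z) (snd z)"
    unfolding tensor_eq
  proof (rule presentation_lift[OF tensor_pres L])
    show "(\<lambda>z. b (fst z) (snd z)) \<in> X \<rightarrow> carrier L" using b by auto
    fix h s
    assume h: "h \<in> left_module_hom R F L" and hz: "\<And>z. z \<in> X \<Longrightarrow> h (e z) = b (fst z) (snd z)"
      and s: "s \<in> tensor_rels R M N"
    have he: "h (e (x, y)) = b x y" if "x \<in> carrier M" "y \<in> carrier N" for x y
      using hz[of "(x, y)"] that by simp
    note hD = left_module_homD[OF h] left_module_hom_minus[OF h F.left_module_axioms L]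
    have eq0: "h (f \<ominus>\<^bsub>F\<^esub> g) = \<zero>\<^bsub>L\<^esub>" if "f \<in> carrier F" "g \<in> carrier F" "h f = h g" for f g
      using that hD(1)[of g] by (simp add: hD(4) L.M.minus_eq_zero_iff)
    from s show "h s = \<zero>\<^bsub>L\<^esub>"
      unfolding tensor_rels_def Let_def
      by (elim UnE CollectE exE conjE; hypsubst; intro eq0 tensor_closed)
        (simp_all only: hD(2,3) he tensor_closed add_left add_right smult_left smult_right)
  qed
  then show ?thesis unfolding tensor_elt_eq by fastforce
qed

end

section \<open>Base change of the differentials\<close>

lemma left_module_hom_restrict_scalars:
  assumes "g \<in> left_module_hom R M N" "h \<in> ring_hom S R"
  shows "g \<in> left_module_hom S (restrict_scalars h M) (restrict_scalars h N)"
  by (rule left_module_homI)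
    (simp_all add: restrict_scalars_def left_module_homD[OF assms(1)] ring_hom_closed[OF assms(2)])

lemma restrict_scalars_sel:
  "carrier (restrict_scalars h M) = carrier M" "add (restrict_scalars h M) = add M"
  "zero (restrict_scalars h M) = zero M" "x \<odot>\<^bsub>restrict_scalars h M\<^esub> m = h x \<odot>\<^bsub>M\<^esub> m"
  by (simp_all add: restrict_scalars_def)

lemma restrict_scalars_minus: "x \<ominus>\<^bsub>restrict_scalars h M\<^esub> y = x \<ominus>\<^bsub>M\<^esub> y"
  by (simp add: restrict_scalars_def a_minus_def a_inv_def m_inv_def)

context pd_quotient
begin

abbreviation M :: "('a, ('a \<Rightarrow> nat \<Rightarrow> 'a) set) module" where "M \<equiv> Omega_as_A_module k p A"
abbreviation AJ :: "('a, 'a set) module" where "AJ \<equiv> quot_module (regular_module A) J"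
abbreviation T0 :: "('a, (('a \<Rightarrow> nat \<Rightarrow> 'a) set \<times> 'a set \<Rightarrow> 'a) set) module"
  where "T0 \<equiv> Omega_tensor k p A J"
abbreviation T :: "(nat \<Rightarrow> 'a set, (('a \<Rightarrow> nat \<Rightarrow> 'a) set \<times> 'a set \<Rightarrow> 'a) set) module"
  where "T \<equiv> Omega_base_change k p A J"
abbreviation t :: "('a \<Rightarrow> nat \<Rightarrow> 'a) set \<Rightarrow> 'a set \<Rightarrow> (('a \<Rightarrow> nat \<Rightarrow> 'a) set \<times> 'a set \<Rightarrow> 'a) set"
  where "t \<equiv> Omega_tensor_elt k p A J"
abbreviation \<iota> :: "('a \<Rightarrow> nat \<Rightarrow> 'a) set \<Rightarrow> (('a \<Rightarrow> nat \<Rightarrow> 'a) set \<times> 'a set \<Rightarrow> 'a) set"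
  where "\<iota> w \<equiv> t w (q \<one>\<^bsub>A\<^esub>)"

text \<open>Otherwise the simplifier destroys the form \<open>t w (q \<one>)\<close> of \<open>\<iota> w\<close>.\<close>

declare q.hom_one [simp del]

interpretation W: left_module V W by (rule Omega_left_module)
interpretation W': left_module VB Bp.W by (rule Bp.Omega_left_module)

lemma qV_const: "a \<in> carrier A \<Longrightarrow> qV (V_const A a) = c a"
  by (rule qV_monom)

lemma qV_P: "qV (V_P A) = V_P B"
  using qV_monom[OF R.one_closed, of 1] by (simp only: q.hom_one)

lemma M_left_module: "left_module A M"
  unfolding Omega_as_A_module_def
  by (rule restrict_scalars_left_module[OF Omega_left_module R.ring_axioms V_const_hom])

lemmas M_sel = restrict_scalars_sel[of "V_const A" W, folded Omega_as_A_module_def]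

section \<open>A/J as an A-module and the tensor product over A\<close>

lemma J_submodule: "submodule J A (regular_module A)"
  by (rule left_module.submoduleI[OF regular_module_left_module[OF R.ring_axioms]])
    (simp_all add: regular_module_def J.a_subset J.I_l_closed)

lemma regular_coset: "J +>\<^bsub>regular_module A\<^esub> a = q a"
  by (simp add: a_r_coset_def r_coset_def regular_module_def)

lemma regular_sel:
  "carrier (regular_module A) = carrier A" "add (regular_module A) = add A"
  "smult (regular_module A) = mult A"
  by (simp_all add: regular_module_def)

lemmas AJ_lemmas = regular_module_left_module[OF R.ring_axioms] J_submodule

lemmas AJ_left_module = quot_module_left_module[OF AJ_lemmas]
lemmas AJ_add = quot_module_add[OF AJ_lemmas, unfolded regular_coset regular_sel]
lemmas AJ_smult = quot_module_smult[OF AJ_lemmas, unfolded regular_coset regular_sel]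
lemmas AJ_closed = quot_module_coset_closed[OF AJ_lemmas, unfolded regular_coset regular_sel]
lemmas AJ_cosetE = quot_module_cosetE[OF AJ_lemmas, unfolded regular_coset regular_sel]

lemmas MAJ = M_left_module AJ_left_module

lemmas T0_left_module = tensor_left_module[OF MAJ, folded Omega_tensor_def]

interpretation T0: left_module A T0 by (rule T0_left_module)

lemma t_eq: "t = tensor_elt A M AJ"
  by (intro ext) (simp add: Omega_tensor_elt_def)

lemmas t_closed = tensor_elt_closed[OF MAJ, folded t_eq Omega_tensor_def, unfolded M_sel]
lemmas t_add_left = tensor_elt_add_left[OF MAJ, folded t_eq Omega_tensor_def, unfolded M_sel]
lemmas t_smult_left = tensor_elt_smult_left[OF MAJ, folded t_eq Omega_tensor_def, unfolded M_sel]
lemmas t_smult_right = tensor_elt_smult_right[OF MAJ, folded t_eq Omega_tensor_def, unfolded M_sel]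
lemmas T0_generate = tensor_generate[OF MAJ, folded t_eq Omega_tensor_def, unfolded M_sel]
lemmas T0_lift = tensor_lift[OF MAJ, folded t_eq Omega_tensor_def, unfolded M_sel]

lemma q1_closed: "q \<one>\<^bsub>A\<^esub> \<in> carrier AJ"
  by (rule AJ_closed) simp

lemma \<iota>_closed: "w \<in> carrier W \<Longrightarrow> \<iota> w \<in> carrier T0"
  by (rule t_closed[OF _ q1_closed])

lemma \<iota>_add: "\<lbrakk>w \<in> carrier W; w' \<in> carrier W\<rbrakk> \<Longrightarrow> \<iota> (w \<oplus>\<^bsub>W\<^esub> w') = \<iota> w \<oplus>\<^bsub>T0\<^esub> \<iota> w'"
  by (rule t_add_left[OF _ _ q1_closed])

lemma \<iota>_smult: "\<lbrakk>a \<in> carrier A; w \<in> carrier W\<rbrakk> \<Longrightarrow> \<iota> (V_const A a \<odot>\<^bsub>W\<^esub> w) = a \<odot>\<^bsub>T0\<^esub> \<iota> w"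
  by (rule t_smult_left[OF _ _ q1_closed])

lemma t_q: "\<lbrakk>w \<in> carrier W; a \<in> carrier A\<rbrakk> \<Longrightarrow> t w (q a) = a \<odot>\<^bsub>T0\<^esub> \<iota> w"
  using t_smult_right[OF _ _ q1_closed, of a w] AJ_smult[of a "\<one>\<^bsub>A\<^esub>"] by simp

text \<open>A/J is generated by 1 over A, so the a in w \<otimes> (a + J) can be moved to the left
  factor. The image of the linear map \<iota> is therefore a submodule that contains all pure
  tensors.\<close>

lemma T0_carrier: "carrier T0 = \<iota> ` carrier W"
proof (rule T0_generate)
  have "\<iota> \<in> left_module_hom A M T0"
    by (rule left_module_homI) (simp_all add: M_sel \<iota>_closed \<iota>_add \<iota>_smult)
  from left_module_hom_image_submodule[OF M_left_module T0_left_module this]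
  show "submodule (\<iota> ` carrier W) A T0" by (simp add: M_sel)
  fix w X assume w: "w \<in> carrier W" and "X \<in> carrier AJ"
  then obtain a where a: "a \<in> carrier A" "X = q a" by (elim AJ_cosetE)
  have "t w X = \<iota> (V_const A a \<odot>\<^bsub>W\<^esub> w)"
    unfolding a(2) using t_q[OF w a(1)] \<iota>_smult[OF a(1) w] by simp
  then show "t w X \<in> \<iota> ` carrier W" using w a(1) by (simp add: W.smult_closed)
qed

text \<open>\<open>j\<close> can act through the right factor, where its coset is zero. This lets
  the action of A descend to A/J.\<close>

lemma T0_kill: "\<lbrakk>j \<in> J; m \<in> carrier T0\<rbrakk> \<Longrightarrow> j \<odot>\<^bsub>T0\<^esub> m = \<zero>\<^bsub>T0\<^esub>"
proof -
  assume j: "j \<in> J" and "m \<in> carrier T0"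
  then obtain w where w: "w \<in> carrier W" "m = \<iota> w" unfolding T0_carrier by blast
  have "q j = q \<zero>\<^bsub>A\<^esub>" using j J.Icarr[OF j] by (subst q_eq_iff) (simp_all add: a_minus_def)
  then have "j \<odot>\<^bsub>T0\<^esub> m = \<zero>\<^bsub>A\<^esub> \<odot>\<^bsub>T0\<^esub> m"
    unfolding w(2) using t_q[OF w(1) J.Icarr[OF j]] t_q[OF w(1) R.zero_closed] by simp
  then show ?thesis using \<open>m \<in> carrier T0\<close> by (simp add: T0.smult_l_null)
qed

lemma T0_descend:
  shows "left_module B (descend_scalars T0)"
    and "\<lbrakk>a \<in> carrier A; m \<in> carrier T0\<rbrakk> \<Longrightarrow> q a \<odot>\<^bsub>descend_scalars T0\<^esub> m = a \<odot>\<^bsub>T0\<^esub> m"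
  using descend_scalars[OF T0_left_module, OF T0_kill] by simp_all

section \<open>The operator P on the tensor product\<close>

lemma P_const:
  assumes "a \<in> carrier A" "w \<in> carrier W"
  shows "V_P A \<odot>\<^bsub>W\<^esub> (V_const A a \<odot>\<^bsub>W\<^esub> w) = V_const A (a [^]\<^bsub>A\<^esub> p) \<odot>\<^bsub>W\<^esub> (V_P A \<odot>\<^bsub>W\<^esub> w)"
proof -
  have "V_P A \<otimes>\<^bsub>V\<^esub> V_const A a = V_const A (a [^]\<^bsub>A\<^esub> p) \<otimes>\<^bsub>V\<^esub> V_P A"
    using assms(1) by (simp add: V_monom_mult' tw_1 tw_0)
  then show ?thesis
    using assms by (simp only: W.smult_assoc[symmetric] V_monom_closed R.one_closed R.nat_pow_closed)
qed

text \<open>On \<open>\<Omega> \<otimes> A/J\<close> the operator \<open>P\<close> is linear over the Frobenius endomorphism of \<open>A\<close>.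
  Well-definedness on cosets comes from \<open>a^p\<close> being the scalar \<open>\<epsilon>(a)^p\<close>.\<close>

lemma tensor_P_exists:
  "\<exists>F\<in>left_module_hom A T0 (restrict_scalars (\<lambda>a. a [^]\<^bsub>A\<^esub> p) T0).
    \<forall>w\<in>carrier W. \<forall>a\<in>carrier A. F (t w (q a)) = (a [^]\<^bsub>A\<^esub> p) \<odot>\<^bsub>T0\<^esub> \<iota> (V_P A \<odot>\<^bsub>W\<^esub> w)"
proof -
  \<comment> \<open>\<open>T0_lift\<close> asks for a function of the coset, so a^p is written as
    \<epsilon>(a + J)^p. Restricting the target along a \<mapsto> a^p turns the semilinear operator
    into a linear map, which is what the lifting produces.\<close>
  let ?s = "\<lambda>X. scal (aug B X [^]\<^bsub>k\<^esub> p)"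
  have s: "?s (q a) = a [^]\<^bsub>A\<^esub> p" if "a \<in> carrier A" for a
    using that by (simp add: B_aug pow_p_eq_scal)
  have P: "V_P A \<odot>\<^bsub>W\<^esub> w \<in> carrier W" if "w \<in> carrier W" for w
    using that by (simp add: W.smult_closed)
  note fr = frobenius_hom[THEN ring_hom_add] frobenius_hom[THEN ring_hom_mult]
  note closed = T0.smult_closed \<iota>_closed P R.nat_pow_closed
  have "\<exists>F\<in>left_module_hom A T0 (restrict_scalars (\<lambda>a. a [^]\<^bsub>A\<^esub> p) T0).
    \<forall>w\<in>carrier W. \<forall>X\<in>carrier AJ. F (t w X) = ?s X \<odot>\<^bsub>T0\<^esub> \<iota> (V_P A \<odot>\<^bsub>W\<^esub> w)"
  proof (rule T0_lift)
    show "left_module A (restrict_scalars (\<lambda>a. a [^]\<^bsub>A\<^esub> p) T0)"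
      by (rule restrict_scalars_left_module[OF T0_left_module R.ring_axioms frobenius_hom])
    fix w X assume w: "w \<in> carrier W" and "X \<in> carrier AJ"
    then obtain a where a: "a \<in> carrier A" "X = q a" by (elim AJ_cosetE)
    show "?s X \<odot>\<^bsub>T0\<^esub> \<iota> (V_P A \<odot>\<^bsub>W\<^esub> w) \<in> carrier (restrict_scalars (\<lambda>a. a [^]\<^bsub>A\<^esub> p) T0)"
      unfolding a(2) s[OF a(1)] restrict_scalars_sel using w a(1) by (intro closed)
    show "?s X \<odot>\<^bsub>T0\<^esub> \<iota> (V_P A \<odot>\<^bsub>W\<^esub> (w \<oplus>\<^bsub>W\<^esub> w')) =
        ?s X \<odot>\<^bsub>T0\<^esub> \<iota> (V_P A \<odot>\<^bsub>W\<^esub> w) \<oplus>\<^bsub>restrict_scalars (\<lambda>a. a [^]\<^bsub>A\<^esub> p) T0\<^esub> ?s X \<odot>\<^bsub>T0\<^esub> \<iota> (V_P A \<odot>\<^bsub>W\<^esub> w')"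
      if "w' \<in> carrier W" for w'
      unfolding a(2) s[OF a(1)] restrict_scalars_sel
      using w that a(1)
      by (simp only: W.smult_r_distr T0.smult_r_distr \<iota>_add closed V_monom_closed R.one_closed)
    show "?s (X \<oplus>\<^bsub>AJ\<^esub> Y) \<odot>\<^bsub>T0\<^esub> \<iota> (V_P A \<odot>\<^bsub>W\<^esub> w) =
        ?s X \<odot>\<^bsub>T0\<^esub> \<iota> (V_P A \<odot>\<^bsub>W\<^esub> w) \<oplus>\<^bsub>restrict_scalars (\<lambda>a. a [^]\<^bsub>A\<^esub> p) T0\<^esub> ?s Y \<odot>\<^bsub>T0\<^esub> \<iota> (V_P A \<odot>\<^bsub>W\<^esub> w)"
      if "Y \<in> carrier AJ" for Y
    proof -
      obtain b where b: "b \<in> carrier A" "Y = q b" using \<open>Y \<in> carrier AJ\<close> by (rule AJ_cosetE)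
      show ?thesis
        unfolding a(2) b(2) restrict_scalars_sel
        using w a(1) b(1)
        by (simp only: AJ_add s R.a_closed fr T0.smult_l_distr closed)
    qed
    fix b assume b: "b \<in> carrier A"
    show "?s X \<odot>\<^bsub>T0\<^esub> \<iota> (V_P A \<odot>\<^bsub>W\<^esub> (V_const A b \<odot>\<^bsub>W\<^esub> w)) =
        b \<odot>\<^bsub>restrict_scalars (\<lambda>a. a [^]\<^bsub>A\<^esub> p) T0\<^esub> (?s X \<odot>\<^bsub>T0\<^esub> \<iota> (V_P A \<odot>\<^bsub>W\<^esub> w))"
      unfolding a(2) s[OF a(1)] restrict_scalars_sel
      using w a(1) b
      by (simp only: P_const \<iota>_smult closed T0.smult_assoc[symmetric] R.m_comm)
    show "?s (b \<odot>\<^bsub>AJ\<^esub> X) \<odot>\<^bsub>T0\<^esub> \<iota> (V_P A \<odot>\<^bsub>W\<^esub> w) =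
        b \<odot>\<^bsub>restrict_scalars (\<lambda>a. a [^]\<^bsub>A\<^esub> p) T0\<^esub> (?s X \<odot>\<^bsub>T0\<^esub> \<iota> (V_P A \<odot>\<^bsub>W\<^esub> w))"
      unfolding a(2) restrict_scalars_sel
      using w a(1) b
      by (simp only: AJ_smult s fr R.m_closed closed T0.smult_assoc)
  qed
  then obtain F where F: "F \<in> left_module_hom A T0 (restrict_scalars (\<lambda>a. a [^]\<^bsub>A\<^esub> p) T0)"
    "\<And>w X. \<lbrakk>w \<in> carrier W; X \<in> carrier AJ\<rbrakk> \<Longrightarrow> F (t w X) = ?s X \<odot>\<^bsub>T0\<^esub> \<iota> (V_P A \<odot>\<^bsub>W\<^esub> w)"
    by blast
  show ?thesis
    by (rule bexI[OF _ F(1)], intro ballI) (simp only: F(2) AJ_closed s)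
qed

abbreviation PT where "PT \<equiv> Omega_tensor_P k p A J"

text \<open>\<open>Omega_tensor_P\<close> is a definite description. Existence is
  \<open>tensor_P_exists\<close>; uniqueness holds because \<iota> is onto and the condition at a =
  1 fixes the value on each \<iota> w.\<close>

lemma tensor_P_spec:
  shows "PT \<in> hom (add_monoid T0) (add_monoid T0)"
    and "\<And>w a. \<lbrakk>w \<in> carrier W; a \<in> carrier A\<rbrakk> \<Longrightarrow> PT (t w (q a)) =
      t (V_const A (a [^]\<^bsub>A\<^esub> p) \<odot>\<^bsub>W\<^esub> (V_P A \<odot>\<^bsub>W\<^esub> w)) (q \<one>\<^bsub>A\<^esub>)"
    and "\<And>a m. \<lbrakk>a \<in> carrier A; m \<in> carrier T0\<rbrakk> \<Longrightarrow> PT (a \<odot>\<^bsub>T0\<^esub> m) = (a [^]\<^bsub>A\<^esub> p) \<odot>\<^bsub>T0\<^esub> PT m"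
proof -
  obtain F where F: "F \<in> left_module_hom A T0 (restrict_scalars (\<lambda>a. a [^]\<^bsub>A\<^esub> p) T0)"
    "\<forall>w\<in>carrier W. \<forall>a\<in>carrier A. F (t w (q a)) = (a [^]\<^bsub>A\<^esub> p) \<odot>\<^bsub>T0\<^esub> \<iota> (V_P A \<odot>\<^bsub>W\<^esub> w)"
    using tensor_P_exists by blast
  note FD = left_module_homD[OF F(1), unfolded restrict_scalars_sel]
  define S where "S F \<longleftrightarrow> F \<in> extensional (carrier T0) \<and> F \<in> hom (add_monoid T0) (add_monoid T0) \<and>
       (\<forall>w\<in>carrier W. \<forall>a\<in>carrier A. F (t w (q a)) =
          t (V_const A (a [^]\<^bsub>A\<^esub> p) \<odot>\<^bsub>W\<^esub> (V_P A \<odot>\<^bsub>W\<^esub> w)) (q \<one>\<^bsub>A\<^esub>))" for F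
  have P: "V_P A \<odot>\<^bsub>W\<^esub> w \<in> carrier W" if "w \<in> carrier W" for w
    using that by (simp add: W.smult_closed)
  \<comment> \<open>Values off the carrier would be arbitrary; the restriction makes the operator
    \<open>extensional\<close> and so unique as a function.\<close>
  let ?G = "restrict F (carrier T0)"
  have Ft: "F (t w (q a)) = \<iota> (V_const A (a [^]\<^bsub>A\<^esub> p) \<odot>\<^bsub>W\<^esub> (V_P A \<odot>\<^bsub>W\<^esub> w))"
    if "w \<in> carrier W" "a \<in> carrier A" for w a
    using that F(2) by (simp only: \<iota>_smult P R.nat_pow_closed)
  have G: "S ?G"
    unfolding S_def
  proof (intro conjI ballI)
    show "?G \<in> hom (add_monoid T0) (add_monoid T0)"
      using FD(1,2) by (intro homI) simp_all
  qed (simp_all only: Ft t_closed AJ_closed restrict_apply if_True restrict_extensional)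
  have eq: "F' = ?G" if "S F'" for F'
  proof (rule extensionalityI[of _ "carrier T0"])
    show "F' \<in> extensional (carrier T0)" "?G \<in> extensional (carrier T0)"
      using that by (simp_all add: S_def)
    fix m assume "m \<in> carrier T0"
    then obtain w where w: "w \<in> carrier W" "m = \<iota> w" unfolding T0_carrier by blast
    then show "F' m = ?G m" using that G R.one_closed unfolding S_def w(2) by (metis (no_types, lifting))
  qed
  have "PT = (THE F. S F)" by (simp add: Omega_tensor_P_def Let_def S_def)
  also have "\<dots> = ?G" using G eq by (rule the_equality)
  finally have PT: "PT = ?G" .
  show "PT \<in> hom (add_monoid T0) (add_monoid T0)"
    "\<And>w a. \<lbrakk>w \<in> carrier W; a \<in> carrier A\<rbrakk> \<Longrightarrow> PT (t w (q a)) =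
      t (V_const A (a [^]\<^bsub>A\<^esub> p) \<odot>\<^bsub>W\<^esub> (V_P A \<odot>\<^bsub>W\<^esub> w)) (q \<one>\<^bsub>A\<^esub>)"
    using G unfolding PT S_def by blast+
  show "PT (a \<odot>\<^bsub>T0\<^esub> m) = (a [^]\<^bsub>A\<^esub> p) \<odot>\<^bsub>T0\<^esub> PT m" if "a \<in> carrier A" "m \<in> carrier T0" for a m
    unfolding PT using that FD(3) by (simp add: T0.smult_closed)
qed

lemma PT_\<iota>: "w \<in> carrier W \<Longrightarrow> PT (\<iota> w) = \<iota> (V_P A \<odot>\<^bsub>W\<^esub> w)"
  using tensor_P_spec(2)[of w "\<one>\<^bsub>A\<^esub>"] W.smult_one W.smult_closed
  by (simp add: V_ring_simps(4)[symmetric] del: V_ring_simps)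

lemma T_sel: "carrier T = carrier T0" "add T = add T0" "zero T = zero T0"
  by (simp_all add: Omega_base_change_def V_module_of_def descend_scalars_def)

lemma T_V_module:
  shows "left_module VB T"
    and "\<lbrakk>X \<in> carrier B; m \<in> carrier T0\<rbrakk> \<Longrightarrow>
      V_monom B X n \<odot>\<^bsub>T\<^esub> m = X \<odot>\<^bsub>descend_scalars T0\<^esub> (PT ^^ n) m"
proof -
  have hom: "PT \<in> hom (add_monoid (descend_scalars T0)) (add_monoid (descend_scalars T0))"
    using tensor_P_spec(1) by (simp add: hom_def descend_sel)
  have semi: "PT (X \<odot>\<^bsub>descend_scalars T0\<^esub> m) = (X [^]\<^bsub>B\<^esub> p) \<odot>\<^bsub>descend_scalars T0\<^esub> PT m"
    if X: "X \<in> carrier B" and m: "m \<in> carrier (descend_scalars T0)" for X m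
  proof -
    obtain a where a: "a \<in> carrier A" "X = q a" using X by (rule B_cosetE)
    have "X [^]\<^bsub>B\<^esub> p = q (a [^]\<^bsub>A\<^esub> p)" unfolding a(2) using a(1) by (simp add: q.hom_nat_pow)
    moreover have "PT m \<in> carrier T0" using tensor_P_spec(1) m by (auto simp: hom_def descend_sel)
    ultimately show ?thesis
      using a m by (simp add: T0_descend(2) descend_sel tensor_P_spec(3))
  qed
  show "left_module VB T"
    unfolding Omega_base_change_def
    by (rule Bp.V_module_of_left_module(1)[OF T0_descend(1) hom semi])
  show "\<lbrakk>X \<in> carrier B; m \<in> carrier T0\<rbrakk> \<Longrightarrow>
      V_monom B X n \<odot>\<^bsub>T\<^esub> m = X \<odot>\<^bsub>descend_scalars T0\<^esub> (PT ^^ n) m"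
    unfolding Omega_base_change_def
    using Bp.V_module_of_left_module(2)[OF T0_descend(1) hom semi] by (simp add: descend_sel)
qed

interpretation T: left_module VB T by (rule T_V_module(1))

lemma T_const: "\<lbrakk>a \<in> carrier A; m \<in> carrier T0\<rbrakk> \<Longrightarrow> c a \<odot>\<^bsub>T\<^esub> m = a \<odot>\<^bsub>T0\<^esub> m"
  by (simp add: T_V_module(2) T0_descend(2))

lemma T_P: "m \<in> carrier T0 \<Longrightarrow> V_P B \<odot>\<^bsub>T\<^esub> m = PT m"
proof -
  assume m: "m \<in> carrier T0"
  then have "PT m \<in> carrier T0" using tensor_P_spec(1) by (auto simp: hom_def)
  then show ?thesis
    using T_V_module(2)[of "q \<one>\<^bsub>A\<^esub>" m 1] T0_descend(2)[of "\<one>\<^bsub>A\<^esub>" "PT m"] m T0.smult_one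
    by (simp add: q.hom_one)
qed

lemma \<iota>_hom: "\<iota> \<in> left_module_hom V W (restrict_scalars qV T)"
proof (rule left_module_V_homI[OF Omega_left_module])
  show "left_module V (restrict_scalars qV T)"
    by (rule restrict_scalars_left_module[OF T_V_module(1) V_ring_ring qV_hom])
  show "\<iota> \<in> hom (add_monoid W) (add_monoid (restrict_scalars qV T))"
    by (rule homI) (simp_all add: restrict_scalars_sel T_sel \<iota>_closed \<iota>_add)
qed (simp_all only: restrict_scalars_sel qV_const qV_P \<iota>_smult T_const \<iota>_closed T_P PT_\<iota>)

section \<open>The exact sequence\<close>

text \<open>The target is viewed over V(A) through \<open>qV\<close>. There a \<mapsto> d(a + J)
  satisfies the defining relations, because \<open>q\<close> respects scalars, products and the
  p-map.\<close>

lemma Omega_map_exists: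
  "\<exists>h\<in>left_module_hom V W (restrict_scalars qV Bp.W). \<forall>a\<in>carrier A. h (d a) = Bp.d (q a)"
proof (rule Omega_lift)
  show "left_module V (restrict_scalars qV Bp.W)"
    by (rule restrict_scalars_left_module[OF Bp.Omega_left_module V_ring_ring qV_hom])
  note [simp] = restrict_scalars_sel restrict_scalars_minus
  show "Bp.d (q (scal l)) = \<zero>\<^bsub>restrict_scalars qV Bp.W\<^esub>" if "l \<in> carrier k" for l
  proof -
    have "q (scal l) = Bp.scal l"
      using B_smult[OF that R.one_closed] by (simp add: scal_def Bp.scal_def q.hom_one)
    then show ?thesis using that by (simp add: Bp.d_scal)
  qed
  show "Bp.d (q (pmap A x)) = V_P A \<odot>\<^bsub>restrict_scalars qV Bp.W\<^esub> Bp.d (q x) \<ominus>\<^bsub>restrict_scalars qV Bp.W\<^esub>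
      V_const A (x [^]\<^bsub>A\<^esub> (p - 1)) \<odot>\<^bsub>restrict_scalars qV Bp.W\<^esub> Bp.d (q x)"
    if x: "x \<in> aug_ideal k A" for x
  proof -
    have "q x \<in> aug_ideal k B" using x by (simp add: B_aug_ideal_iff aug_ideal_carrier)
    then have "Bp.d (q (pmap A x)) = V_P B \<odot>\<^bsub>Bp.W\<^esub> Bp.d (q x) \<ominus>\<^bsub>Bp.W\<^esub>
        V_const B (q x [^]\<^bsub>B\<^esub> (p - 1)) \<odot>\<^bsub>Bp.W\<^esub> Bp.d (q x)"
      using Bp.d_pmap[of "q x"] by (simp add: B_pmap[OF x])
    then show ?thesis
      using aug_ideal_carrier[OF x]
      by (simp only: restrict_scalars_sel restrict_scalars_minus qV_const qV_P
          R.nat_pow_closed q.hom_nat_pow)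
  qed
qed (simp_all add: restrict_scalars_sel Bp.d_closed Bp.d_add Bp.d_mult qV_const)

text \<open>Only existence has been shown, hence the choice. On the carrier there is just one such
  map, since the elements d a generate.\<close>

definition Omega_map where
  "Omega_map = (SOME h. h \<in> left_module_hom V W (restrict_scalars qV Bp.W) \<and>
    (\<forall>a\<in>carrier A. h (d a) = Bp.d (q a)))"

lemma Omega_map:
  shows "Omega_map \<in> left_module_hom V W (restrict_scalars qV Bp.W)"
    and "a \<in> carrier A \<Longrightarrow> Omega_map (d a) = Bp.d (q a)"
  using someI_ex[of "\<lambda>h. h \<in> left_module_hom V W (restrict_scalars qV Bp.W) \<and>
    (\<forall>a\<in>carrier A. h (d a) = Bp.d (q a))"] Omega_map_exists
  unfolding Omega_map_def[symmetric] by blast+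

lemmas Omega_mapD = left_module_homD[OF Omega_map(1), unfolded restrict_scalars_sel]

text \<open>Two formulas are kept: the one on w \<otimes> 1 serves exactness, the one on all pure
  tensors contains the prescribed values of \<psi>.\<close>

lemma psi_exists:
  "\<exists>\<psi>\<in>left_module_hom VB T Bp.W. (\<forall>w\<in>carrier W. \<psi> (\<iota> w) = Omega_map w) \<and>
    (\<forall>w\<in>carrier W. \<forall>X\<in>carrier B. \<psi> (t w X) = V_const B X \<odot>\<^bsub>Bp.W\<^esub> Omega_map w)"
proof -
  \<comment> \<open>A/J occurs as a quotient A-module and as a quotient algebra. The cosets are the
    same, so an element of the former can serve as a constant of V(A/J).\<close>
  have AJB: "carrier AJ = carrier B"
    by (auto simp: B_carrier AJ_closed elim!: AJ_cosetE)
  have cW: "c a \<odot>\<^bsub>Bp.W\<^esub> m \<in> carrier Bp.W" if "a \<in> carrier A" "m \<in> carrier Bp.W" for a m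
    using that by (intro W'.smult_closed Bp.V_monom_closed q.hom_closed)
  note ch = ring_hom_closed[OF c_hom] ring_hom_add[OF c_hom] ring_hom_mult[OF c_hom]
  have "\<exists>\<psi>\<in>left_module_hom A T0 (restrict_scalars c Bp.W).
    (\<forall>w\<in>carrier W. \<forall>X\<in>carrier AJ. \<psi> (t w X) = V_const B X \<odot>\<^bsub>Bp.W\<^esub> Omega_map w)"
  proof (rule T0_lift)
    show "left_module A (restrict_scalars c Bp.W)"
      by (rule restrict_scalars_left_module[OF Bp.Omega_left_module R.ring_axioms c_hom])
    fix w X assume w: "w \<in> carrier W" and "X \<in> carrier AJ"
    then obtain a where a: "a \<in> carrier A" "X = q a" by (elim AJ_cosetE)
    show "V_const B X \<odot>\<^bsub>Bp.W\<^esub> Omega_map w \<in> carrier (restrict_scalars c Bp.W)"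
      unfolding a(2) restrict_scalars_sel using w a(1) by (intro cW Omega_mapD)
    show "V_const B X \<odot>\<^bsub>Bp.W\<^esub> Omega_map (w \<oplus>\<^bsub>W\<^esub> w') =
        V_const B X \<odot>\<^bsub>Bp.W\<^esub> Omega_map w \<oplus>\<^bsub>restrict_scalars c Bp.W\<^esub> V_const B X \<odot>\<^bsub>Bp.W\<^esub> Omega_map w'"
      if "w' \<in> carrier W" for w'
      unfolding a(2) restrict_scalars_sel
      using w that a(1) by (simp only: Omega_mapD W'.smult_r_distr ch)
    show "V_const B (X \<oplus>\<^bsub>AJ\<^esub> Y) \<odot>\<^bsub>Bp.W\<^esub> Omega_map w =
        V_const B X \<odot>\<^bsub>Bp.W\<^esub> Omega_map w \<oplus>\<^bsub>restrict_scalars c Bp.W\<^esub> V_const B Y \<odot>\<^bsub>Bp.W\<^esub> Omega_map w"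
      if "Y \<in> carrier AJ" for Y
    proof -
      obtain b where b: "b \<in> carrier A" "Y = q b" using \<open>Y \<in> carrier AJ\<close> by (rule AJ_cosetE)
      show ?thesis
        unfolding a(2) b(2) restrict_scalars_sel
        using w a(1) b(1) by (simp only: AJ_add ch W'.smult_l_distr Omega_mapD)
    qed
    fix b assume b: "b \<in> carrier A"
    \<comment> \<open>V(A/J) need not be commutative, but its constants commute with one another,
      and linearity in the left factor needs just that.\<close>
    have comm: "c a \<otimes>\<^bsub>VB\<^esub> c b = c b \<otimes>\<^bsub>VB\<^esub> c a"
      using a(1) b by (simp only: ch(3)[symmetric] R.m_comm)
    show "V_const B X \<odot>\<^bsub>Bp.W\<^esub> Omega_map (V_const A b \<odot>\<^bsub>W\<^esub> w) =
        b \<odot>\<^bsub>restrict_scalars c Bp.W\<^esub> (V_const B X \<odot>\<^bsub>Bp.W\<^esub> Omega_map w)"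
      unfolding a(2) restrict_scalars_sel
      using w a(1) b comm
      by (simp only: Omega_mapD V_monom_closed qV_const W'.smult_assoc[symmetric] ch(1))
    show "V_const B (b \<odot>\<^bsub>AJ\<^esub> X) \<odot>\<^bsub>Bp.W\<^esub> Omega_map w =
        b \<odot>\<^bsub>restrict_scalars c Bp.W\<^esub> (V_const B X \<odot>\<^bsub>Bp.W\<^esub> Omega_map w)"
      unfolding a(2) restrict_scalars_sel
      using w a(1) b by (simp only: AJ_smult ch Omega_mapD W'.smult_assoc)
  qed
  then obtain \<psi> where \<psi>: "\<psi> \<in> left_module_hom A T0 (restrict_scalars c Bp.W)"
    "\<forall>w\<in>carrier W. \<forall>X\<in>carrier B. \<psi> (t w X) = V_const B X \<odot>\<^bsub>Bp.W\<^esub> Omega_map w"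
    unfolding AJB by blast
  note \<psi>D = left_module_homD[OF \<psi>(1), unfolded restrict_scalars_sel]
  have \<psi>\<iota>: "\<psi> (\<iota> w) = Omega_map w" if "w \<in> carrier W" for w
  proof -
    have "\<psi> (\<iota> w) = c \<one>\<^bsub>A\<^esub> \<odot>\<^bsub>Bp.W\<^esub> Omega_map w" using \<psi>(2) that by simp
    also have "\<dots> = Omega_map w"
      using that ring_hom_one[OF c_hom] by (simp only: W'.smult_one Omega_mapD)
    finally show ?thesis .
  qed
  have "\<psi> \<in> left_module_hom VB T Bp.W"
  proof (rule Bp.left_module_V_homI[OF T_V_module(1) Bp.Omega_left_module])
    show "\<psi> \<in> hom (add_monoid T) (add_monoid Bp.W)"
      using \<psi>D(1,2) by (intro homI) (simp_all add: T_sel)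
    fix m assume m: "m \<in> carrier T"
    show "\<psi> (V_const B X \<odot>\<^bsub>T\<^esub> m) = V_const B X \<odot>\<^bsub>Bp.W\<^esub> \<psi> m" if X: "X \<in> carrier B" for X
    proof -
      obtain a where a: "a \<in> carrier A" "X = q a" using X by (rule B_cosetE)
      show ?thesis
        unfolding a(2) using a(1) m by (simp only: T_sel T_const \<psi>D)
    qed
    \<comment> \<open>Every element is some \<iota> w, on which P acts as P on w, so commuting with
      P reduces to the linearity of \<open>Omega_map\<close> along \<open>qV\<close>.\<close>
    obtain w where w: "w \<in> carrier W" "m = \<iota> w" using m unfolding T_sel T0_carrier by blast
    have "Omega_map (V_P A \<odot>\<^bsub>W\<^esub> w) = V_P B \<odot>\<^bsub>Bp.W\<^esub> Omega_map w"
      using w(1) by (simp only: Omega_mapD V_monom_closed R.one_closed qV_P)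
    then show "\<psi> (V_P B \<odot>\<^bsub>T\<^esub> m) = V_P B \<odot>\<^bsub>Bp.W\<^esub> \<psi> m"
      unfolding w(2) using w(1)
      by (simp only: T_P \<iota>_closed PT_\<iota> \<psi>\<iota> W.smult_closed V_monom_closed R.one_closed)
  qed
  then show ?thesis using \<psi>(2) \<psi>\<iota> by blast
qed

text \<open>After tensoring, J acts as 0. This removes x da from d(a x), both terms of d(i j) for i,
  j in J, and x^(p-1) dx from d(\<pi>(x)). What is left is linearity over A, vanishing on J^2 and
  compatibility with P.\<close>

lemma phi_exists: "\<exists>\<phi>\<in>left_module_hom VB C T. \<forall>x\<in>J. \<phi> (r x) = \<iota> (d x)"
proof (rule C_lift[OF T_V_module(1)])
  have d: "\<iota> (d a) \<in> carrier T0" if "a \<in> carrier A" for a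
    using that by (intro \<iota>_closed d_closed)
  have cd: "V_const A a \<odot>\<^bsub>W\<^esub> d b \<in> carrier W" if "a \<in> carrier A" "b \<in> carrier A" for a b
    using that by (intro W.smult_closed V_monom_closed d_closed)
  have dmult: "\<iota> (d (a \<otimes>\<^bsub>A\<^esub> x)) = a \<odot>\<^bsub>T0\<^esub> \<iota> (d x)" if "a \<in> carrier A" "x \<in> J" for a x
    using that J.Icarr[OF that(2)]
    by (simp add: d_mult \<iota>_add \<iota>_smult cd d_closed T0_kill d T0.smult_closed)
  fix x assume x: "x \<in> J"
  note xc = J.Icarr[OF x]
  show "\<iota> (d x) \<in> carrier T" unfolding T_sel by (rule d[OF xc])
  show "\<iota> (d (x \<oplus>\<^bsub>A\<^esub> y)) = \<iota> (d x) \<oplus>\<^bsub>T\<^esub> \<iota> (d y)" if "y \<in> J" for y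
    using xc J.Icarr[OF that] by (simp add: T_sel d_add \<iota>_add d_closed)
  show "\<iota> (d (a \<otimes>\<^bsub>A\<^esub> x)) = c a \<odot>\<^bsub>T\<^esub> \<iota> (d x)" if "a \<in> carrier A" for a
    using that x xc by (simp only: dmult T_const d)
  \<comment> \<open>The exponent is positive even for p = 2, so the power contains a factor
    \<open>x\<close> from \<open>J\<close>.\<close>
  have "x [^]\<^bsub>A\<^esub> (p - 1) \<in> J"
  proof -
    obtain n where "p - 1 = Suc n" using prime_ge_2_nat[OF prime] by (cases "p - 1") auto
    then show ?thesis using x xc by (simp add: J.I_l_closed)
  qed
  then have z: "\<iota> (V_const A (x [^]\<^bsub>A\<^esub> (p - 1)) \<odot>\<^bsub>W\<^esub> d x) = \<zero>\<^bsub>T0\<^esub>"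
    using xc by (simp add: \<iota>_smult d_closed T0_kill d)
  have P: "V_P A \<odot>\<^bsub>W\<^esub> d x \<in> carrier W"
    using xc by (intro W.smult_closed V_monom_closed d_closed) simp_all
  have \<iota>a: "\<iota> \<in> hom (add_monoid W) (add_monoid T0)"
    by (rule homI) (simp_all add: \<iota>_closed \<iota>_add)
  have "\<iota> (d (pmap A x)) = \<iota> (V_P A \<odot>\<^bsub>W\<^esub> d x) \<ominus>\<^bsub>T0\<^esub> \<zero>\<^bsub>T0\<^esub>"
    unfolding d_pmap[OF J_aug[OF x]] z[symmetric]
    using xc P cd by (intro additive_hom_minus[OF \<iota>a W.M.abelian_group_axioms T0.M.abelian_group_axioms]) simp_all
  also have "\<dots> = \<iota> (V_P A \<odot>\<^bsub>W\<^esub> d x)"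
    using \<iota>_closed[OF P] by (simp add: a_minus_def)
  also have "\<dots> = V_P B \<odot>\<^bsub>T\<^esub> \<iota> (d x)"
    using xc by (simp only: T_P d PT_\<iota> d_closed)
  finally show "\<iota> (d (pmap A x)) = V_P B \<odot>\<^bsub>T\<^esub> \<iota> (d x)" .
next
  fix z assume "z \<in> JJ"
  then show "\<iota> (d z) = \<zero>\<^bsub>T\<^esub>"
  proof (induction z rule: ideal_prod.induct)
    case (prod i j)
    note ij = prod J.Icarr[OF prod(1)] J.Icarr[OF prod(2)]
    have "V_const A i \<odot>\<^bsub>W\<^esub> d j \<in> carrier W" "V_const A j \<odot>\<^bsub>W\<^esub> d i \<in> carrier W"
      using ij by (intro W.smult_closed V_monom_closed d_closed; simp)+
    then show ?case
      using ij by (simp add: d_mult \<iota>_add \<iota>_smult d_closed T0_kill \<iota>_closed T_sel)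
  next
    case (sum s u)
    have "s \<in> carrier A" "u \<in> carrier A" using sum JJ_subset J.Icarr by auto
    then show ?case using sum by (simp add: d_add \<iota>_add d_closed T_sel)
  qed
qed

text \<open>The image is a submodule, and it contains each generator d(a + J) as the value at d a
  \<otimes> 1.\<close>

lemma psi_surjective:
  assumes \<psi>: "\<psi> \<in> left_module_hom VB T Bp.W"
    and \<psi>\<iota>: "\<And>w. w \<in> carrier W \<Longrightarrow> \<psi> (\<iota> w) = Omega_map w"
  shows "\<psi> ` carrier T = carrier Bp.W"
proof (rule Bp.Omega_generate[symmetric])
  show "submodule (\<psi> ` carrier T) VB Bp.W"
    by (rule left_module_hom_image_submodule[OF T_V_module(1) Bp.Omega_left_module \<psi>])
  fix X assume "X \<in> carrier B"
  then obtain a where a: "a \<in> carrier A" "X = q a" by (elim B_cosetE)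
  have "Bp.d X = \<psi> (\<iota> (d a))" unfolding a(2) using a(1) by (simp add: \<psi>\<iota> d_closed Omega_map(2))
  then show "Bp.d X \<in> \<psi> ` carrier T"
    unfolding T_sel using \<iota>_closed[OF d_closed[OF a(1)]] by blast
qed

text \<open>Modulo the image of \<open>\<phi>\<close>, the class of \<open>d a \<otimes> 1\<close> only depends on the coset \<open>a + J\<close>; this
  gives a map from \<open>\<Omega>(A/J)\<close> to the cokernel of \<open>\<phi>\<close> through which the projection factors.\<close>

lemma kernel_psi:
  assumes \<phi>: "\<phi> \<in> left_module_hom VB C T" and \<phi>d: "\<And>x. x \<in> J \<Longrightarrow> \<phi> (r x) = \<iota> (d x)"
    and \<psi>: "\<psi> \<in> left_module_hom VB T Bp.W"
    and \<psi>\<iota>: "\<And>w. w \<in> carrier W \<Longrightarrow> \<psi> (\<iota> w) = Omega_map w"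
  shows "\<phi> ` carrier C = a_kernel T Bp.W \<psi>"
proof -
  let ?N = "\<phi> ` carrier C"
  let ?Q = "quot_module T ?N"
  let ?pr = "\<lambda>m. ?N +>\<^bsub>T\<^esub> m"
  have N: "submodule ?N VB T"
    by (rule left_module_hom_image_submodule[OF C_left_module T_V_module(1) \<phi>])
  have Q: "left_module VB ?Q"
    by (rule quot_module_left_module[OF T_V_module(1) N])
  interpret Q: left_module VB ?Q by (rule Q)
  have pr: "?pr \<in> left_module_hom VB T ?Q"
    by (rule quot_module_proj_hom[OF T_V_module(1) N])
  \<comment> \<open>The class of w \<otimes> 1 in the cokernel of \<phi>. It will be compared with
    \<theta> after \<open>Omega_map\<close>.\<close>
  define f where "f w = ?pr (\<iota> w)" for w
  have "f \<in> left_module_hom V W (restrict_scalars qV ?Q)"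
    unfolding f_def
    by (rule left_module_hom_comp[OF \<iota>_hom left_module_hom_restrict_scalars[OF pr qV_hom]])
  note f = this left_module_homD[OF this, unfolded restrict_scalars_sel]
  have RQ: "left_module V (restrict_scalars qV ?Q)"
    by (rule restrict_scalars_left_module[OF Q V_ring_ring qV_hom])
  \<comment> \<open>For x in J the element d x \<otimes> 1 is \<phi>(x + J^2), hence zero in the
    cokernel.\<close>
  have fJ: "f (d x) = \<zero>\<^bsub>?Q\<^esub>" if "x \<in> J" for x
    using that \<phi>d[OF that] \<iota>_closed[OF d_closed[OF J.Icarr[OF that]]] r_closed[OF that]
    unfolding f_def
    by (subst quot_module_proj_eq_zero_iff[OF T_V_module(1) N]) (auto simp: T_sel C_sel image_iff)
  define u where "u X = the_elem ((\<lambda>a. f (d a)) ` X)" for X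
  have u: "u (q a) = f (d a)" if a: "a \<in> carrier A" for a
  proof -
    have "f (d b) = f (d a)" if "b \<in> q a" for b
    proof -
      note b = q_eqD[OF that a]
      have j: "b \<ominus>\<^bsub>A\<^esub> a \<in> carrier A" using b(2) by (rule J.Icarr)
      have "f (d b) = f (d (b \<ominus>\<^bsub>A\<^esub> a) \<oplus>\<^bsub>W\<^esub> d a)"
        using b(3) d_add[OF j a] by simp
      also have "\<dots> = f (d (b \<ominus>\<^bsub>A\<^esub> a)) \<oplus>\<^bsub>?Q\<^esub> f (d a)"
        using j a by (intro f d_closed)
      finally show ?thesis using fJ[OF b(2)] f(2)[OF d_closed[OF a]] by simp
    qed
    then have "(\<lambda>a. f (d a)) ` q a = {f (d a)}"
      by (rule abelian_subgroup.a_coset_image_eq[OF J_subgroup a])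
    then show ?thesis by (simp add: u_def)
  qed
  \<comment> \<open>Each relation over A/J is checked on representatives, where it is the image
    under \<open>f\<close> of the same relation over A.\<close>
  have "\<exists>\<theta>\<in>left_module_hom VB Bp.W ?Q. \<forall>X\<in>carrier B. \<theta> (Bp.d X) = u X"
  proof (rule Bp.Omega_lift[OF Q])
    fix l assume "l \<in> carrier k"
    then show "u (Bp.scal l) = \<zero>\<^bsub>?Q\<^esub>"
      using B_smult[of l "\<one>\<^bsub>A\<^esub>"] u[of "scal l"] left_module_hom_zero[OF f(1) Omega_left_module RQ]
      by (simp add: Bp.scal_def d_scal restrict_scalars_sel q.hom_one flip: scal_def)
  next
    fix X assume "X \<in> aug_ideal k B"
    then obtain x where x: "x \<in> carrier A" "x \<in> aug_ideal k A" "X = q x" by (rule B_aug_idealE)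
    have cl: "V_P A \<odot>\<^bsub>W\<^esub> d x \<in> carrier W" "V_const A (x [^]\<^bsub>A\<^esub> (p - 1)) \<odot>\<^bsub>W\<^esub> d x \<in> carrier W"
      using x(1) by (intro W.smult_closed V_monom_closed d_closed; simp)+
    have "u (pmap B X) = f (V_P A \<odot>\<^bsub>W\<^esub> d x \<ominus>\<^bsub>W\<^esub> V_const A (x [^]\<^bsub>A\<^esub> (p - 1)) \<odot>\<^bsub>W\<^esub> d x)"
      unfolding x(3) B_pmap[OF x(2)] u[OF pmap_carrier[OF x(2)]] d_pmap[OF x(2)] ..
    also have "\<dots> = f (V_P A \<odot>\<^bsub>W\<^esub> d x) \<ominus>\<^bsub>?Q\<^esub> f (V_const A (x [^]\<^bsub>A\<^esub> (p - 1)) \<odot>\<^bsub>W\<^esub> d x)"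
      using left_module_hom_minus[OF f(1) Omega_left_module RQ cl] by (simp add: restrict_scalars_minus)
    also have "\<dots> = V_P B \<odot>\<^bsub>?Q\<^esub> f (d x) \<ominus>\<^bsub>?Q\<^esub> V_const B (X [^]\<^bsub>B\<^esub> (p - 1)) \<odot>\<^bsub>?Q\<^esub> f (d x)"
      unfolding x(3) using x(1)
      by (simp only: f(4) V_monom_closed R.one_closed R.nat_pow_closed d_closed qV_const qV_P
          q.hom_nat_pow)
    finally show "u (pmap B X) =
        V_P B \<odot>\<^bsub>?Q\<^esub> u X \<ominus>\<^bsub>?Q\<^esub> V_const B (X [^]\<^bsub>B\<^esub> (p - 1)) \<odot>\<^bsub>?Q\<^esub> u X"
      unfolding x(3) u[OF x(1)] .
  next
    fix X assume "X \<in> carrier B"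
    then obtain a where a: "a \<in> carrier A" "X = q a" by (elim B_cosetE)
    show "u X \<in> carrier ?Q" unfolding a(2) u[OF a(1)] using a(1) by (intro f d_closed)
    fix Y assume "Y \<in> carrier B"
    then obtain b where b: "b \<in> carrier A" "Y = q b" by (elim B_cosetE)
    have cl: "V_const A a \<odot>\<^bsub>W\<^esub> d b \<in> carrier W" "V_const A b \<odot>\<^bsub>W\<^esub> d a \<in> carrier W"
      using a(1) b(1) by (intro W.smult_closed V_monom_closed d_closed; simp)+
    show "u (X \<oplus>\<^bsub>B\<^esub> Y) = u X \<oplus>\<^bsub>?Q\<^esub> u Y"
      unfolding a(2) b(2) using a(1) b(1)
      by (simp only: q.hom_add[symmetric] u R.a_closed d_add f(3) d_closed)
    show "u (X \<otimes>\<^bsub>B\<^esub> Y) = V_const B X \<odot>\<^bsub>?Q\<^esub> u Y \<oplus>\<^bsub>?Q\<^esub> V_const B Y \<odot>\<^bsub>?Q\<^esub> u X"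
      unfolding a(2) b(2) using a(1) b(1) cl
      by (simp only: q.hom_mult[symmetric] u R.m_closed d_mult f(3,4) d_closed V_monom_closed qV_const)
  qed
  then obtain \<theta> where \<theta>: "\<theta> \<in> left_module_hom VB Bp.W ?Q" "\<forall>X\<in>carrier B. \<theta> (Bp.d X) = u X"
    by blast
  \<comment> \<open>Both sides are linear over V(A) through \<open>qV\<close> and agree on the
    generators d a.\<close>
  have \<theta>f: "\<theta> (Omega_map w) = f w" if "w \<in> carrier W" for w
  proof (rule Omega_hom_eqI[OF RQ _ f(1) _ that])
    show "(\<lambda>w. \<theta> (Omega_map w)) \<in> left_module_hom V W (restrict_scalars qV ?Q)"
      by (rule left_module_hom_comp[OF Omega_map(1) left_module_hom_restrict_scalars[OF \<theta>(1) qV_hom]])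
  qed (simp add: Omega_map(2) \<theta>(2) u)
  show ?thesis
  proof (intro equalityI subsetI)
    fix m assume "m \<in> a_kernel T Bp.W \<psi>"
    then have m: "m \<in> carrier T" "\<psi> m = \<zero>\<^bsub>Bp.W\<^esub>"
      unfolding a_kernel_def kernel_def by simp_all
    obtain w where w: "w \<in> carrier W" "m = \<iota> w" using m(1) unfolding T_sel T0_carrier by blast
    \<comment> \<open>\<theta> sends \<psi>(m) to the class of m, so that class is zero once
      \<psi>(m) is.\<close>
    have "?pr m = \<theta> \<zero>\<^bsub>Bp.W\<^esub>"
      using \<theta>f[OF w(1)] \<psi>\<iota>[OF w(1)] m(2) unfolding f_def w(2) by simp
    also have "\<dots> = \<zero>\<^bsub>?Q\<^esub>" by (rule left_module_hom_zero[OF \<theta>(1) Bp.Omega_left_module Q])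
    finally show "m \<in> ?N"
      by (simp add: quot_module_proj_eq_zero_iff[OF T_V_module(1) N m(1)])
  next
    fix m assume "m \<in> ?N"
    then obtain x where x: "x \<in> J" "m = \<iota> (d x)"
      using \<phi>d by (auto simp: C_sel elim!: rE)
    have xc: "x \<in> carrier A" using x(1) by (rule J.Icarr)
    \<comment> \<open>The zero coset is written as the coset of the scalar 0, so that
      \<open>d_scal\<close> applies.\<close>
    have "q x = q (scal \<zero>\<^bsub>k\<^esub>)" using x(1) xc by (subst q_eq_iff) (simp_all add: a_minus_def)
    then have "\<psi> m = Bp.d (q (scal \<zero>\<^bsub>k\<^esub>))"
      unfolding x(2) using xc by (simp only: \<psi>\<iota> d_closed Omega_map(2))
    also have "\<dots> = Omega_map (d (scal \<zero>\<^bsub>k\<^esub>))" by (simp only: Omega_map(2) scal_closed k.zero_closed)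
    also have "\<dots> = \<zero>\<^bsub>Bp.W\<^esub>"
      using left_module_hom_zero[OF Omega_map(1) Omega_left_module
          restrict_scalars_left_module[OF Bp.Omega_left_module V_ring_ring qV_hom]]
      by (simp only: d_scal k.zero_closed restrict_scalars_sel)
    finally show "m \<in> a_kernel T Bp.W \<psi>"
      using \<iota>_closed[OF d_closed[OF xc]]
      unfolding a_kernel_def kernel_def x(2) by (simp add: T_sel)
  qed
qed

end

text \<open>Besides exactness the conclusion records how P acts on the first two modules. Their
  definitions use unions over representatives and a definite description, which by themselves do not
  show that the intended formulas hold.\<close>

theorem proposition2p11:
  fixes k :: "('k, 'u) ring_scheme" and p :: nat
    and A :: "('k, 'a, 'v) pd_alg_scheme" and J :: "'a set"
  assumes A: "pd_algebra k p A"
    and J: "p_ideal k A J"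
  defines "B \<equiv> pd_quot A J"
    and "V \<equiv> V_ring k p (pd_quot A J)"
    and "C \<equiv> conormal A J"
    and "T \<equiv> Omega_base_change k p A J"
    and "W \<equiv> Omega k p A"
    and "W' \<equiv> Omega k p (pd_quot A J)"
  shows
    "left_module V C \<and> left_module V T \<and> left_module V W' \<and>
     (\<forall>x\<in>J. V_P B \<odot>\<^bsub>C\<^esub> ((J \<cdot>\<^bsub>A\<^esub> J) +>\<^bsub>A\<^esub> x) = (J \<cdot>\<^bsub>A\<^esub> J) +>\<^bsub>A\<^esub> pmap A x) \<and>
     (\<forall>w\<in>carrier W. \<forall>a\<in>carrier A.
        V_P B \<odot>\<^bsub>T\<^esub> Omega_tensor_elt k p A J w (J +>\<^bsub>A\<^esub> a) =
        Omega_tensor_elt k p A J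
          (V_const A (a [^]\<^bsub>A\<^esub> p) \<odot>\<^bsub>W\<^esub> (V_P A \<odot>\<^bsub>W\<^esub> w)) (J +>\<^bsub>A\<^esub> \<one>\<^bsub>A\<^esub>)) \<and>
     (\<exists>\<phi> \<psi>.
        \<phi> \<in> left_module_hom V C T \<and>
        \<psi> \<in> left_module_hom V T W' \<and>
        (\<forall>x\<in>J. \<phi> ((J \<cdot>\<^bsub>A\<^esub> J) +>\<^bsub>A\<^esub> x) =
           Omega_tensor_elt k p A J (Omega_d k p A x) (J +>\<^bsub>A\<^esub> \<one>\<^bsub>A\<^esub>)) \<and>
        (\<forall>t\<in>carrier A. \<forall>a\<in>carrier A.
           \<psi> (Omega_tensor_elt k p A J (Omega_d k p A t) (J +>\<^bsub>A\<^esub> a)) =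
           V_const B (J +>\<^bsub>A\<^esub> a) \<odot>\<^bsub>W'\<^esub> Omega_d k p B (J +>\<^bsub>A\<^esub> t)) \<and>
        \<phi> ` carrier C = a_kernel T W' \<psi> \<and>
        \<psi> ` carrier T = carrier W')"
proof -
  interpret Q: pd_quotient k p A J
    using A J by (intro pd_quotient.intro pd_quotient_axioms.intro)
  obtain \<phi> where \<phi>: "\<phi> \<in> left_module_hom Q.VB Q.C Q.T" "\<And>x. x \<in> J \<Longrightarrow> \<phi> (Q.r x) = Q.\<iota> (Q.d x)"
    using Q.phi_exists by auto
  obtain \<psi> where \<psi>: "\<psi> \<in> left_module_hom Q.VB Q.T Q.Bp.W"
    "\<And>w X. \<lbrakk>w \<in> carrier Q.W; X \<in> carrier Q.B\<rbrakk> \<Longrightarrow>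
      \<psi> (Q.t w X) = V_const Q.B X \<odot>\<^bsub>Q.Bp.W\<^esub> Q.Omega_map w"
    and \<psi>\<iota>: "\<And>w. w \<in> carrier Q.W \<Longrightarrow> \<psi> (Q.\<iota> w) = Q.Omega_map w"
    using Q.psi_exists by auto
  have P: "V_P Q.B \<odot>\<^bsub>Q.T\<^esub> Q.t w (Q.q a) =
      Q.t (V_const A (a [^]\<^bsub>A\<^esub> p) \<odot>\<^bsub>Q.W\<^esub> (V_P A \<odot>\<^bsub>Q.W\<^esub> w)) (Q.q \<one>\<^bsub>A\<^esub>)"
    if "w \<in> carrier Q.W" "a \<in> carrier A" for w a
    using that by (simp only: Q.T_P Q.t_closed Q.AJ_closed Q.tensor_P_spec(2))
  have \<psi>d: "\<psi> (Q.t (Q.d b) (Q.q a)) = V_const Q.B (Q.q a) \<odot>\<^bsub>Q.Bp.W\<^esub> Q.Bp.d (Q.q b)"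
    if "b \<in> carrier A" "a \<in> carrier A" for a b
    using that by (simp only: \<psi>(2) Q.d_closed Q.q.hom_closed Q.Omega_map(2))
  show ?thesis
    unfolding B_def V_def C_def T_def W_def W'_def
    by (intro conjI exI[of _ \<phi>] exI[of _ \<psi>] ballI Q.C_left_module Q.T_V_module(1)
        Q.Bp.Omega_left_module Q.C_P P \<phi> \<psi>(1) \<psi>d Q.kernel_psi[OF \<phi> \<psi>(1) \<psi>\<iota>]
        Q.psi_surjective[OF \<psi>(1) \<psi>\<iota>])
qed

end
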